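(* Let $f=1+\sum_{|\alpha|\ge1}b_\alpha Z_\alpha$ be a formal power series with $b_\alpha>0$ such that $\sup_{\alpha}\frac{b_\alpha}{b_{g_i\alpha}}<\infty$ and $\sup_{\alpha}\frac{b_\alpha}{b_{\alpha g_i}}<\infty$ for every $i\in\{1,\ldots,n\}$, and let $\mathcal K$ be a Hilbert space. The right multiplier algebra $\mathcal M^r(F^2(f)\otimes\mathcal K)$ is completely isometrically isomorphic to the noncommutative Hardy algebra $R^\infty(f)\bar\otimes_{min}B(\mathcal K)$. Moreover, the map $\Psi:\mathcal M^r(F^2(f)\otimes\mathcal K)\to R^\infty(f)\bar\otimes_{min}B(\mathcal K)$ defined by $$\Psi(\varphi):=(U_f^*\otimes I_{\mathcal K})R_\varphi(U_f\otimes I_{\mathcal K}),\qquad\varphi\in\mathcal M^r(F^2(f)\otimes\mathcal K),$$ is a completely isometric isomorphism.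
   Context: $\mathbb F_n^+$ is the unital free semigroup on generators $g_1,\ldots,g_n$ with identity $g_0$; $|\alpha|$ is the length; $b_{g_0}=1$; for $\beta=g_{i_1}\cdots g_{i_p}$, $\tilde\beta:=g_{i_p}\cdots g_{i_1}$. $F^2(H_n)$ is the full Fock space with orthonormal basis $\{e_\alpha\}_{\alpha\in\mathbb F_n^+}$. $F^2(f)$ is the Hilbert space of formal power series $\zeta=\sum_\alpha c_\alpha Z_\alpha$ ($c_\alpha\in\mathbb C$) in noncommuting indeterminates with $\|\zeta\|^2=\sum_\alpha\frac1{b_\alpha}|c_\alpha|^2<\infty$; $\{\sqrt{b_\alpha}Z_\alpha\}$ is an orthonormal basis, and $U_f:F^2(H_n)\to F^2(f)$ is the unitary $U_fe_\alpha:=\sqrt{b_\alpha}Z_\alpha$. A formal power series $\varphi=\sum_\alpha Z_\alpha\otimes A_{(\alpha)}$, $A_{(\alpha)}\in B(\mathcal K)$, is a (twisted) right multiplier, $\varphi\in\mathcal M^r(F^2(f)\otimes\mathcal K)$, if for every $\zeta=\sum_\beta Z_\beta\otimes h_{(\beta)}\in F^2(f)\otimes\mathcal K$ one has $\zeta\varphi:=\sum_\gamma Z_\gamma\otimes\sum_{\beta\alpha=\gamma}A_{(\alpha)}h_{(\beta)}\in F^2(f)\otimes\mathcal K$. Then $R_\varphi\zeta:=\zeta\varphi$ is a bounded operator, and the multiplier norm is $\|R_\varphi\|$. The operator algebra structure (product and matrix norms) of $\mathcal M^r(F^2(f)\otimes\mathcal K)$ is the one obtained by identifying $\varphi$ with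 the operator $R_\varphi$. $R^\infty(f)$: the weighted right creation operators on $F^2(H_n)$ are $\Lambda_ie_\alpha=\sqrt{b_\alpha/b_{\alpha g_i}}\,e_{\alpha g_i}$, and $\Lambda_\beta=\Lambda_{i_1}\cdots\Lambda_{i_p}$ for $\beta=g_{i_1}\cdots g_{i_p}$. With $\mathcal P=\mathrm{span}\{e_\alpha\}$, consider formal sums $\sum_\beta c_{\tilde\beta}\Lambda_\beta$ with $\sum_\beta|c_\beta|^2\frac{b_\gamma}{b_{\gamma\beta}}<\infty$ for each $\gamma$ and $\sup_{p\in\mathcal P,\|p\|\le1}\|\sum_\beta c_{\tilde\beta}\Lambda_\beta(p)\|<\infty$. Each determines a unique bounded operator on $F^2(H_n)$ agreeing with $p\mapsto\sum_\beta c_{\tilde\beta}\Lambda_\beta(p)$ on $\mathcal P$; $R^\infty(f)$ is the algebra of all such operators. $R^\infty(f)\bar\otimes_{min}B(\mathcal K)$ denotes the WOT-closure in $B(F^2(H_n)\otimes\mathcal K)$ of the spatial tensor product $R^\infty(f)\otimes_{min}B(\mathcal K)$. *)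

theory Defs
  imports "HOL-Analysis.Analysis"
begin

subsection \<open>Complex Hilbert spaces\<close>

text \<open>The inner product is linear in the first argument.\<close>

class chilbert = banach +
  fixes scaleC :: "complex \<Rightarrow> 'a \<Rightarrow> 'a" (infixr \<open>*\<^sub>C\<close> 75)
    and cinner :: "'a \<Rightarrow> 'a \<Rightarrow> complex"
  assumes scaleC_add_right: "c *\<^sub>C (x + y) = c *\<^sub>C x + c *\<^sub>C y"
    and scaleC_add_left: "(c + d) *\<^sub>C x = c *\<^sub>C x + d *\<^sub>C x"
    and scaleC_scaleC: "c *\<^sub>C (d *\<^sub>C x) = (c * d) *\<^sub>C x"
    and scaleC_of_real: "complex_of_real r *\<^sub>C x = r *\<^sub>R x"
    and cinner_commute: "cinner x y = cnj (cinner y x)"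
    and cinner_add_left: "cinner (x + y) z = cinner x z + cinner y z"
    and cinner_scaleC_left: "cinner (c *\<^sub>C x) y = c * cinner x y"
    and cinner_self: "cinner x x = complex_of_real ((norm x)\<^sup>2)"

instantiation complex :: chilbert
begin

definition scaleC_complex :: "complex \<Rightarrow> complex \<Rightarrow> complex" where
  "scaleC_complex c x = c * x"

definition cinner_complex :: "complex \<Rightarrow> complex \<Rightarrow> complex" where
  "cinner_complex x y = x * cnj y"

instance
proof
  fix x :: complex
  show "cinner x x = complex_of_real ((norm x)\<^sup>2)"
    by (simp add: cinner_complex_def complex_norm_square del: of_real_power)
qed (simp_all add: scaleC_complex_def cinner_complex_def algebra_simps scaleR_conv_of_real)

end

text \<open>The elements of \<open>B(\<K>)\<close>.\<close>

definition bounded_clinear :: "('k::chilbert \<Rightarrow> 'k) \<Rightarrow> bool" where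
  "bounded_clinear A \<longleftrightarrow> bounded_linear A \<and> (\<forall>c x. A (c *\<^sub>C x) = c *\<^sub>C A x)"

subsection \<open>The spaces \<open>F\<^sup>2(f) \<otimes> \<K>\<close> and \<open>F\<^sup>2(H\<^sub>n) \<otimes> \<K>\<close>\<close>

text \<open>
  A word \<open>g\<^bsub>i\<^sub>1\<^esub> \<dots> g\<^bsub>i\<^sub>p\<^esub>\<close> of the free semigroup on \<open>n = CARD('n)\<close> generators is the list
  \<open>[i\<^sub>1, \<dots>, i\<^sub>p] :: 'n list\<close>; thus \<open>g\<^sub>0 = []\<close>, the product is \<open>@\<close>, and the reversed word is \<open>rev\<close>.

  An element \<open>\<Sum> Z\<^sub>\<alpha> \<otimes> h\<^sub>\<alpha>\<close> of \<open>F\<^sup>2(f) \<otimes> \<K>\<close> is the family of its coefficients \<open>h\<^sub>\<alpha>\<close>. The vectors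
  \<open>Z\<^sub>\<alpha>\<close> are orthogonal with \<open>\<parallel>Z\<^sub>\<alpha>\<parallel>\<^sup>2 = 1/b\<^sub>\<alpha>\<close>, whence the norm below. For \<open>\<K> = \<complex>\<close> this is
  \<open>F\<^sup>2(f)\<close> itself, and for the constant weight 1 it is \<open>F\<^sup>2(H\<^sub>n) \<otimes> \<K>\<close>, with coefficients taken with
  respect to the orthonormal basis \<open>e\<^sub>\<alpha>\<close>.
\<close>

definition F2 :: "('n list \<Rightarrow> real) \<Rightarrow> ('n list \<Rightarrow> 'k::chilbert) set" where
  "F2 b = {\<zeta>. (\<lambda>\<alpha>. (norm (\<zeta> \<alpha>))\<^sup>2 / b \<alpha>) summable_on UNIV}"

definition F2_norm :: "('n list \<Rightarrow> real) \<Rightarrow> ('n list \<Rightarrow> 'k::chilbert) \<Rightarrow> real" where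
  "F2_norm b \<zeta> = sqrt (\<Sum>\<^sub>\<infinity>\<alpha>. (norm (\<zeta> \<alpha>))\<^sup>2 / b \<alpha>)"

definition F2_inner ::
    "('n list \<Rightarrow> real) \<Rightarrow> ('n list \<Rightarrow> 'k::chilbert) \<Rightarrow> ('n list \<Rightarrow> 'k) \<Rightarrow> complex" where
  "F2_inner b \<zeta> \<eta> = (\<Sum>\<^sub>\<infinity>\<alpha>. cinner (\<zeta> \<alpha>) (\<eta> \<alpha>) / complex_of_real (b \<alpha>))"

abbreviation fock_weight :: "'n list \<Rightarrow> real" where
  "fock_weight \<equiv> (\<lambda>_. 1)"

abbreviation Fock :: "('n list \<Rightarrow> 'k::chilbert) set" where
  "Fock \<equiv> F2 fock_weight"

subsection \<open>Bounded operators\<close>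

text \<open>
  Operators are extensional functions on their domain (value \<open>undefined\<close> outside), so that equality
  of functions is equality of operators.
\<close>

definition bop :: "('n list \<Rightarrow> real) \<Rightarrow> ('n list \<Rightarrow> real) \<Rightarrow>
    (('n list \<Rightarrow> 'k::chilbert) \<Rightarrow> ('n list \<Rightarrow> 'k)) set" where
  "bop b c = {T \<in> F2 b \<rightarrow>\<^sub>E F2 c.
     (\<forall>x\<in>F2 b. \<forall>y\<in>F2 b. T (\<lambda>\<alpha>. x \<alpha> + y \<alpha>) = (\<lambda>\<alpha>. T x \<alpha> + T y \<alpha>)) \<and>
     (\<forall>a. \<forall>x\<in>F2 b. T (\<lambda>\<alpha>. a *\<^sub>C x \<alpha>) = (\<lambda>\<alpha>. a *\<^sub>C T x \<alpha>)) \<and>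
     (\<exists>C. \<forall>x\<in>F2 b. F2_norm c (T x) \<le> C * F2_norm b x)}"

definition adjoint_op :: "('n list \<Rightarrow> real) \<Rightarrow> ('n list \<Rightarrow> real) \<Rightarrow>
    (('n list \<Rightarrow> 'k::chilbert) \<Rightarrow> ('n list \<Rightarrow> 'k)) \<Rightarrow> (('n list \<Rightarrow> 'k) \<Rightarrow> ('n list \<Rightarrow> 'k))" where
  "adjoint_op b c T = (THE S. S \<in> bop c b \<and>
     (\<forall>x\<in>F2 b. \<forall>y\<in>F2 c. F2_inner c (T x) y = F2_inner b x (S y)))"

text \<open>
  The norm of an \<open>m \<times> m\<close> matrix of operators on \<open>F2 b\<close>, acting on the \<open>m\<close>-fold Hilbert space
  direct sum of \<open>F2 b\<close>. The usual operator norm is the case \<open>m = 1\<close>.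
\<close>

definition matrix_op_norm :: "('n list \<Rightarrow> real) \<Rightarrow> nat \<Rightarrow>
    (nat \<Rightarrow> nat \<Rightarrow> ('n list \<Rightarrow> 'k::chilbert) \<Rightarrow> ('n list \<Rightarrow> 'k)) \<Rightarrow> real" where
  "matrix_op_norm b m T =
     (SUP x \<in> {x. (\<forall>j<m. x j \<in> F2 b) \<and> (\<Sum>j<m. (F2_norm b (x j))\<^sup>2) \<le> 1}.
        sqrt (\<Sum>i<m. (F2_norm b (\<lambda>\<alpha>. \<Sum>j<m. T i j (x j) \<alpha>))\<^sup>2))"

definition tensor_vec :: "('n list \<Rightarrow> complex) \<Rightarrow> 'k::chilbert \<Rightarrow> ('n list \<Rightarrow> 'k)" where
  "tensor_vec \<xi> h = (\<lambda>\<alpha>. \<xi> \<alpha> *\<^sub>C h)"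

text \<open>\<open>T = A \<otimes> B\<close>; there is at most one such \<open>T\<close>, as elementary tensors have dense linear span.\<close>

definition is_tensor_op :: "('n list \<Rightarrow> real) \<Rightarrow> ('n list \<Rightarrow> real) \<Rightarrow>
    (('n list \<Rightarrow> complex) \<Rightarrow> ('n list \<Rightarrow> complex)) \<Rightarrow> ('k::chilbert \<Rightarrow> 'k) \<Rightarrow>
    (('n list \<Rightarrow> 'k) \<Rightarrow> ('n list \<Rightarrow> 'k)) \<Rightarrow> bool" where
  "is_tensor_op b c A B T \<longleftrightarrow>
     T \<in> bop b c \<and> (\<forall>\<xi>\<in>F2 b. \<forall>h. T (tensor_vec \<xi> h) = tensor_vec (A \<xi>) (B h))"

definition tensor_op :: "('n list \<Rightarrow> real) \<Rightarrow> ('n list \<Rightarrow> real) \<Rightarrow>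
    (('n list \<Rightarrow> complex) \<Rightarrow> ('n list \<Rightarrow> complex)) \<Rightarrow> ('k::chilbert \<Rightarrow> 'k) \<Rightarrow>
    (('n list \<Rightarrow> 'k) \<Rightarrow> ('n list \<Rightarrow> 'k))" where
  "tensor_op b c A B = (THE T. is_tensor_op b c A B T)"

subsection \<open>Operator algebras and complete isometries\<close>

record 'x operator_algebra =
  oa_carrier :: "'x set"
  oa_add :: "'x \<Rightarrow> 'x \<Rightarrow> 'x"
  oa_scale :: "complex \<Rightarrow> 'x \<Rightarrow> 'x"
  oa_mult :: "'x \<Rightarrow> 'x \<Rightarrow> 'x"
  oa_norm :: "nat \<Rightarrow> (nat \<Rightarrow> nat \<Rightarrow> 'x) \<Rightarrow> real"

definition oa_closed :: "'x operator_algebra \<Rightarrow> bool" where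
  "oa_closed \<A> \<longleftrightarrow>
     (\<forall>x\<in>oa_carrier \<A>. \<forall>y\<in>oa_carrier \<A>. oa_add \<A> x y \<in> oa_carrier \<A>) \<and>
     (\<forall>a. \<forall>x\<in>oa_carrier \<A>. oa_scale \<A> a x \<in> oa_carrier \<A>) \<and>
     (\<forall>x\<in>oa_carrier \<A>. \<forall>y\<in>oa_carrier \<A>. oa_mult \<A> x y \<in> oa_carrier \<A>)"

definition completely_isometric_isomorphism ::
    "'x operator_algebra \<Rightarrow> 'y operator_algebra \<Rightarrow> ('x \<Rightarrow> 'y) \<Rightarrow> bool" where
  "completely_isometric_isomorphism \<A> \<B> \<Phi> \<longleftrightarrow>
     oa_closed \<A> \<and> oa_closed \<B> \<and>
     bij_betw \<Phi> (oa_carrier \<A>) (oa_carrier \<B>) \<and>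
     (\<forall>x\<in>oa_carrier \<A>. \<forall>y\<in>oa_carrier \<A>. \<Phi> (oa_add \<A> x y) = oa_add \<B> (\<Phi> x) (\<Phi> y)) \<and>
     (\<forall>a. \<forall>x\<in>oa_carrier \<A>. \<Phi> (oa_scale \<A> a x) = oa_scale \<B> a (\<Phi> x)) \<and>
     (\<forall>x\<in>oa_carrier \<A>. \<forall>y\<in>oa_carrier \<A>. \<Phi> (oa_mult \<A> x y) = oa_mult \<B> (\<Phi> x) (\<Phi> y)) \<and>
     (\<forall>m X. (\<forall>i<m. \<forall>j<m. X i j \<in> oa_carrier \<A>) \<longrightarrow>
        oa_norm \<B> m (\<lambda>i j. \<Phi> (X i j)) = oa_norm \<A> m X)"

definition completely_isometrically_isomorphic ::
    "'x operator_algebra \<Rightarrow> 'y operator_algebra \<Rightarrow> bool" where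
  "completely_isometrically_isomorphic \<A> \<B> \<longleftrightarrow>
     (\<exists>\<Phi>. completely_isometric_isomorphism \<A> \<B> \<Phi>)"

text \<open>A set of operators on \<open>F\<^sup>2(H\<^sub>n) \<otimes> \<K>\<close> with the structure inherited from \<open>B(F\<^sup>2(H\<^sub>n) \<otimes> \<K>)\<close>.\<close>

definition concrete_operator_algebra ::
    "(('n list \<Rightarrow> 'k::chilbert) \<Rightarrow> ('n list \<Rightarrow> 'k)) set \<Rightarrow>
     (('n list \<Rightarrow> 'k) \<Rightarrow> ('n list \<Rightarrow> 'k)) operator_algebra" where
  "concrete_operator_algebra S =
     \<lparr>oa_carrier = S,
      oa_add = (\<lambda>T T'. \<lambda>x\<in>Fock. \<lambda>\<alpha>. T x \<alpha> + T' x \<alpha>),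
      oa_scale = (\<lambda>a T. \<lambda>x\<in>Fock. \<lambda>\<alpha>. a *\<^sub>C T x \<alpha>),
      oa_mult = compose Fock,
      oa_norm = matrix_op_norm fock_weight\<rparr>"

subsection \<open>Right multipliers\<close>

text \<open>The formal power series \<open>\<zeta>\<phi>\<close>; the sum ranges over the finitely many factorizations of \<open>\<gamma>\<close>.\<close>

definition series_mult ::
    "('n list \<Rightarrow> 'k::chilbert) \<Rightarrow> ('n list \<Rightarrow> 'k \<Rightarrow> 'k) \<Rightarrow> ('n list \<Rightarrow> 'k)" where
  "series_mult \<zeta> \<phi> = (\<lambda>\<gamma>. \<Sum>(\<beta>, \<alpha>) | \<beta> @ \<alpha> = \<gamma>. \<phi> \<alpha> (\<zeta> \<beta>))"

definition right_multipliers ::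
    "('n list \<Rightarrow> real) \<Rightarrow> ('n list \<Rightarrow> 'k::chilbert \<Rightarrow> 'k) set" where
  "right_multipliers b =
     {\<phi>. (\<forall>\<alpha>. bounded_clinear (\<phi> \<alpha>)) \<and> (\<forall>\<zeta>\<in>F2 b. series_mult \<zeta> \<phi> \<in> F2 b)}"

definition R_op :: "('n list \<Rightarrow> real) \<Rightarrow> ('n list \<Rightarrow> 'k::chilbert \<Rightarrow> 'k) \<Rightarrow>
    (('n list \<Rightarrow> 'k) \<Rightarrow> ('n list \<Rightarrow> 'k))" where
  "R_op b \<phi> = (\<lambda>\<zeta>\<in>F2 b. series_mult \<zeta> \<phi>)"

text \<open>
  Product and matrix norms are transported along \<open>\<phi> \<mapsto> R\<^sub>\<phi>\<close>: the product of \<open>\<phi>\<close> and \<open>\<psi>\<close> is the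
  multiplier \<open>\<chi>\<close> with \<open>R\<^sub>\<chi> = R\<^sub>\<phi> R\<^sub>\<psi>\<close>.
\<close>

definition right_multiplier_algebra ::
    "('n list \<Rightarrow> real) \<Rightarrow> ('n list \<Rightarrow> 'k::chilbert \<Rightarrow> 'k) operator_algebra" where
  "right_multiplier_algebra b =
     \<lparr>oa_carrier = right_multipliers b,
      oa_add = (\<lambda>\<phi> \<psi>. \<lambda>\<alpha> h. \<phi> \<alpha> h + \<psi> \<alpha> h),
      oa_scale = (\<lambda>a \<phi>. \<lambda>\<alpha> h. a *\<^sub>C \<phi> \<alpha> h),
      oa_mult = (\<lambda>\<phi> \<psi>. inv_into (right_multipliers b) (R_op b)
                          (compose (F2 b) (R_op b \<phi>) (R_op b \<psi>))),
      oa_norm = (\<lambda>m X. matrix_op_norm b m (\<lambda>i j. R_op b (X i j)))\<rparr>"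

subsection \<open>The algebra \<open>R\<^sup>\<infinity>(f)\<close>\<close>

definition fock_e :: "'n list \<Rightarrow> ('n list \<Rightarrow> complex)" where
  "fock_e \<alpha> = (\<lambda>\<gamma>. if \<gamma> = \<alpha> then 1 else 0)"

definition Lambda :: "('n list \<Rightarrow> real) \<Rightarrow> 'n \<Rightarrow> ('n list \<Rightarrow> complex) \<Rightarrow> ('n list \<Rightarrow> complex)" where
  "Lambda b i \<xi> = (\<lambda>\<gamma>. if \<gamma> \<noteq> [] \<and> last \<gamma> = i
     then complex_of_real (sqrt (b (butlast \<gamma>) / b \<gamma>)) * \<xi> (butlast \<gamma>) else 0)"

lemma Lambda_fock_e:
  "Lambda b i (fock_e \<alpha>) =
     (\<lambda>\<gamma>. complex_of_real (sqrt (b \<alpha> / b (\<alpha> @ [i]))) * fock_e (\<alpha> @ [i]) \<gamma>)"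
proof
  fix \<gamma>
  show "Lambda b i (fock_e \<alpha>) \<gamma> =
     complex_of_real (sqrt (b \<alpha> / b (\<alpha> @ [i]))) * fock_e (\<alpha> @ [i]) \<gamma>"
    by (cases \<gamma> rule: rev_cases) (auto simp: Lambda_def fock_e_def)
qed

text \<open>\<open>\<Lambda>\<^sub>\<beta> = \<Lambda>\<^bsub>i\<^sub>1\<^esub> \<dots> \<Lambda>\<^bsub>i\<^sub>p\<^esub>\<close>\<close>

definition Lambda_word ::
    "('n list \<Rightarrow> real) \<Rightarrow> 'n list \<Rightarrow> ('n list \<Rightarrow> complex) \<Rightarrow> ('n list \<Rightarrow> complex)" where
  "Lambda_word b \<beta> = foldr (\<lambda>i T. Lambda b i \<circ> T) \<beta> id"

text \<open>The span of the vectors \<open>e\<^sub>\<alpha>\<close>.\<close>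

definition fock_polynomials :: "('n list \<Rightarrow> complex) set" where
  "fock_polynomials = {p. finite {\<alpha>. p \<alpha> \<noteq> 0}}"

text \<open>
  The value at \<open>p\<close> of the formal sum with coefficients \<open>c\<close>, computed coordinatewise: since
  \<open>\<Lambda>\<^sub>\<beta> e\<^sub>\<gamma>\<close> is a multiple of \<open>e\<close> at \<open>\<gamma> @ rev \<beta>\<close>, each coordinate of the sum has only finitely many
  nonzero terms.
\<close>

definition formal_Lambda_sum :: "('n list \<Rightarrow> real) \<Rightarrow> ('n list \<Rightarrow> complex) \<Rightarrow>
    ('n list \<Rightarrow> complex) \<Rightarrow> ('n list \<Rightarrow> complex)" where
  "formal_Lambda_sum b c p = (\<lambda>\<delta>. \<Sum>\<^sub>\<infinity>\<beta>. c (rev \<beta>) * Lambda_word b \<beta> p \<delta>)"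

definition R_infty ::
    "('n list \<Rightarrow> real) \<Rightarrow> (('n list \<Rightarrow> complex) \<Rightarrow> ('n list \<Rightarrow> complex)) set" where
  "R_infty b = {T \<in> bop fock_weight fock_weight. \<exists>c.
     (\<forall>\<gamma>. (\<lambda>\<beta>. (cmod (c \<beta>))\<^sup>2 * (b \<gamma> / b (\<gamma> @ \<beta>))) summable_on UNIV) \<and>
     bdd_above ((\<lambda>p. F2_norm fock_weight (formal_Lambda_sum b c p)) `
       {p \<in> fock_polynomials. F2_norm fock_weight p \<le> 1}) \<and>
     (\<forall>p\<in>fock_polynomials. T p = formal_Lambda_sum b c p)}"

subsection \<open>Spatial tensor products and their WOT-closures\<close>

definition algebraic_tensor ::
    "(('n list \<Rightarrow> complex) \<Rightarrow> ('n list \<Rightarrow> complex)) set \<Rightarrow>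
     (('n list \<Rightarrow> 'k::chilbert) \<Rightarrow> ('n list \<Rightarrow> 'k)) set" where
  "algebraic_tensor \<A> = {\<lambda>x\<in>Fock. \<lambda>\<alpha>. \<Sum>l<r. S l x \<alpha> | (r::nat) S.
     \<forall>l<r. \<exists>A\<in>\<A>. \<exists>B. bounded_clinear B \<and> is_tensor_op fock_weight fock_weight A B (S l)}"

definition op_norm_closure ::
    "(('n list \<Rightarrow> 'k::chilbert) \<Rightarrow> ('n list \<Rightarrow> 'k)) set \<Rightarrow>
     (('n list \<Rightarrow> 'k) \<Rightarrow> ('n list \<Rightarrow> 'k)) set" where
  "op_norm_closure \<S> = {T \<in> bop fock_weight fock_weight. \<forall>\<epsilon>>0. \<exists>S\<in>\<S>. \<forall>x\<in>Fock.
     F2_norm fock_weight (\<lambda>\<alpha>. T x \<alpha> - S x \<alpha>) \<le> \<epsilon> * F2_norm fock_weight x}"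

definition wot_closure ::
    "(('n list \<Rightarrow> 'k::chilbert) \<Rightarrow> ('n list \<Rightarrow> 'k)) set \<Rightarrow>
     (('n list \<Rightarrow> 'k) \<Rightarrow> ('n list \<Rightarrow> 'k)) set" where
  "wot_closure \<S> = {T \<in> bop fock_weight fock_weight.
     \<forall>P. finite P \<and> P \<subseteq> Fock \<times> Fock \<longrightarrow> (\<forall>\<epsilon>>0. \<exists>S\<in>\<S>. \<forall>(x, y)\<in>P.
       cmod (F2_inner fock_weight (\<lambda>\<alpha>. T x \<alpha> - S x \<alpha>) y) < \<epsilon>)}"

text \<open>The first closure is the spatial tensor product of \<open>R\<^sup>\<infinity>(f)\<close> and \<open>B(\<K>)\<close>.\<close>

definition hardy_algebra :: "('n list \<Rightarrow> real) \<Rightarrow>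
    (('n list \<Rightarrow> 'k::chilbert) \<Rightarrow> ('n list \<Rightarrow> 'k)) operator_algebra" where
  "hardy_algebra b =
     concrete_operator_algebra (wot_closure (op_norm_closure (algebraic_tensor (R_infty b))))"

subsection \<open>The map \<open>\<Psi>\<close>\<close>

definition U_op :: "('n list \<Rightarrow> real) \<Rightarrow> ('n list \<Rightarrow> complex) \<Rightarrow> ('n list \<Rightarrow> complex)" where
  "U_op b = (\<lambda>\<xi>\<in>Fock. \<lambda>\<alpha>. complex_of_real (sqrt (b \<alpha>)) * \<xi> \<alpha>)"

definition Psi :: "('n list \<Rightarrow> real) \<Rightarrow> ('n list \<Rightarrow> 'k::chilbert \<Rightarrow> 'k) \<Rightarrow>
    (('n list \<Rightarrow> 'k) \<Rightarrow> ('n list \<Rightarrow> 'k))" where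
  "Psi b \<phi> =
     compose Fock (tensor_op b fock_weight (adjoint_op fock_weight b (U_op b)) id)
       (compose Fock (R_op b \<phi>) (tensor_op fock_weight b (U_op b) id))"

end

theory Submission
  imports Defs
begin

text \<open>
  In the orthonormal bases, \<open>\<Psi>(\<phi>)\<close> has the operator matrix with entry
  \<open>\<surd>(b\<^sub>\<beta> / b\<^sub>\<gamma>) \<phi>\<^sub>\<alpha>\<close> at \<open>(\<gamma>, \<beta>)\<close> if \<open>\<gamma> = \<beta>\<alpha>\<close> and 0 otherwise, and it is bounded by the
  uniform boundedness principle. The entries in the first column determine all others through equations
  that hold for \<open>R\<^sup>\<infinity>(f) \<otimes> B(\<K>)\<close> and are preserved under weak limits, so every element of the Hardy
  algebra is some \<open>\<Psi>(\<phi>)\<close>. Conversely the Fejer means of \<open>\<Psi>(\<phi>)\<close> are finite sums of elementary tensors,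
  bounded by \<open>\<parallel>\<Psi>(\<phi>)\<parallel>\<close>, and converge to \<open>\<Psi>(\<phi>)\<close> entrywise, hence weakly.
\<close>

subsection \<open>Families of square-summable vectors\<close>

text \<open>\<open>Psi b\<close> is conjugation by a unitary that merely rescales coordinates, so
  multiplicativity and equality of all matrix norms come at once; the content is the description of
  its range. Partial sums of a multiplier series need not be uniformly bounded, which is why Fejer
  means appear: averaging keeps the bound, and the bound is what upgrades entrywise convergence to
  weak convergence. As there are finitely many letters, a Fejer mean involves finitely many words,
  and the bounds on the ratios \<open>b \<alpha> / b (\<alpha> @ [i])\<close> make each monomial
  term a bounded operator. Averaging over windows of word lengths takes the place of integration
  over a circle action, so that only finite sums occur. In the other direction the approximating
  operators come with no norm bound, hence only relations between finitely many entries can be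
  carried to the limit.\<close>

lemma norm_scaleC: "norm (c *\<^sub>C (x::'k::chilbert)) = cmod c * norm x"
proof -
  have "complex_of_real ((norm (c *\<^sub>C x))\<^sup>2) = c * cnj (cinner (c *\<^sub>C x) x)"
    by (metis cinner_self cinner_scaleC_left cinner_commute)
  also have "\<dots> = (c * cnj c) * cnj (cinner x x)"
    by (simp add: cinner_scaleC_left)
  also have "\<dots> = complex_of_real ((cmod c * norm x)\<^sup>2)"
    by (simp add: cinner_self complex_norm_square power_mult_distrib mult.commute del: of_real_power)
  finally have "(norm (c *\<^sub>C x))\<^sup>2 = (cmod c * norm x)\<^sup>2"
    using of_real_eq_iff by blast
  then show ?thesis by (simp add: power2_eq_iff_nonneg)
qed

lemma scaleC_zero_right [simp]: "c *\<^sub>C (0::'k::chilbert) = 0"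
  and scaleC_zero_left [simp]: "0 *\<^sub>C (x::'k::chilbert) = 0"
  and scaleC_one [simp]: "1 *\<^sub>C (x::'k::chilbert) = x"
  using norm_scaleC[of c 0] norm_scaleC[of 0 x] scaleC_of_real[of 1 x] by simp_all

lemma scaleC_sum_right: "c *\<^sub>C sum f A = (\<Sum>i\<in>A. c *\<^sub>C (f i :: 'k::chilbert))"
  by (induction A rule: infinite_finite_induct) (auto simp: scaleC_add_right)

lemma scaleC_scaleR: "c *\<^sub>C (r *\<^sub>R x) = r *\<^sub>R (c *\<^sub>C (x::'k::chilbert))"
  by (simp add: scaleC_scaleC mult.commute flip: scaleC_of_real)

lemma cinner_zero_left [simp]: "cinner 0 (y::'k::chilbert) = 0"
  and cinner_zero_right [simp]: "cinner (y::'k::chilbert) 0 = 0"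
proof -
  show *: "cinner 0 y = 0" for y :: 'k
    using cinner_scaleC_left[of 0 0 y] by simp
  show "cinner y 0 = 0" by (metis * cinner_commute complex_cnj_zero)
qed

lemma cinner_diff_left: "cinner (x - y) (z::'k::chilbert) = cinner x z - cinner y z"
  using cinner_add_left[of "x - y" y z] by simp

lemma cinner_scaleR_left: "cinner (r *\<^sub>R x) (z::'k::chilbert) = complex_of_real r * cinner x z"
  by (simp add: cinner_scaleC_left flip: scaleC_of_real)

lemma cinner_scaleR_right: "cinner z (r *\<^sub>R (x::'k::chilbert)) = complex_of_real r * cinner z x"
  by (metis cinner_commute cinner_scaleR_left complex_cnj_complex_of_real complex_cnj_mult)

lemma cinner_Cauchy_Schwarz: "cmod (cinner x (y::'k::chilbert)) \<le> norm x * norm y"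
proof (cases "y = 0")
  case False
  define c where "c = cinner x y / complex_of_real ((norm y)\<^sup>2)"
  have ny: "complex_of_real ((norm y)\<^sup>2) \<noteq> 0" using False by simp
  have "cinner (x - c *\<^sub>C y) y = 0"
    using ny by (simp add: cinner_diff_left cinner_scaleC_left cinner_self c_def)
  then have "cinner (c *\<^sub>C y) (x - c *\<^sub>C y) = 0"
    by (metis cinner_commute cinner_scaleC_left complex_cnj_zero mult_zero_right)
  then have "complex_of_real ((norm (x - c *\<^sub>C y))\<^sup>2) = cinner x (x - c *\<^sub>C y)"
    by (metis cinner_self cinner_diff_left diff_zero)
  also have "\<dots> = cnj (cinner x x - c * cinner y x)"
    by (metis cinner_commute cinner_diff_left cinner_scaleC_left)
  also have "\<dots> = complex_of_real ((norm x)\<^sup>2) - cnj c * cinner x y"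
    by (metis cinner_commute cinner_self complex_cnj_complex_of_real complex_cnj_diff complex_cnj_mult)
  also have "cnj c * cinner x y = complex_of_real ((cmod (cinner x y))\<^sup>2 / (norm y)\<^sup>2)"
    by (simp add: c_def complex_norm_square mult.commute del: of_real_power)
  finally have "(norm (x - c *\<^sub>C y))\<^sup>2 = (norm x)\<^sup>2 - (cmod (cinner x y))\<^sup>2 / (norm y)\<^sup>2"
    by (metis of_real_diff of_real_eq_iff)
  then have "(cmod (cinner x y))\<^sup>2 / (norm y)\<^sup>2 \<le> (norm x)\<^sup>2"
    by (smt (verit) zero_le_power2)
  then have "(cmod (cinner x y))\<^sup>2 \<le> (norm x * norm y)\<^sup>2"
    using False by (simp add: field_simps power_mult_distrib)
  then show ?thesis by (meson mult_nonneg_nonneg norm_ge_zero power2_le_imp_le)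
qed simp

lemma bounded_clinear_add: "bounded_clinear A \<Longrightarrow> A (x + y) = A x + A y"
  by (simp add: bounded_clinear_def bounded_linear.linear linear_add)

lemma bounded_clinear_scaleC: "bounded_clinear A \<Longrightarrow> A (c *\<^sub>C x) = c *\<^sub>C A x"
  by (simp add: bounded_clinear_def)

lemma bounded_clinear_scaleR: "bounded_clinear A \<Longrightarrow> A (r *\<^sub>R x) = r *\<^sub>R A x"
  by (simp add: bounded_clinear_def bounded_linear.linear linear_cmul)

lemma bounded_clinear_zero: "bounded_clinear A \<Longrightarrow> A 0 = 0"
  by (simp add: bounded_clinear_def bounded_linear.linear linear_0)

lemma bounded_clinear_sum: "bounded_clinear A \<Longrightarrow> A (sum f S) = (\<Sum>i\<in>S. A (f i))"
  by (simp add: bounded_clinear_def bounded_linear.linear linear_sum)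

lemma bounded_clinear_bound:
  assumes "bounded_clinear A"
  obtains K where "K \<ge> 0" "\<And>x. norm (A x) \<le> K * norm x"
proof -
  obtain K where "K \<ge> 0" "\<forall>x. norm (A x) \<le> norm x * K"
    using assms bounded_linear.nonneg_bounded[of A] unfolding bounded_clinear_def by blast
  then show ?thesis using that[of K] by (simp add: mult.commute)
qed

lemma bounded_clinear_plus:
  "bounded_clinear A \<Longrightarrow> bounded_clinear B \<Longrightarrow> bounded_clinear (\<lambda>h. A h + B h)"
  by (auto simp: bounded_clinear_def bounded_linear_add scaleC_add_right)

lemma bounded_linear_scaleC_right: "bounded_linear (\<lambda>x::'k::chilbert. c *\<^sub>C x)"
  by (rule bounded_linear_intro[of _ "cmod c"])
    (simp_all add: scaleC_add_right scaleC_scaleR norm_scaleC mult.commute)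

lemma bounded_clinear_scale: "bounded_clinear A \<Longrightarrow> bounded_clinear (\<lambda>h. c *\<^sub>C A h)"
  by (auto simp: bounded_clinear_def scaleC_scaleC mult.commute
      intro: bounded_linear_compose[OF bounded_linear_scaleC_right])

lemma bounded_clinear_scaleR_fun: "bounded_clinear A \<Longrightarrow> bounded_clinear (\<lambda>h. r *\<^sub>R A h)"
  by (simp add: bounded_clinear_scale flip: scaleC_of_real)

lemma bounded_clinear_comp:
  "bounded_clinear A \<Longrightarrow> bounded_clinear B \<Longrightarrow> bounded_clinear (\<lambda>h. A (B h))"
  by (auto simp: bounded_clinear_def intro: bounded_linear_compose)

lemma bounded_clinear_const_zero: "bounded_clinear (\<lambda>_. 0)"
  by (simp add: bounded_clinear_def)

lemma bounded_clinear_sum_fun: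
  "(\<And>i. i \<in> S \<Longrightarrow> bounded_clinear (A i)) \<Longrightarrow> bounded_clinear (\<lambda>h. \<Sum>i\<in>S. A i h)"
  by (induction S rule: infinite_finite_induct)
    (auto simp: bounded_clinear_const_zero bounded_clinear_plus)

lemma bounded_clinear_id: "bounded_clinear id"
  by (simp add: bounded_clinear_def id_def bounded_linear_ident)

section \<open>Weighted Hilbert sums indexed by words\<close>

context
  fixes b :: "'n list \<Rightarrow> real"
  assumes pos: "\<And>\<alpha>. b \<alpha> > 0"
begin

lemma F2_norm_nonneg: "0 \<le> F2_norm b x"
  using pos by (auto simp: F2_norm_def infsum_nonneg less_imp_le)

lemma F2_norm_square: "(F2_norm b x)\<^sup>2 = (\<Sum>\<^sub>\<infinity>\<alpha>. (norm (x \<alpha>))\<^sup>2 / b \<alpha>)"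
  using pos by (simp add: F2_norm_def infsum_nonneg less_imp_le)

lemma L2_set_weighted:
  "L2_set (\<lambda>\<alpha>. norm (x \<alpha>) / sqrt (b \<alpha>)) F = sqrt (\<Sum>\<alpha>\<in>F. (norm (x \<alpha>))\<^sup>2 / b \<alpha>)"
  using pos by (simp add: L2_set_def power_divide less_imp_le)

lemma F2_sum_le:
  assumes "x \<in> F2 b" "finite F"
  shows "(\<Sum>\<alpha>\<in>F. (norm (x \<alpha>))\<^sup>2 / b \<alpha>) \<le> (F2_norm b x)\<^sup>2"
  unfolding F2_norm_square
  by (rule finite_sum_le_infsum) (use assms pos in \<open>auto simp: F2_def less_imp_le\<close>)

lemma F2_L2_set_le:
  assumes "x \<in> F2 b"
  shows "L2_set (\<lambda>\<alpha>. norm (x \<alpha>) / sqrt (b \<alpha>)) F \<le> F2_norm b x"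
proof (cases "finite F")
  case True
  then show ?thesis
    using real_sqrt_le_mono[OF F2_sum_le[OF assms True]] F2_norm_nonneg[of x] by (simp add: L2_set_weighted)
qed (simp add: F2_norm_nonneg)

lemma F2I:
  assumes "\<And>F. finite F \<Longrightarrow> (\<Sum>\<alpha>\<in>F. (norm (x \<alpha>))\<^sup>2 / b \<alpha>) \<le> C"
  shows "x \<in> F2 b"
  unfolding F2_def
  by (auto intro!: nonneg_bdd_above_summable_on bdd_aboveI2[where M=C] simp: assms pos less_imp_le)

text \<open>Finite sections decide both membership and the norm bound, so the Minkowski inequality
  of \<open>L2_set\<close> carries over without handling infinite sums. Non-negativity of
  \<open>C\<close> is the case of the empty section.\<close>

lemma F2_norm_leI:
  assumes "\<And>F. finite F \<Longrightarrow> L2_set (\<lambda>\<alpha>. norm (x \<alpha>) / sqrt (b \<alpha>)) F \<le> C"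
  shows "x \<in> F2 b" "F2_norm b x \<le> C"
proof -
  have C: "C \<ge> 0" using assms[of "{}"] by simp
  have *: "(\<Sum>\<alpha>\<in>F. (norm (x \<alpha>))\<^sup>2 / b \<alpha>) \<le> C\<^sup>2" if "finite F" for F
    using assms[OF that] C unfolding L2_set_weighted
    using sqrt_le_D by blast
  then show 1: "x \<in> F2 b" by (rule F2I)
  then have "(F2_norm b x)\<^sup>2 \<le> C\<^sup>2"
    unfolding F2_norm_square by (intro infsum_le_finite_sums) (auto simp: * F2_def)
  then show "F2_norm b x \<le> C" using C by (rule power2_le_imp_le)
qed

lemma F2_norm_leI':
  assumes "\<And>F. finite F \<Longrightarrow> (\<Sum>\<alpha>\<in>F. (norm (x \<alpha>))\<^sup>2 / b \<alpha>) \<le> C\<^sup>2" "C \<ge> 0"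
  shows "x \<in> F2 b" "F2_norm b x \<le> C"
proof -
  have *: "L2_set (\<lambda>\<alpha>. norm (x \<alpha>) / sqrt (b \<alpha>)) F \<le> C" if "finite F" for F
    unfolding L2_set_weighted using assms that by (simp add: real_le_lsqrt sum_nonneg pos less_imp_le)
  show "x \<in> F2 b" "F2_norm b x \<le> C" by (rule F2_norm_leI[OF *], assumption)+
qed

text \<open>Continuity of the coordinate functionals: norm convergence implies convergence of every
  coefficient, and matrix entries of bounded operators are bounded.\<close>

lemma F2_coord_le:
  assumes "x \<in> F2 b"
  shows "norm (x \<alpha>) \<le> sqrt (b \<alpha>) * F2_norm b x"
proof -
  have "norm (x \<alpha>) / sqrt (b \<alpha>) \<le> F2_norm b x"
    using F2_L2_set_le[OF assms, of "{\<alpha>}"] pos[of \<alpha>] by simp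
  then show ?thesis using pos[of \<alpha>] by (simp add: divide_le_eq mult.commute)
qed

lemma F2_add:
  assumes "x \<in> F2 b" "y \<in> F2 b"
  shows "(\<lambda>\<alpha>. x \<alpha> + y \<alpha>) \<in> F2 b"
    and "F2_norm b (\<lambda>\<alpha>. x \<alpha> + y \<alpha>) \<le> F2_norm b x + F2_norm b y"
proof -
  have *: "L2_set (\<lambda>\<alpha>. norm (x \<alpha> + y \<alpha>) / sqrt (b \<alpha>)) F \<le> F2_norm b x + F2_norm b y" for F
  proof -
    have "L2_set (\<lambda>\<alpha>. norm (x \<alpha> + y \<alpha>) / sqrt (b \<alpha>)) F
        \<le> L2_set (\<lambda>\<alpha>. norm (x \<alpha>) / sqrt (b \<alpha>) + norm (y \<alpha>) / sqrt (b \<alpha>)) F"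
      by (rule L2_set_mono)
        (use pos in \<open>auto simp: divide_right_mono norm_triangle_ineq less_imp_le simp flip: add_divide_distrib\<close>)
    also have "\<dots> \<le> L2_set (\<lambda>\<alpha>. norm (x \<alpha>) / sqrt (b \<alpha>)) F + L2_set (\<lambda>\<alpha>. norm (y \<alpha>) / sqrt (b \<alpha>)) F"
      by (rule L2_set_triangle_ineq)
    also have "\<dots> \<le> F2_norm b x + F2_norm b y"
      by (intro add_mono F2_L2_set_le assms)
    finally show ?thesis .
  qed
  show "(\<lambda>\<alpha>. x \<alpha> + y \<alpha>) \<in> F2 b" "F2_norm b (\<lambda>\<alpha>. x \<alpha> + y \<alpha>) \<le> F2_norm b x + F2_norm b y"
    by (rule F2_norm_leI[OF *])+
qed

lemma F2_scaleC:
  assumes "x \<in> F2 b"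
  shows "(\<lambda>\<alpha>. c *\<^sub>C x \<alpha>) \<in> F2 b"
    and "F2_norm b (\<lambda>\<alpha>. c *\<^sub>C x \<alpha>) = cmod c * F2_norm b x"
proof -
  have *: "(\<lambda>\<alpha>. (norm (c *\<^sub>C x \<alpha>))\<^sup>2 / b \<alpha>) = (\<lambda>\<alpha>. (cmod c)\<^sup>2 * ((norm (x \<alpha>))\<^sup>2 / b \<alpha>))"
    by (simp add: norm_scaleC power_mult_distrib)
  show "(\<lambda>\<alpha>. c *\<^sub>C x \<alpha>) \<in> F2 b"
    using assms unfolding F2_def mem_Collect_eq * by (intro summable_on_cmult_right)
  show "F2_norm b (\<lambda>\<alpha>. c *\<^sub>C x \<alpha>) = cmod c * F2_norm b x"
    unfolding F2_norm_def * by (simp only: infsum_cmult_right' real_sqrt_mult real_sqrt_abs abs_norm_cancel)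
qed

lemma F2_scaleR:
  assumes "x \<in> F2 b"
  shows "(\<lambda>\<alpha>. r *\<^sub>R x \<alpha>) \<in> F2 b"
    and "F2_norm b (\<lambda>\<alpha>. r *\<^sub>R x \<alpha>) = \<bar>r\<bar> * F2_norm b x"
  using F2_scaleC[OF assms, of "complex_of_real r"] by (simp_all add: scaleC_of_real)

lemma F2_finite_support:
  assumes "finite F" "\<And>\<alpha>. \<alpha> \<notin> F \<Longrightarrow> x \<alpha> = 0"
  shows "x \<in> F2 b" "(F2_norm b x)\<^sup>2 = (\<Sum>\<alpha>\<in>F. (norm (x \<alpha>))\<^sup>2 / b \<alpha>)"
proof -
  have "((\<lambda>\<alpha>. (norm (x \<alpha>))\<^sup>2 / b \<alpha>) has_sum (\<Sum>\<alpha>\<in>F. (norm (x \<alpha>))\<^sup>2 / b \<alpha>)) UNIV"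
    by (rule has_sum_finite_neutralI[OF assms(1)]) (auto simp: assms(2))
  then show "x \<in> F2 b" "(F2_norm b x)\<^sup>2 = (\<Sum>\<alpha>\<in>F. (norm (x \<alpha>))\<^sup>2 / b \<alpha>)"
    unfolding F2_norm_square by (auto simp: F2_def summable_on_def dest: infsumI)
qed

lemma F2_zero: "(\<lambda>_. 0) \<in> F2 b" "F2_norm b (\<lambda>_. 0) = 0"
  using F2_finite_support[of "{}" "\<lambda>_. 0"] by auto

lemma F2_diff:
  assumes "x \<in> F2 b" "y \<in> F2 b"
  shows "(\<lambda>\<alpha>. x \<alpha> - y \<alpha>) \<in> F2 b"
    and "F2_norm b (\<lambda>\<alpha>. x \<alpha> - y \<alpha>) \<le> F2_norm b x + F2_norm b y"
  using F2_add[OF assms(1) F2_scaleR(1)[OF assms(2), of "-1"]] F2_scaleR(2)[OF assms(2), of "-1"]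
  by simp_all

lemma F2_mono:
  assumes "x \<in> F2 b" "\<And>\<alpha>. norm (y \<alpha>) \<le> norm (x \<alpha>)"
  shows "y \<in> F2 b" "F2_norm b y \<le> F2_norm b x"
proof -
  have "L2_set (\<lambda>\<alpha>. norm (y \<alpha>) / sqrt (b \<alpha>)) F \<le> F2_norm b x" for F
    by (rule order_trans[OF L2_set_mono F2_L2_set_le[OF assms(1)]])
      (use assms pos in \<open>auto intro: divide_right_mono simp: less_imp_le\<close>)
  then show "y \<in> F2 b" "F2_norm b y \<le> F2_norm b x" by (rule F2_norm_leI)+
qed

lemma F2_sum:
  assumes "\<And>i. i \<in> S \<Longrightarrow> x i \<in> F2 b"
  shows "(\<lambda>\<alpha>. \<Sum>i\<in>S. x i \<alpha>) \<in> F2 b"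
  using assms by (induction S rule: infinite_finite_induct) (auto simp: F2_zero F2_add)

lemma F2_norm_eq_0:
  assumes "x \<in> F2 b" "F2_norm b x = 0"
  shows "x \<alpha> = 0"
  using F2_coord_le[OF assms(1), of \<alpha>] assms(2) by simp

text \<open>The bound is claimed for every \<open>G\<close> containing \<open>F\<close> because this
  is the form in which unordered sums are tested for convergence.\<close>

lemma F2_truncation:
  assumes "x \<in> F2 b" "\<epsilon> > 0"
  obtains F where "finite F" "\<And>G. F \<subseteq> G \<Longrightarrow> F2_norm b (\<lambda>\<alpha>. if \<alpha> \<in> G then 0 else x \<alpha>) < \<epsilon>"
proof -
  define f where "f = (\<lambda>\<alpha>. (norm (x \<alpha>))\<^sup>2 / b \<alpha>)"
  have f: "f summable_on UNIV" using assms by (simp add: F2_def f_def)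
  \<comment> \<open>The error is squared because \<open>f\<close> sums to the square of the norm;
    halving \<epsilon> makes the final inequality strict.\<close>
  obtain F where F: "finite F" "dist (sum f F) (infsum f UNIV) \<le> (\<epsilon>/2)\<^sup>2"
    using infsum_finite_approximation[OF f, of "(\<epsilon>/2)\<^sup>2"] assms(2) by auto
  have "F2_norm b (\<lambda>\<alpha>. if \<alpha> \<in> G then 0 else x \<alpha>) \<le> \<epsilon>/2" if "F \<subseteq> G" for G
  proof (rule F2_norm_leI'(2))
    fix H :: "'n list set" assume H: "finite H"
    have "(\<Sum>\<alpha>\<in>H. (norm (if \<alpha> \<in> G then 0 else x \<alpha>))\<^sup>2 / b \<alpha>) \<le> sum f (H - F)"
      unfolding f_def using that H pos
      by (subst sum.mono_neutral_right[where S="H - G"])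
        (auto intro!: sum_mono2 simp: less_imp_le intro: sum.mono_neutral_right)
    also have "\<dots> = sum f (F \<union> H) - sum f F"
      using F(1) H sum.subset_diff[of F "F \<union> H" f] by (simp add: Un_Diff)
    also have "sum f (F \<union> H) \<le> infsum f UNIV"
      by (rule finite_sum_le_infsum) (use f F H pos in \<open>auto simp: f_def less_imp_le\<close>)
    finally show "(\<Sum>\<alpha>\<in>H. (norm (if \<alpha> \<in> G then 0 else x \<alpha>))\<^sup>2 / b \<alpha>) \<le> (\<epsilon>/2)\<^sup>2"
      using F(2) by (simp add: dist_real_def)
  qed (use assms(2) in simp)
  then show ?thesis using that[OF F(1)] assms(2) by (smt (verit) field_sum_of_halves)
qed

end

subsection \<open>Completeness, uniform boundedness and matrix entries\<close>

context
  fixes b :: "'n list \<Rightarrow> real"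
  assumes pos: "\<And>\<alpha>. b \<alpha> > 0"
begin

text \<open>\<open>F2 b\<close> is a subset of a function type, so the metric lives on a carrier
  set; the Baire category theorem is applied below in this setting.\<close>

lemma F2_Metric_space:
  "Metric_space (F2 b :: ('n list \<Rightarrow> 'k::chilbert) set) (\<lambda>x y. F2_norm b (\<lambda>\<alpha>. x \<alpha> - y \<alpha>))"
proof
  fix x y z :: "'n list \<Rightarrow> 'k"
  show "0 \<le> F2_norm b (\<lambda>\<alpha>. x \<alpha> - y \<alpha>)" by (rule F2_norm_nonneg[of b, OF pos])
  show "F2_norm b (\<lambda>\<alpha>. x \<alpha> - y \<alpha>) = F2_norm b (\<lambda>\<alpha>. y \<alpha> - x \<alpha>)"
    by (simp add: F2_norm_def norm_minus_commute)
  assume x: "x \<in> F2 b" and y: "y \<in> F2 b"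
  show "F2_norm b (\<lambda>\<alpha>. x \<alpha> - y \<alpha>) = 0 \<longleftrightarrow> x = y"
  proof
    assume *: "F2_norm b (\<lambda>\<alpha>. x \<alpha> - y \<alpha>) = 0"
    show "x = y"
      using F2_norm_eq_0[OF pos F2_diff(1)[OF pos x y] *] by (auto simp: fun_eq_iff)
  qed (simp add: F2_zero[of b, OF pos])
  assume z: "z \<in> F2 b"
  show "F2_norm b (\<lambda>\<alpha>. x \<alpha> - z \<alpha>) \<le> F2_norm b (\<lambda>\<alpha>. x \<alpha> - y \<alpha>) + F2_norm b (\<lambda>\<alpha>. y \<alpha> - z \<alpha>)"
    using F2_add(2)[OF pos F2_diff(1)[OF pos x y] F2_diff(1)[OF pos y z]] by simp
qed

text \<open>Lower semicontinuity of the norm under coordinatewise convergence, in the manner of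
  Fatou: each finite section is continuous in finitely many coordinates. It serves both completeness
  and the closed sets of the Baire argument.\<close>

lemma F2_norm_le_limit:
  fixes u :: "nat \<Rightarrow> 'n list \<Rightarrow> 'k::chilbert"
  assumes "\<And>\<alpha>. (\<lambda>n. u n \<alpha>) \<longlonglongrightarrow> x \<alpha>"
    and "\<forall>\<^sub>F n in sequentially. u n \<in> F2 b \<and> F2_norm b (u n) \<le> C"
  shows "x \<in> F2 b" "F2_norm b x \<le> C"
proof -
  have *: "L2_set (\<lambda>\<alpha>. norm (x \<alpha>) / sqrt (b \<alpha>)) F \<le> C" for F
  proof (rule tendsto_upperbound)
    show "(\<lambda>n. L2_set (\<lambda>\<alpha>. norm (u n \<alpha>) / sqrt (b \<alpha>)) F) \<longlonglongrightarrow> L2_set (\<lambda>\<alpha>. norm (x \<alpha>) / sqrt (b \<alpha>)) F"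
      unfolding L2_set_def using pos by (intro tendsto_intros assms(1)) (simp add: less_imp_neq[THEN not_sym])
    show "\<forall>\<^sub>F n in sequentially. L2_set (\<lambda>\<alpha>. norm (u n \<alpha>) / sqrt (b \<alpha>)) F \<le> C"
      using assms(2) by (rule eventually_mono) (rule order_trans[OF F2_L2_set_le[OF pos]], auto)
  qed simp
  show "x \<in> F2 b" "F2_norm b x \<le> C" by (rule F2_norm_leI[OF pos *])+
qed

lemma F2_mcomplete:
  "Metric_space.mcomplete (F2 b :: ('n list \<Rightarrow> 'k::chilbert) set) (\<lambda>x y. F2_norm b (\<lambda>\<alpha>. x \<alpha> - y \<alpha>))"
proof -
  interpret Metric_space "F2 b :: ('n list \<Rightarrow> 'k) set" "\<lambda>x y. F2_norm b (\<lambda>\<alpha>. x \<alpha> - y \<alpha>)"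
    by (rule F2_Metric_space)
  show ?thesis
    unfolding mcomplete_def
  proof (intro allI impI)
    fix \<sigma> :: "nat \<Rightarrow> 'n list \<Rightarrow> 'k" assume C: "MCauchy \<sigma>"
    have \<sigma>: "\<sigma> n \<in> F2 b" for n using C by (auto simp: MCauchy_def)
    have Cau: "\<exists>N. \<forall>n n'. N \<le> n \<longrightarrow> N \<le> n' \<longrightarrow> F2_norm b (\<lambda>\<alpha>. \<sigma> n \<alpha> - \<sigma> n' \<alpha>) < \<epsilon>" if "\<epsilon> > 0" for \<epsilon>
      using C that by (simp add: MCauchy_def)
    have "Cauchy (\<lambda>n. \<sigma> n \<alpha>)" for \<alpha>
    proof (rule metric_CauchyI)
      fix e :: real assume e: "e > 0"
      have sb: "sqrt (b \<alpha>) > 0" using pos by simp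
      obtain N where N: "\<And>n n'. N \<le> n \<Longrightarrow> N \<le> n' \<Longrightarrow> F2_norm b (\<lambda>\<alpha>. \<sigma> n \<alpha> - \<sigma> n' \<alpha>) < e / sqrt (b \<alpha>)"
        using Cau[of "e / sqrt (b \<alpha>)"] e sb by auto
      have "dist (\<sigma> m \<alpha>) (\<sigma> n \<alpha>) < e" if "m \<ge> N" "n \<ge> N" for m n
      proof -
        have "dist (\<sigma> m \<alpha>) (\<sigma> n \<alpha>) \<le> sqrt (b \<alpha>) * F2_norm b (\<lambda>\<alpha>. \<sigma> m \<alpha> - \<sigma> n \<alpha>)"
          unfolding dist_norm by (rule F2_coord_le[OF pos F2_diff(1)[OF pos \<sigma> \<sigma>]])
        also have "\<dots> < e" using N[OF that] sb by (simp add: field_simps)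
        finally show ?thesis .
      qed
      then show "\<exists>M. \<forall>m\<ge>M. \<forall>n\<ge>M. dist (\<sigma> m \<alpha>) (\<sigma> n \<alpha>) < e" by blast
    qed
    then have lim: "(\<lambda>n. \<sigma> n \<alpha>) \<longlonglongrightarrow> lim (\<lambda>n. \<sigma> n \<alpha>)" for \<alpha>
      by (simp add: Cauchy_convergent_iff convergent_LIMSEQ_iff)
    define x where "x = (\<lambda>\<alpha>. lim (\<lambda>n. \<sigma> n \<alpha>))"
    \<comment> \<open>Letting the second index of the Cauchy estimate tend to infinity gives the
      estimate for the limit, by lower semicontinuity.\<close>
    have close: "\<exists>N. \<forall>n\<ge>N. (\<lambda>\<alpha>. \<sigma> n \<alpha> - x \<alpha>) \<in> F2 b \<and> F2_norm b (\<lambda>\<alpha>. \<sigma> n \<alpha> - x \<alpha>) \<le> \<epsilon>" if \<epsilon>: "\<epsilon> > 0" for \<epsilon>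
    proof -
      obtain N where N: "\<And>n n'. N \<le> n \<Longrightarrow> N \<le> n' \<Longrightarrow> F2_norm b (\<lambda>\<alpha>. \<sigma> n \<alpha> - \<sigma> n' \<alpha>) < \<epsilon>"
        using Cau[OF \<epsilon>] by auto
      have "(\<lambda>\<alpha>. \<sigma> n \<alpha> - x \<alpha>) \<in> F2 b \<and> F2_norm b (\<lambda>\<alpha>. \<sigma> n \<alpha> - x \<alpha>) \<le> \<epsilon>" if n: "n \<ge> N" for n
      proof -
        have l: "(\<lambda>m. \<sigma> n \<alpha> - \<sigma> m \<alpha>) \<longlonglongrightarrow> \<sigma> n \<alpha> - x \<alpha>" for \<alpha>
          unfolding x_def by (intro tendsto_intros lim)
        have ev: "\<forall>\<^sub>F m in sequentially. (\<lambda>\<alpha>. \<sigma> n \<alpha> - \<sigma> m \<alpha>) \<in> F2 b \<and> F2_norm b (\<lambda>\<alpha>. \<sigma> n \<alpha> - \<sigma> m \<alpha>) \<le> \<epsilon>"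
          using eventually_ge_at_top[of N]
          by (rule eventually_mono) (intro conjI F2_diff(1)[OF pos \<sigma> \<sigma>] less_imp_le[OF N[OF n]])
        show ?thesis using F2_norm_le_limit[OF l ev] by blast
      qed
      then show ?thesis by blast
    qed
    obtain N where "(\<lambda>\<alpha>. \<sigma> N \<alpha> - x \<alpha>) \<in> F2 b" using close[of 1] by auto
    from F2_diff(1)[OF pos \<sigma>[of N] this] have x: "x \<in> F2 b" by simp
    have "\<forall>\<^sub>F n in sequentially. F2_norm b (\<lambda>\<alpha>. \<sigma> n \<alpha> - x \<alpha>) < \<epsilon>" if "\<epsilon> > 0" for \<epsilon>
    proof -
      obtain N where "\<forall>n\<ge>N. F2_norm b (\<lambda>\<alpha>. \<sigma> n \<alpha> - x \<alpha>) \<le> \<epsilon>/2"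
        using close[of "\<epsilon>/2"] \<open>\<epsilon> > 0\<close> by auto
      then show ?thesis
        using \<open>\<epsilon> > 0\<close> unfolding eventually_sequentially by (intro exI[of _ N]) fastforce
    qed
    then show "\<exists>x. limitin mtopology \<sigma> x sequentially"
      using x \<sigma> by (auto simp: limitin_metric)
  qed
qed

text \<open>A closed graph argument through Baire: the sets where \<open>T x\<close> has norm at
  most n are closed because all coordinates of \<open>T\<close> are continuous. They exhaust the
  space, so one of them contains a ball, and linearity moves that ball to the origin.\<close>

lemma coordinatewise_bounded_imp_bounded:
  fixes T :: "('n list \<Rightarrow> 'k::chilbert) \<Rightarrow> ('n list \<Rightarrow> 'k)"
  assumes T: "\<And>x. x \<in> F2 b \<Longrightarrow> T x \<in> F2 b"
    and add: "\<And>x y. x \<in> F2 b \<Longrightarrow> y \<in> F2 b \<Longrightarrow> T (\<lambda>\<alpha>. x \<alpha> + y \<alpha>) = (\<lambda>\<alpha>. T x \<alpha> + T y \<alpha>)"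
    and scale: "\<And>r x. x \<in> F2 b \<Longrightarrow> T (\<lambda>\<alpha>. r *\<^sub>R x \<alpha>) = (\<lambda>\<alpha>. r *\<^sub>R T x \<alpha>)"
    and coord: "\<And>\<gamma>. \<exists>K. \<forall>x\<in>F2 b. norm (T x \<gamma>) \<le> K * F2_norm b x"
  shows "\<exists>C. \<forall>x\<in>F2 b. F2_norm b (T x) \<le> C * F2_norm b x"
proof -
  interpret Metric_space "F2 b :: ('n list \<Rightarrow> 'k) set" "\<lambda>x y. F2_norm b (\<lambda>\<alpha>. x \<alpha> - y \<alpha>)"
    by (rule F2_Metric_space)
  have diff: "T (\<lambda>\<alpha>. x \<alpha> - y \<alpha>) = (\<lambda>\<alpha>. T x \<alpha> - T y \<alpha>)" if "x \<in> F2 b" "y \<in> F2 b" for x y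
    using add[OF that(1) F2_scaleR(1)[OF pos that(2), of "-1"]] scale[OF that(2), of "-1"] by simp
  define A where "A n = {x \<in> F2 b. F2_norm b (T x) \<le> real n}" for n
  have closed: "closedin mtopology (A n)" for n
    unfolding metric_closedin_iff_sequentially_closed
  proof (intro conjI allI impI)
    fix \<sigma> l assume *: "range \<sigma> \<subseteq> A n \<and> limitin mtopology \<sigma> l sequentially"
    then have l: "l \<in> F2 b" and conv: "(\<lambda>k. F2_norm b (\<lambda>\<alpha>. \<sigma> k \<alpha> - l \<alpha>)) \<longlonglongrightarrow> 0"
      by (auto simp: limitin_metric tendsto_iff dist_real_def F2_norm_nonneg[of b, OF pos] elim: eventually_mono)
    have \<sigma>: "\<sigma> k \<in> F2 b" "F2_norm b (T (\<sigma> k)) \<le> n" for k using * by (auto simp: A_def)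
    have "(\<lambda>k. T (\<sigma> k) \<gamma>) \<longlonglongrightarrow> T l \<gamma>" for \<gamma>
    proof -
      obtain K where K: "\<And>x. x \<in> F2 b \<Longrightarrow> norm (T x \<gamma>) \<le> K * F2_norm b x" using coord by blast
      have lim: "(\<lambda>k. K * F2_norm b (\<lambda>\<alpha>. \<sigma> k \<alpha> - l \<alpha>)) \<longlonglongrightarrow> 0" using tendsto_mult_right_zero[OF conv] .
      have le: "norm (T (\<sigma> k) \<gamma> - T l \<gamma>) \<le> K * F2_norm b (\<lambda>\<alpha>. \<sigma> k \<alpha> - l \<alpha>)" for k
        using K[OF F2_diff(1)[OF pos \<sigma>(1) l]] by (simp add: diff[OF \<sigma>(1) l])
      have "(\<lambda>k. T (\<sigma> k) \<gamma> - T l \<gamma>) \<longlonglongrightarrow> 0"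
        by (rule Lim_null_comparison[OF _ lim]) (simp add: le)
      then show ?thesis using Lim_null by blast
    qed
    then have "F2_norm b (T l) \<le> n"
      by (rule F2_norm_le_limit(2)) (use \<sigma> T in auto)
    then show "l \<in> A n" using l by (simp add: A_def)
  qed (auto simp: A_def)
  have "\<exists>n. mtopology interior_of A n \<noteq> {}"
  proof (rule ccontr)
    assume "\<nexists>n. mtopology interior_of A n \<noteq> {}"
    then have "mtopology interior_of \<Union>(range A) = {}"
      by (intro metric_Baire_category_alt) (auto simp: closed F2_mcomplete)
    moreover have "\<Union>(range A) = F2 b"
      using real_arch_simple by (auto simp: A_def)
    ultimately show False
      using F2_zero(1)[of b, OF pos] interior_of_topspace[of mtopology] by auto
  qed
  then obtain n x0 where "x0 \<in> mtopology interior_of A n" by blast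
  then obtain r where x0: "x0 \<in> F2 b" and r: "r > 0" and ball: "mcball x0 r \<subseteq> A n"
    using in_interior_of_mcball by auto
  \<comment> \<open>A vector of norm at most \<open>r\<close> is the difference of two points of the
    ball, \<open>x0 + u\<close> and \<open>x0\<close>; this doubles the bound.\<close>
  have small: "F2_norm b (T u) \<le> 2 * n" if u: "u \<in> F2 b" "F2_norm b u \<le> r" for u
  proof -
    have in1: "x0 \<in> mcball x0 r" using x0 r by (simp add: F2_zero[of b, OF pos])
    have in2: "(\<lambda>\<alpha>. x0 \<alpha> + u \<alpha>) \<in> mcball x0 r"
      using F2_add(1)[OF pos x0 u(1)] x0 u(2) F2_scaleR(2)[OF pos u(1), of "-1"] by simp
    have 1: "F2_norm b (T x0) \<le> n" "F2_norm b (T (\<lambda>\<alpha>. x0 \<alpha> + u \<alpha>)) \<le> n"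
      using subsetD[OF ball in1] subsetD[OF ball in2] unfolding A_def by simp_all
    have "T u = T (\<lambda>\<alpha>. (x0 \<alpha> + u \<alpha>) - x0 \<alpha>)" by simp
    also have "\<dots> = (\<lambda>\<alpha>. T (\<lambda>\<alpha>. x0 \<alpha> + u \<alpha>) \<alpha> - T x0 \<alpha>)"
      by (rule diff[OF F2_add(1)[OF pos x0 u(1)] x0])
    finally have "F2_norm b (T u) \<le> F2_norm b (T (\<lambda>\<alpha>. x0 \<alpha> + u \<alpha>)) + F2_norm b (T x0)"
      using F2_diff(2)[OF pos T[OF F2_add(1)[OF pos x0 u(1)]] T[OF x0]] by simp
    then show ?thesis using 1 by simp
  qed
  have "F2_norm b (T x) \<le> (2 * n / r) * F2_norm b x" if x: "x \<in> F2 b" for x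
  proof (cases "F2_norm b x = 0")
    \<comment> \<open>A null vector cannot be normalized. Instead, all its multiples stay in the
      small ball, so a nonzero \<open>T x\<close> could be scaled beyond the bound
      \<open>2 * n\<close>.\<close>
    case True
    have "F2_norm b (T x) \<le> 0"
    proof (rule ccontr)
      assume "\<not> F2_norm b (T x) \<le> 0"
      then have Tp: "F2_norm b (T x) > 0" by simp
      define s where "s = (2 * real n + 1) / F2_norm b (T x)"
      have s: "s * F2_norm b (T x) > 2 * n" "s > 0" using Tp by (simp_all add: s_def)
      have "F2_norm b (T (\<lambda>\<alpha>. s *\<^sub>R x \<alpha>)) \<le> 2 * n"
        by (rule small[OF F2_scaleR(1)[OF pos x]]) (use True r F2_scaleR(2)[OF pos x] in simp)
      then show False using s F2_scaleR(2)[OF pos T[OF x], of s] by (simp add: scale[OF x])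
    qed
    then show ?thesis using True by simp
  next
    case False
    then have p: "F2_norm b x > 0" using F2_norm_nonneg[of b x, OF pos] by simp
    define s where "s = r / F2_norm b x"
    have s: "s > 0" using p r by (simp add: s_def)
    have "F2_norm b (T (\<lambda>\<alpha>. s *\<^sub>R x \<alpha>)) \<le> 2 * n"
      by (rule small[OF F2_scaleR(1)[OF pos x]]) (use p r s F2_scaleR(2)[OF pos x] in \<open>simp add: s_def\<close>)
    then have "s * F2_norm b (T x) \<le> 2 * n"
      using s F2_scaleR(2)[OF pos T[OF x], of s] by (simp add: scale[OF x])
    then have "(s * F2_norm b (T x)) * (F2_norm b x / r) \<le> (2 * n) * (F2_norm b x / r)"
      using p r by (intro mult_right_mono) simp_all
    moreover have "(s * F2_norm b (T x)) * (F2_norm b x / r) = F2_norm b (T x)"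
      using p r by (simp add: s_def)
    ultimately show ?thesis by simp
  qed
  then show ?thesis by blast
qed

end

text \<open>The elementary tensor of \<open>h\<close> with the basis vector at
  \<open>\<beta>\<close>. The values of an operator on these vectors are the columns of its operator
  matrix.\<close>

definition single :: "'n list \<Rightarrow> 'k::chilbert \<Rightarrow> 'n list \<Rightarrow> 'k" where
  "single \<beta> h = (\<lambda>\<gamma>. if \<gamma> = \<beta> then h else 0)"

lemma tensor_vec_fock_e: "tensor_vec (fock_e \<beta>) h = single \<beta> h"
  by (auto simp: tensor_vec_def fock_e_def single_def)

context
  fixes b :: "'n list \<Rightarrow> real"
  assumes bpos: "\<And>\<alpha>. b \<alpha> > 0"
begin

lemma single_F2: "single \<beta> h \<in> F2 b"
  and F2_norm_single: "F2_norm b (single \<beta> h) = norm h / sqrt (b \<beta>)"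
proof -
  show "single \<beta> h \<in> F2 b" 
    by (rule F2_finite_support(1)[OF bpos, of "{\<beta>}"]) (auto simp: single_def)
  have "(F2_norm b (single \<beta> h))\<^sup>2 = (norm h)\<^sup>2 / b \<beta>"
    using F2_finite_support(2)[OF bpos, of "{\<beta>}" "single \<beta> h"] by (simp add: single_def)
  also have "\<dots> = (norm h / sqrt (b \<beta>))\<^sup>2" using bpos[of \<beta>] by (simp add: power_divide)
  finally show "F2_norm b (single \<beta> h) = norm h / sqrt (b \<beta>)"
    using bpos[of \<beta>] F2_norm_nonneg[of b "single \<beta> h", OF bpos]
    by (simp add: power2_eq_iff_nonneg del: power_divide)
qed

end

section \<open>Bounded operators and their matrices\<close>

context
  fixes b c :: "'n list \<Rightarrow> real"
  assumes bpos: "\<And>\<alpha>. b \<alpha> > 0" and cpos: "\<And>\<alpha>. c \<alpha> > 0"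
begin

lemma bop_closed: "T \<in> bop b c \<Longrightarrow> x \<in> F2 b \<Longrightarrow> T x \<in> F2 c"
  by (auto simp: bop_def)

lemma bop_add:
  "T \<in> bop b c \<Longrightarrow> x \<in> F2 b \<Longrightarrow> y \<in> F2 b \<Longrightarrow> T (\<lambda>\<alpha>. x \<alpha> + y \<alpha>) = (\<lambda>\<alpha>. T x \<alpha> + T y \<alpha>)"
  by (auto simp: bop_def)

lemma bop_scaleC:
  "T \<in> bop b c \<Longrightarrow> x \<in> F2 b \<Longrightarrow> T (\<lambda>\<alpha>. a *\<^sub>C x \<alpha>) = (\<lambda>\<alpha>. a *\<^sub>C T x \<alpha>)"
  by (auto simp: bop_def)

lemma bop_scaleR:
  "T \<in> bop b c \<Longrightarrow> x \<in> F2 b \<Longrightarrow> T (\<lambda>\<alpha>. r *\<^sub>R x \<alpha>) = (\<lambda>\<alpha>. r *\<^sub>R T x \<alpha>)"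
  using bop_scaleC[of T x "complex_of_real r"] by (simp add: scaleC_of_real)

lemma bop_diff:
  assumes "T \<in> bop b c" "x \<in> F2 b" "y \<in> F2 b"
  shows "T (\<lambda>\<alpha>. x \<alpha> - y \<alpha>) = (\<lambda>\<alpha>. T x \<alpha> - T y \<alpha>)"
  using bop_add[OF assms(1,2) F2_scaleR(1)[OF bpos assms(3), of "-1"]] bop_scaleR[OF assms(1,3), of "-1"]
  by simp

lemma bop_zero: "T \<in> bop b c \<Longrightarrow> T (\<lambda>_. 0) = (\<lambda>_. 0)"
  using bop_scaleR[of T "\<lambda>_. 0" 0] F2_zero(1)[of b, OF bpos] by simp

lemma bop_sum:
  assumes "T \<in> bop b c" "\<And>i. i \<in> S \<Longrightarrow> x i \<in> F2 b"
  shows "T (\<lambda>\<alpha>. \<Sum>i\<in>S. x i \<alpha>) = (\<lambda>\<alpha>. \<Sum>i\<in>S. T (x i) \<alpha>)"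
  using assms(2)
  by (induction S rule: infinite_finite_induct)
    (auto simp: bop_zero assms(1) bop_add[OF assms(1)] F2_sum[OF bpos])

lemma bop_bound:
  assumes "T \<in> bop b c"
  obtains C where "C \<ge> 0" "\<And>x. x \<in> F2 b \<Longrightarrow> F2_norm c (T x) \<le> C * F2_norm b x"
proof -
  obtain C where C: "\<And>x. x \<in> F2 b \<Longrightarrow> F2_norm c (T x) \<le> C * F2_norm b x"
    using assms unfolding bop_def by blast
  have "C * F2_norm b x \<le> max C 0 * F2_norm b x" for x :: "'n list \<Rightarrow> 'a"
    by (intro mult_right_mono F2_norm_nonneg[of b, OF bpos]) simp
  then show ?thesis using C that[of "max C 0"] by (meson max.cobounded2 order_trans)
qed

lemma bopI:
  assumes "\<And>x. x \<in> F2 b \<Longrightarrow> T x \<in> F2 c"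
    and "\<And>x. x \<notin> F2 b \<Longrightarrow> T x = undefined"
    and "\<And>x y. x \<in> F2 b \<Longrightarrow> y \<in> F2 b \<Longrightarrow> T (\<lambda>\<alpha>. x \<alpha> + y \<alpha>) = (\<lambda>\<alpha>. T x \<alpha> + T y \<alpha>)"
    and "\<And>a x. x \<in> F2 b \<Longrightarrow> T (\<lambda>\<alpha>. a *\<^sub>C x \<alpha>) = (\<lambda>\<alpha>. a *\<^sub>C T x \<alpha>)"
    and "\<And>x. x \<in> F2 b \<Longrightarrow> F2_norm c (T x) \<le> C * F2_norm b x"
  shows "T \<in> bop b c"
proof -
  have "\<exists>C. \<forall>x\<in>F2 b. F2_norm c (T x) \<le> C * F2_norm b x" using assms(5) by blast
  then show ?thesis using assms(1-4) by (simp add: bop_def PiE_def extensional_def)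
qed

text \<open>Truncations of \<open>x\<close> converge in norm and \<open>T\<close> is continuous, so
  a coordinate of \<open>T x\<close> is the unordered sum of the contributions of the
  columns.\<close>

lemma bop_expansion:
  assumes T: "T \<in> bop b c" and x: "x \<in> F2 b"
  shows "((\<lambda>\<beta>. T (single \<beta> (x \<beta>)) \<gamma>) has_sum T x \<gamma>) UNIV"
  unfolding has_sum_def tendsto_iff eventually_finite_subsets_at_top
proof (intro allI impI)
  fix e :: real assume e: "e > 0"
  obtain C where C: "C \<ge> 0" "\<And>x. x \<in> F2 b \<Longrightarrow> F2_norm c (T x) \<le> C * F2_norm b x"
    using bop_bound[OF T] by blast
  \<comment> \<open>Adding 1 keeps \<open>K\<close> positive when \<open>C = 0\<close>, so that
    \<open>e / K\<close> is a legitimate tolerance.\<close>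
  define K where "K = sqrt (c \<gamma>) * C + 1"
  have K: "K > 0" using C cpos[of \<gamma>] by (simp add: K_def add_nonneg_pos)
  obtain F where F: "finite F" "\<And>G. F \<subseteq> G \<Longrightarrow> F2_norm b (\<lambda>\<alpha>. if \<alpha> \<in> G then 0 else x \<alpha>) < e / K"
    using F2_truncation[OF bpos x, of "e / K"] e K by auto
  have "dist (\<Sum>\<beta>\<in>G. T (single \<beta> (x \<beta>)) \<gamma>) (T x \<gamma>) < e" if G: "finite G" "F \<subseteq> G" for G
  proof -
    have xG: "(\<lambda>\<alpha>. if \<alpha> \<in> G then 0 else x \<alpha>) \<in> F2 b"
      by (rule F2_mono(1)[OF bpos x]) auto
    have "(\<Sum>\<beta>\<in>G. T (single \<beta> (x \<beta>)) \<gamma>) = T (\<lambda>\<alpha>. \<Sum>\<beta>\<in>G. single \<beta> (x \<beta>) \<alpha>) \<gamma>"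
      by (simp add: bop_sum[OF T] single_F2[OF bpos])
    also have "(\<lambda>\<alpha>. \<Sum>\<beta>\<in>G. single \<beta> (x \<beta>) \<alpha>) = (\<lambda>\<alpha>. x \<alpha> - (if \<alpha> \<in> G then 0 else x \<alpha>))"
      using G by (auto simp: single_def)
    finally have "dist (\<Sum>\<beta>\<in>G. T (single \<beta> (x \<beta>)) \<gamma>) (T x \<gamma>) = norm (T (\<lambda>\<alpha>. if \<alpha> \<in> G then 0 else x \<alpha>) \<gamma>)"
      by (simp add: bop_diff[OF T x xG] dist_norm)
    also have "\<dots> \<le> sqrt (c \<gamma>) * F2_norm c (T (\<lambda>\<alpha>. if \<alpha> \<in> G then 0 else x \<alpha>))"
      by (rule F2_coord_le[OF cpos bop_closed[OF T xG]])
    also have "\<dots> \<le> sqrt (c \<gamma>) * (C * F2_norm b (\<lambda>\<alpha>. if \<alpha> \<in> G then 0 else x \<alpha>))"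
      using cpos[of \<gamma>] by (intro mult_left_mono C(2) xG) auto
    also have "\<dots> \<le> K * F2_norm b (\<lambda>\<alpha>. if \<alpha> \<in> G then 0 else x \<alpha>)"
      unfolding K_def using F2_norm_nonneg[of b, OF bpos] by (simp add: algebra_simps)
    also have "\<dots> < e" using F(2)[OF G(2)] K by (simp add: field_simps)
    finally show ?thesis .
  qed
  then show "\<exists>X. finite X \<and> X \<subseteq> UNIV \<and> (\<forall>Y. finite Y \<and> X \<subseteq> Y \<and> Y \<subseteq> UNIV \<longrightarrow> dist (\<Sum>\<beta>\<in>Y. T (single \<beta> (x \<beta>)) \<gamma>) (T x \<gamma>) < e)"
    using F(1) by (intro exI[of _ F]) auto
qed

lemma bop_eqI:
  assumes T: "T \<in> bop b c" and S: "S \<in> bop b c"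
    and eq: "\<And>\<beta> h. T (single \<beta> h) = S (single \<beta> h)"
  shows "T = S"
proof (rule extensionalityI[of _ "F2 b"])
  show "T \<in> extensional (F2 b)" "S \<in> extensional (F2 b)" using T S by (simp_all add: bop_def PiE_def)
  fix x :: "'n list \<Rightarrow> 'a" assume x: "x \<in> F2 b"
  show "T x = S x"
  proof
    fix \<gamma>
    show "T x \<gamma> = S x \<gamma>"
      by (rule has_sum_unique[OF bop_expansion[OF T x, of \<gamma>]])
        (simp only: eq bop_expansion[OF S x, of \<gamma>])
  qed
qed

text \<open>An operator is determined by its columns (\<open>bop_eqI\<close>), so the definite
  description in \<open>tensor_op\<close> evaluates to any tensor operator that is
  exhibited.\<close>

lemma tensor_op_eqI:
  assumes "is_tensor_op b c A B T"
  shows "tensor_op b c A B = T"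
  unfolding tensor_op_def
proof (rule the_equality)
  show "is_tensor_op b c A B T" by (rule assms)
next
  fix S assume S: "is_tensor_op b c A B S"
  show "S = T"
  proof (rule bop_eqI)
    fix \<beta> h
    show "S (single \<beta> h) = T (single \<beta> h)"
    proof -
      have "fock_e \<beta> \<in> F2 b"
        using single_F2[of b \<beta> "1::complex", OF bpos] by (simp add: single_def fock_e_def)
      then show ?thesis using S assms by (simp add: is_tensor_op_def flip: tensor_vec_fock_e)
    qed
  qed (use S assms in \<open>auto simp: is_tensor_op_def\<close>)
qed

end

subsection \<open>The map \<open>\<Psi>\<close> as a weighted convolution\<close>

lemma finite_factorizations: "finite {(\<beta>, \<alpha>). \<beta> @ \<alpha> = (\<gamma> :: 'n list)}"
proof (rule finite_subset)
  show "{(\<beta>, \<alpha>). \<beta> @ \<alpha> = \<gamma>} \<subseteq> (\<lambda>k. (take k \<gamma>, drop k \<gamma>)) ` {..length \<gamma>}"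
  proof clarify
    fix \<beta> \<alpha> assume "\<gamma> = \<beta> @ \<alpha>"
    then show "(\<beta>, \<alpha>) \<in> (\<lambda>k. (take k (\<beta> @ \<alpha>), drop k (\<beta> @ \<alpha>))) ` {..length (\<beta> @ \<alpha>)}"
      by (intro image_eqI[of _ _ "length \<beta>"]) auto
  qed
qed simp

lemma fock_e_eq_single: "fock_e \<alpha> = single \<alpha> 1"
  by (simp add: fock_e_def single_def)

lemma F2_inner_single_right:
  "F2_inner b x (single \<beta> k) = cinner (x \<beta>) k / complex_of_real (b \<beta>)"
  unfolding F2_inner_def
  by (rule infsumI, rule has_sum_finite_neutralI[of "{\<beta>}"]) (auto simp: single_def)

lemma F2_inner_single_left:
  "F2_inner b (single \<beta> k) x = cinner k (x \<beta>) / complex_of_real (b \<beta>)"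
  unfolding F2_inner_def
  by (rule infsumI, rule has_sum_finite_neutralI[of "{\<beta>}"]) (auto simp: single_def)

lemma one_pos: "\<And>\<alpha>. fock_weight \<alpha> > 0" by simp

text \<open>
  The matrix of \<open>R\<^sub>\<phi>\<close> in the orthonormal bases: the unitary \<open>U\<^sub>f\<close> turns right multiplication by
  \<open>\<phi>\<close> into this convolution.
\<close>

definition weighted_conv ::
    "('n list \<Rightarrow> real) \<Rightarrow> ('n list \<Rightarrow> 'k \<Rightarrow> 'k) \<Rightarrow> ('n list \<Rightarrow> 'k::chilbert) \<Rightarrow> 'n list \<Rightarrow> 'k" where
  "weighted_conv b \<phi> x = (\<lambda>\<gamma>. \<Sum>(\<beta>, \<alpha>) | \<beta> @ \<alpha> = \<gamma>. sqrt (b \<beta> / b \<gamma>) *\<^sub>R \<phi> \<alpha> (x \<beta>))"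

text \<open>Coefficientwise form of U_f \<otimes> I: the coefficient at Z_\<alpha> is
  \<open>sqrt (b \<alpha>)\<close> times the one at e_\<alpha>. Its companion \<open>to_Fock\<close>
  will be the adjoint.\<close>

definition from_Fock :: "('n list \<Rightarrow> real) \<Rightarrow> ('n list \<Rightarrow> 'k::chilbert) \<Rightarrow> ('n list \<Rightarrow> 'k)" where
  "from_Fock b = (\<lambda>x\<in>Fock. \<lambda>\<alpha>. sqrt (b \<alpha>) *\<^sub>R x \<alpha>)"

definition to_Fock :: "('n list \<Rightarrow> real) \<Rightarrow> ('n list \<Rightarrow> 'k::chilbert) \<Rightarrow> ('n list \<Rightarrow> 'k)" where
  "to_Fock b = (\<lambda>x\<in>F2 b. \<lambda>\<alpha>. (1 / sqrt (b \<alpha>)) *\<^sub>R x \<alpha>)"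

lemma weighted_conv_add:
  assumes "\<And>\<alpha>. bounded_clinear (\<phi> \<alpha>)"
  shows "weighted_conv b \<phi> (\<lambda>\<alpha>. x \<alpha> + y \<alpha>) = (\<lambda>\<alpha>. weighted_conv b \<phi> x \<alpha> + weighted_conv b \<phi> y \<alpha>)"
  by (simp add: weighted_conv_def bounded_clinear_add[OF assms] sum.distrib case_prod_unfold scaleR_add_right)

lemma weighted_conv_scaleC:
  assumes "\<And>\<alpha>. bounded_clinear (\<phi> \<alpha>)"
  shows "weighted_conv b \<phi> (\<lambda>\<alpha>. a *\<^sub>C x \<alpha>) = (\<lambda>\<alpha>. a *\<^sub>C weighted_conv b \<phi> x \<alpha>)"
  by (simp add: weighted_conv_def bounded_clinear_scaleC[OF assms] scaleC_sum_right scaleC_scaleR case_prod_unfold)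

text \<open>At most one factorization of a row index begins with \<open>\<beta>\<close>, so at most
  one term of the convolution survives.\<close>

lemma weighted_conv_single:
  assumes "\<And>\<alpha>. bounded_clinear (\<phi> \<alpha>)"
  shows "weighted_conv b \<phi> (single \<beta> h) (\<beta> @ \<alpha>) = sqrt (b \<beta> / b (\<beta> @ \<alpha>)) *\<^sub>R \<phi> \<alpha> h"
    and "(\<nexists>\<alpha>. \<gamma> = \<beta> @ \<alpha>) \<Longrightarrow> weighted_conv b \<phi> (single \<beta> h) \<gamma> = 0"
proof -
  have "weighted_conv b \<phi> (single \<beta> h) (\<beta> @ \<alpha>)
      = (\<Sum>(\<beta>', \<alpha>') \<in> {(\<beta>, \<alpha>)}. sqrt (b \<beta>' / b (\<beta> @ \<alpha>)) *\<^sub>R \<phi> \<alpha>' (single \<beta> h \<beta>'))"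
    unfolding weighted_conv_def
    by (rule sum.mono_neutral_right[OF finite_factorizations])
      (auto simp: single_def bounded_clinear_zero[OF assms] split: if_split_asm)
  then show "weighted_conv b \<phi> (single \<beta> h) (\<beta> @ \<alpha>) = sqrt (b \<beta> / b (\<beta> @ \<alpha>)) *\<^sub>R \<phi> \<alpha> h"
    by (simp add: single_def)
  show "(\<nexists>\<alpha>. \<gamma> = \<beta> @ \<alpha>) \<Longrightarrow> weighted_conv b \<phi> (single \<beta> h) \<gamma> = 0"
    unfolding weighted_conv_def
    by (rule sum.neutral) (auto simp: single_def bounded_clinear_zero[OF assms])
qed

context
  fixes b :: "'n list \<Rightarrow> real"
  assumes pos: "\<And>\<alpha>. b \<alpha> > 0"
begin

text \<open>The defining sums agree term by term, so the equations hold for arbitrary families;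
  \<open>Psi_matrix_norm\<close> applies them to sums of images.\<close>

lemma F2_norm_rescale:
  "F2_norm b (\<lambda>\<alpha>. sqrt (b \<alpha>) *\<^sub>R x \<alpha>) = F2_norm fock_weight x"
  "F2_norm fock_weight (\<lambda>\<alpha>. (1 / sqrt (b \<alpha>)) *\<^sub>R x \<alpha>) = F2_norm b x"
proof -
  have "(norm (sqrt (b \<alpha>) *\<^sub>R x \<alpha>))\<^sup>2 / b \<alpha> = (norm (x \<alpha>))\<^sup>2 / 1"
    "(norm ((1 / sqrt (b \<alpha>)) *\<^sub>R x \<alpha>))\<^sup>2 / 1 = (norm (x \<alpha>))\<^sup>2 / b \<alpha>" for \<alpha>
    using pos[of \<alpha>] by (simp_all add: power_mult_distrib power_divide)
  then show "F2_norm b (\<lambda>\<alpha>. sqrt (b \<alpha>) *\<^sub>R x \<alpha>) = F2_norm fock_weight x"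
    "F2_norm fock_weight (\<lambda>\<alpha>. (1 / sqrt (b \<alpha>)) *\<^sub>R x \<alpha>) = F2_norm b x"
    unfolding F2_norm_def by simp_all
qed

lemma F2_rescale:
  "(\<lambda>\<alpha>. sqrt (b \<alpha>) *\<^sub>R x \<alpha>) \<in> F2 b \<longleftrightarrow> x \<in> Fock"
  "(\<lambda>\<alpha>. (1 / sqrt (b \<alpha>)) *\<^sub>R x \<alpha>) \<in> Fock \<longleftrightarrow> x \<in> F2 b"
proof -
  have "(norm (sqrt (b \<alpha>) *\<^sub>R x \<alpha>))\<^sup>2 / b \<alpha> = (norm (x \<alpha>))\<^sup>2 / 1"
    "(norm ((1 / sqrt (b \<alpha>)) *\<^sub>R x \<alpha>))\<^sup>2 / 1 = (norm (x \<alpha>))\<^sup>2 / b \<alpha>" for \<alpha>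
    using pos[of \<alpha>] by (simp_all add: power_mult_distrib power_divide)
  then show "(\<lambda>\<alpha>. sqrt (b \<alpha>) *\<^sub>R x \<alpha>) \<in> F2 b \<longleftrightarrow> x \<in> Fock"
    "(\<lambda>\<alpha>. (1 / sqrt (b \<alpha>)) *\<^sub>R x \<alpha>) \<in> Fock \<longleftrightarrow> x \<in> F2 b"
    unfolding F2_def by simp_all
qed

lemma from_Fock_F2: "x \<in> Fock \<Longrightarrow> from_Fock b x \<in> F2 b"
  and to_Fock_Fock: "y \<in> F2 b \<Longrightarrow> to_Fock b y \<in> Fock"
  and from_Fock_to_Fock: "y \<in> F2 b \<Longrightarrow> from_Fock b (to_Fock b y) = y"
  and F2_norm_from_Fock: "x \<in> Fock \<Longrightarrow> F2_norm b (from_Fock b x) = F2_norm fock_weight x"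
  and F2_norm_to_Fock: "y \<in> F2 b \<Longrightarrow> F2_norm fock_weight (to_Fock b y) = F2_norm b y"
  using pos by (simp_all add: from_Fock_def to_Fock_def F2_rescale F2_norm_rescale less_imp_neq[THEN not_sym]
      fun_eq_iff)

lemma from_Fock_bop: "from_Fock b \<in> bop fock_weight b"
  by (rule bopI[OF one_pos pos, where C=1])
    (simp_all add: from_Fock_F2 F2_norm_from_Fock,
      auto simp: from_Fock_def F2_add[OF one_pos] F2_scaleC[OF one_pos] scaleR_add_right scaleC_scaleR)

lemma to_Fock_bop: "to_Fock b \<in> bop b fock_weight"
  by (rule bopI[OF pos one_pos, where C=1])
    (simp_all add: to_Fock_Fock F2_norm_to_Fock,
      auto simp: to_Fock_def F2_add[OF pos] F2_scaleC[OF pos] scaleR_add_right scaleC_scaleR)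

lemma tensor_op_U: "tensor_op fock_weight b (U_op b) id = (from_Fock b :: ('n list \<Rightarrow> 'k::chilbert) \<Rightarrow> _)"
proof (rule tensor_op_eqI[OF one_pos pos])
  have "from_Fock b (tensor_vec \<xi> h) = tensor_vec (U_op b \<xi>) (id h)" if "\<xi> \<in> Fock" for \<xi> and h :: 'k
  proof -
    have "tensor_vec \<xi> h \<in> Fock"
    proof (rule F2_mono(1)[OF one_pos])
      show "(\<lambda>\<alpha>. norm h *\<^sub>R \<xi> \<alpha>) \<in> Fock" by (rule F2_scaleR(1)[OF one_pos that])
    qed (simp add: tensor_vec_def norm_scaleC mult.commute)
    then show ?thesis
      using that by (simp add: from_Fock_def U_op_def tensor_vec_def fun_eq_iff flip: scaleC_scaleC scaleC_of_real)
  qed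
  then show "is_tensor_op fock_weight b (U_op b) id (from_Fock b :: ('n list \<Rightarrow> 'k) \<Rightarrow> _)"
    by (simp add: is_tensor_op_def from_Fock_bop)
qed

text \<open>A positive diagonal rescaling onto the weight \<open>b\<close> has the inverse rescaling
  as adjoint, since sqrt(b)/b = 1/sqrt(b). The description \<open>THE\<close> is settled by pairing
  with basis vectors, which reads off every coordinate.\<close>

lemma adjoint_U: "adjoint_op fock_weight b (U_op b) = to_Fock b"
  unfolding adjoint_op_def
proof (rule the_equality)
  have adj: "F2_inner b (U_op b x) y = F2_inner fock_weight x (to_Fock b y)" if "x \<in> Fock" "y \<in> F2 b" for x y
  proof -
    have "sqrt (b \<alpha>) * sqrt (b \<alpha>) = b \<alpha>" "sqrt (b \<alpha>) \<noteq> 0" for \<alpha> using pos[of \<alpha>] by simp_all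
    then have "complex_of_real (sqrt (b \<alpha>)) / complex_of_real (b \<alpha>) = 1 / complex_of_real (sqrt (b \<alpha>))" for \<alpha>
      by (metis divide_divide_eq_left' divide_self of_real_eq_0_iff of_real_mult)
    then have "cinner (complex_of_real (sqrt (b \<alpha>)) * x \<alpha>) (y \<alpha>) / complex_of_real (b \<alpha>)
        = cinner (x \<alpha>) ((1 / sqrt (b \<alpha>)) *\<^sub>R y \<alpha>)" for \<alpha>
      unfolding cinner_scaleR_right
      by (simp add: cinner_complex_def) (metis times_divide_eq_left mult.commute mult.left_commute divide_inverse mult_1)
    then show ?thesis
      using that by (simp add: F2_inner_def U_op_def to_Fock_def)
  qed
  then show "to_Fock b \<in> bop b fock_weight \<and>
    (\<forall>x\<in>Fock. \<forall>y\<in>F2 b. F2_inner b (U_op b x) y = F2_inner fock_weight x (to_Fock b y))"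
    by (simp add: to_Fock_bop)
  fix S assume S: "S \<in> bop b fock_weight \<and>
    (\<forall>x\<in>Fock. \<forall>y\<in>F2 b. F2_inner b (U_op b x) y = F2_inner fock_weight x (S y))"
  show "S = to_Fock b"
  proof (rule extensionalityI[of _ "F2 b"])
    show "S \<in> extensional (F2 b)" using S by (simp add: bop_def PiE_def)
    show "to_Fock b \<in> extensional (F2 b)" by (simp add: to_Fock_def)
    fix y :: "'n list \<Rightarrow> complex" assume y: "y \<in> F2 b"
    show "S y = to_Fock b y"
    proof
      fix \<alpha> :: "'n list"
      have s: "single \<alpha> (1::complex) \<in> Fock" by (rule single_F2[OF one_pos])
      have "F2_inner fock_weight (single \<alpha> 1) (S y) = F2_inner fock_weight (single \<alpha> 1) (to_Fock b y)"
        using S s y adj[OF s y] by metis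
      then show "S y \<alpha> = to_Fock b y \<alpha>"
        by (simp add: F2_inner_single_left cinner_complex_def)
    qed
  qed
qed

lemma tensor_op_adjoint_U:
  "tensor_op b fock_weight (adjoint_op fock_weight b (U_op b)) id = (to_Fock b :: ('n list \<Rightarrow> 'k::chilbert) \<Rightarrow> _)"
proof (rule tensor_op_eqI[OF pos one_pos])
  have "to_Fock b (tensor_vec \<xi> h) = tensor_vec (to_Fock b \<xi>) (id h)" if "\<xi> \<in> F2 b" for \<xi> and h :: 'k
  proof -
    have "tensor_vec \<xi> h \<in> F2 b"
    proof (rule F2_mono(1)[OF pos])
      show "(\<lambda>\<alpha>. norm h *\<^sub>R \<xi> \<alpha>) \<in> F2 b" by (rule F2_scaleR(1)[OF pos that])
    qed (simp add: tensor_vec_def norm_scaleC mult.commute)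
    then show ?thesis
      using that by (simp add: to_Fock_def tensor_vec_def scaleR_conv_of_real scaleC_scaleC fun_eq_iff flip: scaleC_of_real)
  qed
  then show "is_tensor_op b fock_weight (adjoint_op fock_weight b (U_op b)) id (to_Fock b :: ('n list \<Rightarrow> 'k) \<Rightarrow> _)"
    by (simp add: is_tensor_op_def to_Fock_bop adjoint_U)
qed

lemma Psi_eq_compose:
  "Psi b \<phi> = compose Fock (to_Fock b) (compose Fock (R_op b \<phi>) (from_Fock b))"
  by (simp add: Psi_def tensor_op_U tensor_op_adjoint_U)

lemma weighted_conv_eq:
  assumes "\<And>\<alpha>. bounded_clinear (\<phi> \<alpha>)"
  shows "weighted_conv b \<phi> x = (\<lambda>\<gamma>. (1 / sqrt (b \<gamma>)) *\<^sub>R series_mult (\<lambda>\<beta>. sqrt (b \<beta>) *\<^sub>R x \<beta>) \<phi> \<gamma>)"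
  by (simp add: weighted_conv_def series_mult_def bounded_clinear_scaleR[OF assms] scaleR_sum_right
      case_prod_unfold real_sqrt_divide)

text \<open>Rescaling is a bijection between \<open>Fock\<close> and \<open>F2 b\<close>, so the
  multiplier condition can be tested on Fock space, where the later estimates take place.\<close>

lemma right_multiplier_iff:
  fixes \<phi> :: "'n list \<Rightarrow> 'k::chilbert \<Rightarrow> 'k"
  shows "\<phi> \<in> right_multipliers b \<longleftrightarrow>
     (\<forall>\<alpha>. bounded_clinear (\<phi> \<alpha>)) \<and> (\<forall>x\<in>Fock. weighted_conv b \<phi> x \<in> Fock)"
proof (cases "\<forall>\<alpha>. bounded_clinear (\<phi> \<alpha>)")
  case True
  have *: "weighted_conv b \<phi> x \<in> Fock \<longleftrightarrow> series_mult (\<lambda>\<beta>. sqrt (b \<beta>) *\<^sub>R x \<beta>) \<phi> \<in> F2 b" for x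
    using True by (simp add: weighted_conv_eq F2_rescale)
  have "(\<forall>x\<in>Fock. weighted_conv b \<phi> x \<in> Fock) \<longleftrightarrow> (\<forall>\<zeta>\<in>F2 b. series_mult \<zeta> \<phi> \<in> F2 b)"
    unfolding *
  proof (intro iffI ballI)
    fix \<zeta> :: "'n list \<Rightarrow> 'k"
    assume *: "\<forall>x\<in>Fock. series_mult (\<lambda>\<beta>. sqrt (b \<beta>) *\<^sub>R x \<beta>) \<phi> \<in> F2 b" and "\<zeta> \<in> F2 b"
    then have "(\<lambda>\<beta>. (1 / sqrt (b \<beta>)) *\<^sub>R \<zeta> \<beta>) \<in> Fock" by (simp add: F2_rescale)
    from bspec[OF * this] show "series_mult \<zeta> \<phi> \<in> F2 b"
      using pos by (simp add: less_imp_neq[THEN not_sym])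
  qed (simp add: F2_rescale)
  then show ?thesis using True by (simp add: right_multipliers_def)
qed (auto simp: right_multipliers_def)

lemma Psi_eq:
  assumes "\<phi> \<in> right_multipliers b"
  shows "Psi b \<phi> = (\<lambda>x\<in>Fock. weighted_conv b \<phi> x)"
proof
  fix x
  have bc: "\<And>\<alpha>. bounded_clinear (\<phi> \<alpha>)" using assms by (simp add: right_multipliers_def)
  show "Psi b \<phi> x = (\<lambda>x\<in>Fock. weighted_conv b \<phi> x) x"
  proof (cases "x \<in> Fock")
    case True
    then have "(\<lambda>\<alpha>. sqrt (b \<alpha>) *\<^sub>R x \<alpha>) \<in> F2 b" by (simp add: F2_rescale)
    then show ?thesis
      using True assms
      by (simp add: Psi_eq_compose compose_def from_Fock_def to_Fock_def R_op_def right_multipliers_def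
          weighted_conv_eq[OF bc])
  qed (simp add: Psi_eq_compose compose_def)
qed

text \<open>A multiplier is only required to map the space into itself, so boundedness has to be
  proved. Each output coordinate is a finite sum of bounded terms, hence continuous, and
  \<open>coordinatewise_bounded_imp_bounded\<close> applies.\<close>

lemma Psi_bop:
  fixes \<phi> :: "'n list \<Rightarrow> 'k::chilbert \<Rightarrow> 'k"
  assumes \<phi>: "\<phi> \<in> right_multipliers b"
  shows "Psi b \<phi> \<in> bop fock_weight fock_weight"
proof -
  have bc: "\<And>\<alpha>. bounded_clinear (\<phi> \<alpha>)" using assms by (simp add: right_multipliers_def)
  have cl: "\<And>x. x \<in> Fock \<Longrightarrow> weighted_conv b \<phi> x \<in> Fock" using \<phi> by (simp add: right_multiplier_iff)
  have "\<forall>\<alpha>. \<exists>K. K \<ge> 0 \<and> (\<forall>h. norm (\<phi> \<alpha> h) \<le> K * norm h)"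
    using bounded_clinear_bound[OF bc] by metis
  then obtain K where K: "\<And>\<alpha>. K \<alpha> \<ge> 0" "\<And>\<alpha> h. norm (\<phi> \<alpha> h) \<le> K \<alpha> * norm h"
    by (metis (no_types))
  have "\<exists>K. \<forall>x\<in>Fock. norm (weighted_conv b \<phi> x \<gamma>) \<le> K * F2_norm fock_weight x" for \<gamma>
  proof (intro exI ballI)
    fix x :: "'n list \<Rightarrow> 'k" assume x: "x \<in> Fock"
    have "norm (weighted_conv b \<phi> x \<gamma>) \<le> (\<Sum>(\<beta>, \<alpha>) | \<beta> @ \<alpha> = \<gamma>. norm (sqrt (b \<beta> / b \<gamma>) *\<^sub>R \<phi> \<alpha> (x \<beta>)))"
      unfolding weighted_conv_def by (rule order_trans[OF norm_sum]) (simp add: case_prod_unfold)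
    also have "\<dots> \<le> (\<Sum>(\<beta>, \<alpha>) | \<beta> @ \<alpha> = \<gamma>. (sqrt (b \<beta> / b \<gamma>) * K \<alpha>) * F2_norm fock_weight x)"
    proof (rule sum_mono, clarify)
      fix \<beta> \<alpha>
      have "norm (\<phi> \<alpha> (x \<beta>)) \<le> K \<alpha> * F2_norm fock_weight x"
        using F2_coord_le[OF one_pos x, of \<beta>] K(1)
        by (intro order_trans[OF K(2)] mult_left_mono) auto
      then show "norm (sqrt (b \<beta> / b (\<beta> @ \<alpha>)) *\<^sub>R \<phi> \<alpha> (x \<beta>)) \<le> sqrt (b \<beta> / b (\<beta> @ \<alpha>)) * K \<alpha> * F2_norm fock_weight x"
        using pos[of \<beta>] pos[of "\<beta> @ \<alpha>"] by (simp add: mult.assoc mult_left_mono)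
    qed
    also have "\<dots> = (\<Sum>(\<beta>, \<alpha>) | \<beta> @ \<alpha> = \<gamma>. sqrt (b \<beta> / b \<gamma>) * K \<alpha>) * F2_norm fock_weight x"
      by (simp add: sum_distrib_right case_prod_unfold)
    finally show "norm (weighted_conv b \<phi> x \<gamma>) \<le> (\<Sum>(\<beta>, \<alpha>) | \<beta> @ \<alpha> = \<gamma>. sqrt (b \<beta> / b \<gamma>) * K \<alpha>) * F2_norm fock_weight x" .
  qed
  note coord = this
  have "weighted_conv b \<phi> (\<lambda>\<alpha>. r *\<^sub>R x \<alpha>) = (\<lambda>\<alpha>. r *\<^sub>R weighted_conv b \<phi> x \<alpha>)" for r x
    using weighted_conv_scaleC[OF bc, where a = "complex_of_real r"] by (simp add: scaleC_of_real)
  from coordinatewise_bounded_imp_bounded[OF one_pos cl weighted_conv_add[OF bc] this coord]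
  obtain C where "\<And>x. x \<in> Fock \<Longrightarrow> F2_norm fock_weight (weighted_conv b \<phi> x) \<le> C * F2_norm fock_weight x"
    by blast
  then show ?thesis
    unfolding Psi_eq[OF \<phi>]
    by (intro bopI[OF one_pos one_pos, where C=C])
      (auto simp: cl weighted_conv_add[OF bc] weighted_conv_scaleC[OF bc] F2_add[OF one_pos] F2_scaleC[OF one_pos])
qed

end

subsection \<open>Algebraic properties of \<open>\<Psi>\<close>\<close>

text \<open>Both sides sum over the factorizations of \<gamma> into three words. As multiplication
  is from the right, \<open>\<psi>\<close> acts first and its word is the left factor of the new
  index.\<close>

lemma series_mult_assoc:
  assumes "\<And>\<alpha>. bounded_clinear (\<phi> \<alpha>)"
  shows "series_mult (series_mult \<zeta> \<psi>) \<phi>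
    = series_mult \<zeta> (\<lambda>\<gamma> h. \<Sum>(\<beta>, \<alpha>) | \<beta> @ \<alpha> = \<gamma>. \<phi> \<alpha> (\<psi> \<beta> h))"
proof
  fix \<gamma>
  let ?S = "\<lambda>\<gamma>. {(\<beta>, \<alpha>). \<beta> @ \<alpha> = \<gamma>}"
  have "series_mult (series_mult \<zeta> \<psi>) \<phi> \<gamma>
      = (\<Sum>p\<in>?S \<gamma>. \<Sum>q\<in>?S (fst p). \<phi> (snd p) (\<psi> (snd q) (\<zeta> (fst q))))"
    by (simp add: series_mult_def bounded_clinear_sum[OF assms] case_prod_unfold)
  also have "\<dots> = (\<Sum>(p, q)\<in>Sigma (?S \<gamma>) (\<lambda>p. ?S (fst p)). \<phi> (snd p) (\<psi> (snd q) (\<zeta> (fst q))))"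
    by (rule sum.Sigma) (simp_all add: finite_factorizations)
  \<comment> \<open>The bijection moves the bracket from (\<nu>\<beta>)\<alpha> to
    \<nu>(\<beta>\<alpha>).\<close>
  also have "\<dots> = (\<Sum>(p, q)\<in>Sigma (?S \<gamma>) (\<lambda>p. ?S (snd p)). \<phi> (snd q) (\<psi> (fst q) (\<zeta> (fst p))))"
    by (rule sum.reindex_bij_witness[of _ "\<lambda>((\<nu>, \<delta>), (\<beta>, \<alpha>)). ((\<nu> @ \<beta>, \<alpha>), (\<nu>, \<beta>))"
          "\<lambda>((\<mu>, \<alpha>), (\<nu>, \<beta>)). ((\<nu>, \<beta> @ \<alpha>), (\<beta>, \<alpha>))"]) auto
  also have "\<dots> = (\<Sum>p\<in>?S \<gamma>. \<Sum>q\<in>?S (snd p). \<phi> (snd q) (\<psi> (fst q) (\<zeta> (fst p))))"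
    by (rule sum.Sigma[symmetric]) (simp_all add: finite_factorizations)
  also have "\<dots> = series_mult \<zeta> (\<lambda>\<gamma> h. \<Sum>(\<beta>, \<alpha>) | \<beta> @ \<alpha> = \<gamma>. \<phi> \<alpha> (\<psi> \<beta> h)) \<gamma>"
    by (simp add: series_mult_def case_prod_unfold)
  finally show "series_mult (series_mult \<zeta> \<psi>) \<phi> \<gamma>
    = series_mult \<zeta> (\<lambda>\<gamma> h. \<Sum>(\<beta>, \<alpha>) | \<beta> @ \<alpha> = \<gamma>. \<phi> \<alpha> (\<psi> \<beta> h)) \<gamma>" .
qed

lemma weighted_conv_plus:
  "weighted_conv b (\<lambda>\<alpha> h. \<phi> \<alpha> h + \<psi> \<alpha> h) x = (\<lambda>\<gamma>. weighted_conv b \<phi> x \<gamma> + weighted_conv b \<psi> x \<gamma>)"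
  by (simp add: weighted_conv_def scaleR_add_right sum.distrib case_prod_unfold)

lemma weighted_conv_scale:
  "weighted_conv b (\<lambda>\<alpha> h. a *\<^sub>C \<phi> \<alpha> h) x = (\<lambda>\<gamma>. a *\<^sub>C weighted_conv b \<phi> x \<gamma>)"
  by (simp add: weighted_conv_def scaleC_sum_right scaleC_scaleR case_prod_unfold)

context
  fixes b :: "'n list \<Rightarrow> real"
  assumes pos: "\<And>\<alpha>. b \<alpha> > 0"
begin

lemma right_multipliers_plus:
  assumes "\<phi> \<in> right_multipliers b" "\<psi> \<in> right_multipliers b"
  shows "(\<lambda>\<alpha> h. \<phi> \<alpha> h + \<psi> \<alpha> h) \<in> right_multipliers b"
  using assms
  by (auto simp: right_multiplier_iff[OF pos] weighted_conv_plus intro: bounded_clinear_plus F2_add(1)[OF one_pos])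

lemma right_multipliers_scale:
  assumes "\<phi> \<in> right_multipliers b"
  shows "(\<lambda>\<alpha> h. a *\<^sub>C \<phi> \<alpha> h) \<in> right_multipliers b"
  using assms
  by (auto simp: right_multiplier_iff[OF pos] weighted_conv_scale intro: bounded_clinear_scale F2_scaleC(1)[OF one_pos])

text \<open>The column at the empty word contains every coefficient, each up to a positive
  factor.\<close>

lemma Psi_inj: "inj_on (Psi b :: ('n list \<Rightarrow> 'k::chilbert \<Rightarrow> 'k) \<Rightarrow> _) (right_multipliers b)"
proof (rule inj_onI, intro ext)
  fix \<phi> \<psi> :: "'n list \<Rightarrow> 'k \<Rightarrow> 'k" and \<alpha> h
  assume \<phi>: "\<phi> \<in> right_multipliers b" and \<psi>: "\<psi> \<in> right_multipliers b" and eq: "Psi b \<phi> = Psi b \<psi>"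
  have bc: "\<And>\<alpha>. bounded_clinear (\<phi> \<alpha>)" "\<And>\<alpha>. bounded_clinear (\<psi> \<alpha>)"
    using \<phi> \<psi> by (simp_all add: right_multipliers_def)
  have s: "(single [] h :: 'n list \<Rightarrow> 'k) \<in> Fock" by (rule single_F2[OF one_pos])
  have "weighted_conv b \<phi> (single [] h) ([] @ \<alpha>) = weighted_conv b \<psi> (single [] h) ([] @ \<alpha>)"
    using fun_cong[OF eq, of "single [] h"] s by (simp add: Psi_eq[OF pos] \<phi> \<psi>)
  then show "\<phi> \<alpha> h = \<psi> \<alpha> h"
    using pos[of "[]"] pos[of \<alpha>] unfolding weighted_conv_single(1)[OF bc(1)] weighted_conv_single(1)[OF bc(2)]
    by simp
qed

text \<open>The product of \<open>right_multiplier_algebra\<close> is an \<open>inv_into\<close>,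
  which is meaningful only if the composite is again of the form \<open>R_op b \<rho>\<close>.
  Associativity provides \<open>\<rho>\<close> as the Cauchy product of the coefficients.\<close>

lemma R_op_compose:
  fixes \<phi> \<psi> :: "'n list \<Rightarrow> 'k::chilbert \<Rightarrow> 'k"
  assumes \<phi>: "\<phi> \<in> right_multipliers b" and \<psi>: "\<psi> \<in> right_multipliers b"
  shows "compose (F2 b) (R_op b \<phi>) (R_op b \<psi>) \<in> R_op b ` right_multipliers b"
proof (rule image_eqI)
  let ?\<rho> = "\<lambda>\<gamma> h. \<Sum>(\<beta>, \<alpha>) | \<beta> @ \<alpha> = \<gamma>. \<phi> \<alpha> (\<psi> \<beta> h)"
  have bc: "\<And>\<alpha>. bounded_clinear (\<phi> \<alpha>)" "\<And>\<alpha>. bounded_clinear (\<psi> \<alpha>)"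
    using \<phi> \<psi> by (simp_all add: right_multipliers_def)
  have "bounded_clinear (?\<rho> \<gamma>)" for \<gamma>
    unfolding case_prod_unfold by (intro bounded_clinear_sum_fun bounded_clinear_comp[OF bc])
  then show "?\<rho> \<in> right_multipliers b"
    using \<phi> \<psi> by (auto simp: right_multipliers_def series_mult_assoc[OF bc(1), symmetric])
  show "compose (F2 b) (R_op b \<phi>) (R_op b \<psi>) = R_op b ?\<rho>"
  proof
    fix x show "compose (F2 b) (R_op b \<phi>) (R_op b \<psi>) x = R_op b ?\<rho> x"
      using \<psi> by (auto simp: compose_def R_op_def right_multipliers_def series_mult_assoc[OF bc(1)])
  qed
qed

lemma multiplier_product:
  assumes "\<phi> \<in> right_multipliers b" "\<psi> \<in> right_multipliers b"
  defines "\<rho> \<equiv> inv_into (right_multipliers b) (R_op b) (compose (F2 b) (R_op b \<phi>) (R_op b \<psi>))"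
  shows "\<rho> \<in> right_multipliers b" "R_op b \<rho> = compose (F2 b) (R_op b \<phi>) (R_op b \<psi>)"
  unfolding \<rho>_def using R_op_compose[OF assms(1,2)] by (rule inv_into_into, rule f_inv_into_f)

lemma R_op_closed: "\<phi> \<in> right_multipliers b \<Longrightarrow> x \<in> F2 b \<Longrightarrow> R_op b \<phi> x \<in> F2 b"
  by (simp add: R_op_def right_multipliers_def)

text \<open>The inner pair U_f U_f^* cancels between the two conjugates.\<close>

lemma Psi_mult:
  assumes \<phi>: "\<phi> \<in> right_multipliers b" and \<psi>: "\<psi> \<in> right_multipliers b"
  shows "Psi b (inv_into (right_multipliers b) (R_op b) (compose (F2 b) (R_op b \<phi>) (R_op b \<psi>)))
    = compose Fock (Psi b \<phi>) (Psi b \<psi>)"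
proof
  fix x
  show "Psi b (inv_into (right_multipliers b) (R_op b) (compose (F2 b) (R_op b \<phi>) (R_op b \<psi>))) x
    = compose Fock (Psi b \<phi>) (Psi b \<psi>) x"
  proof (cases "x \<in> Fock")
    case True
    then have "from_Fock b x \<in> F2 b" by (rule from_Fock_F2[OF pos])
    moreover from this have "R_op b \<psi> (from_Fock b x) \<in> F2 b" by (rule R_op_closed[OF \<psi>])
    ultimately show ?thesis
      using True
      by (simp add: Psi_eq_compose[OF pos] multiplier_product(2)[OF \<phi> \<psi>] compose_eq to_Fock_Fock[OF pos]
          from_Fock_to_Fock[OF pos])
  qed (simp add: Psi_eq_compose[OF pos] compose_def)
qed

text \<open>Componentwise rescaling maps one unit ball of the direct sum onto the other and
  preserves the values, so both suprema range over one and the same set of reals.\<close>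

lemma Psi_matrix_norm:
  fixes X :: "nat \<Rightarrow> nat \<Rightarrow> 'n list \<Rightarrow> 'k::chilbert \<Rightarrow> 'k"
  assumes X: "\<And>i j. i < m \<Longrightarrow> j < m \<Longrightarrow> X i j \<in> right_multipliers b"
  shows "matrix_op_norm fock_weight m (\<lambda>i j. Psi b (X i j)) = matrix_op_norm b m (\<lambda>i j. R_op b (X i j))"
proof -
  define D where "D c = {x :: nat \<Rightarrow> 'n list \<Rightarrow> 'k. (\<forall>j<m. x j \<in> F2 c) \<and> (\<Sum>j<m. (F2_norm c (x j))\<^sup>2) \<le> 1}" for c :: "'n list \<Rightarrow> real"
  define f where "f = (\<lambda>x. sqrt (\<Sum>i<m. (F2_norm fock_weight (\<lambda>\<alpha>. \<Sum>j<m. Psi b (X i j) (x j) \<alpha>))\<^sup>2))"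
  define g where "g = (\<lambda>x. sqrt (\<Sum>i<m. (F2_norm b (\<lambda>\<alpha>. \<Sum>j<m. R_op b (X i j) (x j) \<alpha>))\<^sup>2))"
  have fg: "f x = g (\<lambda>j. from_Fock b (x j))" if x: "\<forall>j<m. x j \<in> Fock" for x
  proof -
    have "F2_norm fock_weight (\<lambda>\<alpha>. \<Sum>j<m. Psi b (X i j) (x j) \<alpha>)
        = F2_norm b (\<lambda>\<alpha>. \<Sum>j<m. R_op b (X i j) (from_Fock b (x j)) \<alpha>)" if i: "i < m" for i
    proof -
      have "(\<lambda>\<alpha>. \<Sum>j<m. Psi b (X i j) (x j) \<alpha>)
          = (\<lambda>\<alpha>. (1 / sqrt (b \<alpha>)) *\<^sub>R (\<Sum>j<m. R_op b (X i j) (from_Fock b (x j)) \<alpha>))"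
        unfolding scaleR_sum_right
        using x i by (intro ext sum.cong refl)
          (simp add: Psi_eq_compose[OF pos] compose_eq to_Fock_def R_op_closed[OF X] from_Fock_F2[OF pos])
      then show ?thesis by (simp only: F2_norm_rescale[OF pos])
    qed
    then show ?thesis by (simp add: f_def g_def)
  qed
  have "f ` D fock_weight = g ` D b"
  proof (intro equalityI subsetI; elim imageE)
    fix r x assume r: "r = f x" and x: "x \<in> D fock_weight"
    have "(\<lambda>j. from_Fock b (x j)) \<in> D b"
      using x by (simp add: D_def from_Fock_F2[OF pos] F2_norm_from_Fock[OF pos])
    then show "r \<in> g ` D b" using r fg x by (auto simp: D_def)
  next
    fix r y assume r: "r = g y" and y: "y \<in> D b"
    define x where "x = (\<lambda>j. to_Fock b (y j))"
    have x: "x \<in> D fock_weight"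
      using y by (simp add: D_def x_def to_Fock_Fock[OF pos] F2_norm_to_Fock[OF pos])
    have "g (\<lambda>j. from_Fock b (x j)) = g y"
      using y unfolding g_def x_def D_def by (simp add: from_Fock_to_Fock[OF pos])
    then have "r = f x" using fg x r by (simp add: D_def)
    then show "r \<in> f ` D fock_weight" using x by blast
  qed
  then show ?thesis
    unfolding matrix_op_norm_def D_def f_def g_def by (rule arg_cong)
qed

text \<open>The target is the range of \<open>Psi b\<close> with its inherited structure;
  identifying this range with the Hardy algebra occupies the rest of the proof.\<close>

lemma Psi_completely_isometric:
  "completely_isometric_isomorphism (right_multiplier_algebra b)
     (concrete_operator_algebra (Psi b ` right_multipliers b)) (Psi b)"
proof -
  let ?M = "right_multipliers b"
  have add: "Psi b (\<lambda>\<alpha> h. \<phi> \<alpha> h + \<psi> \<alpha> h) = (\<lambda>x\<in>Fock. \<lambda>\<alpha>. Psi b \<phi> x \<alpha> + Psi b \<psi> x \<alpha>)"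
    if "\<phi> \<in> ?M" "\<psi> \<in> ?M" for \<phi> \<psi>
    using that by (simp add: Psi_eq[OF pos] right_multipliers_plus weighted_conv_plus cong: restrict_cong)
  have scale: "Psi b (\<lambda>\<alpha> h. a *\<^sub>C \<phi> \<alpha> h) = (\<lambda>x\<in>Fock. \<lambda>\<alpha>. a *\<^sub>C Psi b \<phi> x \<alpha>)"
    if "\<phi> \<in> ?M" for a \<phi>
    using that by (simp add: Psi_eq[OF pos] right_multipliers_scale weighted_conv_scale cong: restrict_cong)
  note mult = Psi_mult
  have "oa_closed (right_multiplier_algebra b)"
    by (simp add: oa_closed_def right_multiplier_algebra_def right_multipliers_plus right_multipliers_scale
        multiplier_product)
  moreover have "oa_closed (concrete_operator_algebra (Psi b ` ?M))"
    unfolding oa_closed_def concrete_operator_algebra_def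
    by (auto simp: add[symmetric] scale[symmetric] mult[symmetric]
        intro!: imageI right_multipliers_plus right_multipliers_scale multiplier_product(1))
  moreover have "bij_betw (Psi b) ?M (Psi b ` ?M)"
    using Psi_inj by (simp add: bij_betw_def)
  ultimately show ?thesis
    unfolding completely_isometric_isomorphism_def
    by (simp add: right_multiplier_algebra_def concrete_operator_algebra_def add scale mult Psi_matrix_norm)
qed

end

subsection \<open>Elements of the Hardy algebra are convolution operators\<close>

text \<open>
  The relations between matrix entries that single out the operators \<open>\<Psi>(\<phi>)\<close>; each is an equation
  between two matrix entries, so it passes to weak limits.
\<close>

definition shift_covariant ::
    "('n list \<Rightarrow> real) \<Rightarrow> (('n list \<Rightarrow> 'k::chilbert) \<Rightarrow> 'n list \<Rightarrow> 'k) \<Rightarrow> bool" where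
  "shift_covariant b T \<longleftrightarrow>
     (\<forall>\<beta> \<alpha> h. T (single \<beta> h) (\<beta> @ \<alpha>) = sqrt (b \<beta> * b \<alpha> / b (\<beta> @ \<alpha>)) *\<^sub>R T (single [] h) \<alpha>) \<and>
     (\<forall>\<beta> \<gamma> h. (\<nexists>\<alpha>. \<gamma> = \<beta> @ \<alpha>) \<longrightarrow> T (single \<beta> h) \<gamma> = 0)"

text \<open>Letters are appended at the right end and the last letter of \<open>\<beta>\<close> acts
  first, whence \<open>rev \<beta>\<close>. The weights of the successive letters telescope.\<close>

lemma Lambda_word_append:
  "Lambda_word b \<beta> \<xi> (\<gamma> @ rev \<beta>) = complex_of_real (sqrt (b \<gamma> / b (\<gamma> @ rev \<beta>))) * \<xi> \<gamma>"
  if "\<And>\<alpha>. b \<alpha> > 0" for b :: "'n list \<Rightarrow> real"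
proof (induction \<beta>)
  case Nil
  then show ?case using that[of \<gamma>] by (simp add: Lambda_word_def)
next
  case (Cons i \<beta>)
  have "Lambda_word b (i # \<beta>) \<xi> (\<gamma> @ rev (i # \<beta>))
      = complex_of_real (sqrt (b (\<gamma> @ rev \<beta>) / b (\<gamma> @ rev \<beta> @ [i]))) * Lambda_word b \<beta> \<xi> (\<gamma> @ rev \<beta>)"
    by (simp add: Lambda_word_def Lambda_def butlast_append flip: append_assoc)
  also have "\<dots> = complex_of_real (sqrt (b (\<gamma> @ rev \<beta>) / b (\<gamma> @ rev \<beta> @ [i])) * sqrt (b \<gamma> / b (\<gamma> @ rev \<beta>))) * \<xi> \<gamma>"
    by (simp only: Cons.IH of_real_mult mult.assoc)
  also have "sqrt (b (\<gamma> @ rev \<beta>) / b (\<gamma> @ rev \<beta> @ [i])) * sqrt (b \<gamma> / b (\<gamma> @ rev \<beta>)) = sqrt (b \<gamma> / b (\<gamma> @ rev \<beta> @ [i]))"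
    using that[of "\<gamma> @ rev \<beta>"] by (simp flip: real_sqrt_mult)
  finally show ?case by simp
qed

lemma Lambda_word_eq_0: "(\<nexists>\<gamma>. \<delta> = \<gamma> @ rev \<beta>) \<Longrightarrow> Lambda_word b \<beta> \<xi> \<delta> = 0"
proof (induction \<beta> arbitrary: \<delta>)
  case (Cons i \<beta>)
  show ?case
  proof (cases "\<delta> \<noteq> [] \<and> last \<delta> = i")
    case True
    then have \<delta>: "\<delta> = butlast \<delta> @ [i]" by (metis append_butlast_last_id)
    have "\<nexists>\<gamma>. butlast \<delta> = \<gamma> @ rev \<beta>"
      using Cons.prems \<delta> by (metis append_assoc rev.simps(2))
    from Cons.IH[OF this] show ?thesis by (simp add: Lambda_word_def Lambda_def)
  qed (auto simp: Lambda_word_def Lambda_def)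
qed (simp add: Lambda_word_def)

text \<open>The reversal in the coefficient \<open>c (rev \<beta>)\<close> undoes the one in the
  action of the word, so the operator with formal coefficients \<open>c\<close> is right
  multiplication by the scalar series with the same coefficients.\<close>

lemma formal_Lambda_sum_eq:
  fixes b :: "'n list \<Rightarrow> real"
  assumes pos: "\<And>\<alpha>. b \<alpha> > 0"
  shows "formal_Lambda_sum b c p = weighted_conv b (\<lambda>\<alpha> h. c \<alpha> * h) p"
proof
  fix \<delta> :: "'n list"
  let ?S = "{(\<gamma>, \<alpha>). \<gamma> @ \<alpha> = \<delta>}"
  have "((\<lambda>\<beta>. c (rev \<beta>) * Lambda_word b \<beta> p \<delta>) has_sum weighted_conv b (\<lambda>\<alpha> h. c \<alpha> * h) p \<delta>) UNIV"
  proof (rule has_sum_finite_neutralI[of "(\<lambda>(\<gamma>, \<alpha>). rev \<alpha>) ` ?S"])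
    fix \<beta> assume \<beta>: "\<beta> \<in> UNIV - (\<lambda>(\<gamma>, \<alpha>). rev \<alpha>) ` ?S"
    have "\<nexists>\<gamma>. \<delta> = \<gamma> @ rev \<beta>"
    proof
      assume "\<exists>\<gamma>. \<delta> = \<gamma> @ rev \<beta>"
      then obtain \<gamma> where "\<gamma> @ rev \<beta> = \<delta>" by auto
      then have "rev (rev \<beta>) \<in> (\<lambda>(\<gamma>, \<alpha>). rev \<alpha>) ` ?S"
        by (intro image_eqI[of _ _ "(\<gamma>, rev \<beta>)"]) auto
      then show False using \<beta> by simp
    qed
    then show "c (rev \<beta>) * Lambda_word b \<beta> p \<delta> = 0" by (simp add: Lambda_word_eq_0)
  next
    have "inj_on (\<lambda>(\<gamma>, \<alpha>). rev \<alpha>) ?S" by (auto simp: inj_on_def)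
    then have "(\<Sum>\<beta>\<in>(\<lambda>(\<gamma>, \<alpha>). rev \<alpha>) ` ?S. c (rev \<beta>) * Lambda_word b \<beta> p \<delta>)
        = (\<Sum>(\<gamma>, \<alpha>)\<in>?S. c \<alpha> * Lambda_word b (rev \<alpha>) p \<delta>)"
      by (simp add: sum.reindex case_prod_unfold)
    also have "\<dots> = weighted_conv b (\<lambda>\<alpha> h. c \<alpha> * h) p \<delta>"
      unfolding weighted_conv_def
    proof (rule sum.cong[OF refl], clarify)
      fix \<gamma> \<alpha>
      show "c \<alpha> * Lambda_word b (rev \<alpha>) p (\<gamma> @ \<alpha>) = sqrt (b \<gamma> / b (\<gamma> @ \<alpha>)) *\<^sub>R (c \<alpha> * p \<gamma>)"
        using Lambda_word_append[of b "rev \<alpha>" p \<gamma>, OF pos] by (simp add: scaleR_conv_of_real)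
    qed
    finally show "weighted_conv b (\<lambda>\<alpha> h. c \<alpha> * h) p \<delta>
      = (\<Sum>\<beta>\<in>(\<lambda>(\<gamma>, \<alpha>). rev \<alpha>) ` ?S. c (rev \<beta>) * Lambda_word b \<beta> p \<delta>)" by simp
  qed (simp_all add: finite_factorizations)
  then show "formal_Lambda_sum b c p \<delta> = weighted_conv b (\<lambda>\<alpha> h. c \<alpha> * h) p \<delta>"
    unfolding formal_Lambda_sum_def by (rule infsumI)
qed

lemma bounded_clinear_mult_complex: "bounded_clinear (\<lambda>h::complex. c * h)"
  by (simp add: bounded_clinear_def scaleC_complex_def bounded_linear_mult_right mult.left_commute)

text \<open>A prefix of \<gamma> determines the remaining factor, so summing over prefixes is
  summing over factorizations. This matches the matrix expansion of an operator with the
  convolution.\<close>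

lemma sum_has_factorization:
  assumes "\<And>\<beta>. (\<nexists>\<alpha>. \<gamma> = \<beta> @ \<alpha>) \<Longrightarrow> f \<beta> = 0"
  shows "(f has_sum (\<Sum>(\<beta>, \<alpha>) | \<beta> @ \<alpha> = \<gamma>. f \<beta>)) UNIV"
proof (rule has_sum_finite_neutralI[of "fst ` {(\<beta>, \<alpha>). \<beta> @ \<alpha> = \<gamma>}"])
  show "finite (fst ` {(\<beta>, \<alpha>). \<beta> @ \<alpha> = \<gamma>})" by (intro finite_imageI finite_factorizations)
  show "f \<beta> = 0" if "\<beta> \<in> UNIV - fst ` {(\<beta>, \<alpha>). \<beta> @ \<alpha> = \<gamma>}" for \<beta>
    using that by (intro assms) force
  have "inj_on fst {(\<beta>, \<alpha>). \<beta> @ \<alpha> = \<gamma>}" by (auto simp: inj_on_def)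
  then show "(\<Sum>(\<beta>, \<alpha>) | \<beta> @ \<alpha> = \<gamma>. f \<beta>) = sum f (fst ` {(\<beta>, \<alpha>). \<beta> @ \<alpha> = \<gamma>})"
    by (simp add: sum.reindex case_prod_unfold)
qed simp

section \<open>Covariance of the Hardy algebra and recovery of the series\<close>

context
  fixes b :: "'n list \<Rightarrow> real"
  assumes pos: "\<And>\<alpha>. b \<alpha> > 0"
begin

text \<open>On basis vectors \<open>A\<close> is convolution with scalars, so the tensor operator
  has the coefficients \<open>c \<alpha>\<close> times \<open>B\<close>; comparing two entries that
  belong to the same \<alpha> eliminates both \<open>c\<close> and \<open>B\<close>.\<close>

lemma shift_covariant_tensor:
  assumes A: "A \<in> R_infty b" and B: "bounded_clinear B"
    and S: "is_tensor_op fock_weight fock_weight A B S"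
    and b1: "b [] = 1"
  shows "shift_covariant b S"
proof -
  obtain c where c: "\<And>p. p \<in> fock_polynomials \<Longrightarrow> A p = formal_Lambda_sum b c p"
    using A by (auto simp: R_infty_def)
  have e: "fock_e \<beta> \<in> fock_polynomials" for \<beta> :: "'n list"
    by (auto simp: fock_polynomials_def fock_e_def)
  have eF: "fock_e \<beta> \<in> Fock" for \<beta> :: "'n list"
    unfolding fock_e_eq_single by (rule single_F2[OF one_pos])
  have *: "S (single \<beta> h) \<gamma> = weighted_conv b (\<lambda>\<alpha> h. c \<alpha> * h) (single \<beta> 1) \<gamma> *\<^sub>C B h" for \<beta> h \<gamma>
  proof -
    have "S (tensor_vec (fock_e \<beta>) h) = tensor_vec (A (fock_e \<beta>)) (B h)"
      using S eF by (simp add: is_tensor_op_def)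
    then show ?thesis
      unfolding tensor_vec_fock_e c[OF e] formal_Lambda_sum_eq[OF pos] by (simp add: tensor_vec_def fock_e_eq_single)
  qed
  note conv = weighted_conv_single[where b = b and \<phi> = "\<lambda>\<alpha> h. c \<alpha> * h", OF bounded_clinear_mult_complex]
  have 0: "S (single \<beta> h) (\<beta> @ \<alpha>) = sqrt (b \<beta> / b (\<beta> @ \<alpha>)) *\<^sub>R (c \<alpha> *\<^sub>C B h)" for \<beta> \<alpha> h
    unfolding * conv by (simp add: scaleR_conv_of_real flip: scaleC_scaleC scaleC_of_real)
  have "S (single \<beta> h) (\<beta> @ \<alpha>) = sqrt (b \<beta> * b \<alpha> / b (\<beta> @ \<alpha>)) *\<^sub>R S (single [] h) \<alpha>" for \<beta> \<alpha> h
  proof -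
    \<comment> \<open>The entry in row \<beta>\<alpha> carries the weight
      \<open>sqrt (b \<beta> / b (\<beta> @ \<alpha>))\<close>, the entry in row \<alpha> of the
      first column \<open>sqrt (b [] / b \<alpha>)\<close>; as \<open>b [] = 1\<close>, their
      quotient is the covariance factor.\<close>
    have "sqrt (b \<beta> * b \<alpha> / b (\<beta> @ \<alpha>)) * sqrt (b [] / b \<alpha>) = sqrt (b \<beta> / b (\<beta> @ \<alpha>))"
      using pos[of \<alpha>] b1 by (simp flip: real_sqrt_mult)
    then show ?thesis using 0[of \<beta> h \<alpha>] 0[of "[]" h \<alpha>] by simp
  qed
  moreover have "S (single \<beta> h) \<gamma> = 0" if "\<nexists>\<alpha>. \<gamma> = \<beta> @ \<alpha>" for \<beta> \<gamma> h
    unfolding * conv(2)[OF that] by simp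
  ultimately show ?thesis by (simp add: shift_covariant_def)
qed

lemma shift_covariant_algebraic_tensor:
  assumes "T \<in> algebraic_tensor (R_infty b)" "b [] = 1"
  shows "shift_covariant b (T :: ('n list \<Rightarrow> 'k::chilbert) \<Rightarrow> _)"
proof -
  obtain r :: nat and S where T: "T = (\<lambda>x\<in>Fock. \<lambda>\<alpha>. \<Sum>l<r. S l x \<alpha>)"
    and S: "\<forall>l<r. \<exists>A\<in>R_infty b. \<exists>B. bounded_clinear B \<and> is_tensor_op fock_weight fock_weight A B (S l)"
    using assms(1) by (auto simp: algebraic_tensor_def)
  have cov: "shift_covariant b (S l)" if "l < r" for l
    using S that shift_covariant_tensor assms(2) by blast
  have s: "(single \<beta> h :: 'n list \<Rightarrow> 'k) \<in> Fock" for \<beta> h by (rule single_F2[OF one_pos])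
  show ?thesis
    using cov unfolding shift_covariant_def T
    by (auto simp: s scaleR_sum_right intro!: sum.cong sum.neutral)
qed

text \<open>
  Each covariance relation involves only two matrix entries, so the approximation hypothesis, common to
  the weak and the norm closure, asks for just two at a time.
\<close>

lemma shift_covariant_weak_limit:
  fixes T :: "('n list \<Rightarrow> 'k::chilbert) \<Rightarrow> 'n list \<Rightarrow> 'k"
  assumes approx: "\<And>x x' \<gamma> \<gamma>' k \<epsilon>. x \<in> Fock \<Longrightarrow> x' \<in> Fock \<Longrightarrow> \<epsilon> > 0 \<Longrightarrow>
      \<exists>S\<in>\<S>. cmod (cinner (T x \<gamma> - S x \<gamma>) k) < \<epsilon> \<and> cmod (cinner (T x' \<gamma>' - S x' \<gamma>') k) < \<epsilon>"
    and cov: "\<And>S. S \<in> \<S> \<Longrightarrow> shift_covariant b S"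
  shows "shift_covariant b T"
proof -
  have s: "(single \<beta> h :: 'n list \<Rightarrow> 'k) \<in> Fock" for \<beta> h by (rule single_F2[OF one_pos])
  \<comment> \<open>Both kinds of relation say that one entry is a real multiple of another. The
    defect \<open>u\<close> is tested against itself, which turns weak closeness of entries into a
    bound on its norm.\<close>
  have key: "T x \<gamma> = r *\<^sub>R T x' \<gamma>'"
    if rel: "\<And>S. S \<in> \<S> \<Longrightarrow> S x \<gamma> = r *\<^sub>R S x' \<gamma>'" and x: "x \<in> Fock" "x' \<in> Fock" for x x' \<gamma> \<gamma>' r
  proof -
    define u where "u = T x \<gamma> - r *\<^sub>R T x' \<gamma>'"
    have "(norm u)\<^sup>2 \<le> 0"
    proof (rule field_le_epsilon)
      fix e :: real assume e: "e > 0"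
      \<comment> \<open>The second error gets multiplied by |r|; with this share the two errors add
        up to \<open>e\<close>.\<close>
      have d: "e / (1 + \<bar>r\<bar>) > 0" using e by (simp add: add_pos_nonneg)
      obtain S where S: "S \<in> \<S>" "cmod (cinner (T x \<gamma> - S x \<gamma>) u) < e / (1 + \<bar>r\<bar>)"
        "cmod (cinner (T x' \<gamma>' - S x' \<gamma>') u) < e / (1 + \<bar>r\<bar>)"
        using approx[OF x d] by blast
      have "u = (T x \<gamma> - S x \<gamma>) - r *\<^sub>R (T x' \<gamma>' - S x' \<gamma>')"
        using rel[OF S(1)] by (simp add: u_def algebra_simps)
      then have "cinner u u = cinner (T x \<gamma> - S x \<gamma>) u - complex_of_real r * cinner (T x' \<gamma>' - S x' \<gamma>') u"
        by (metis cinner_diff_left cinner_scaleR_left)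
      then have "cmod (cinner u u) \<le> cmod (cinner (T x \<gamma> - S x \<gamma>) u) + \<bar>r\<bar> * cmod (cinner (T x' \<gamma>' - S x' \<gamma>') u)"
        by (metis norm_triangle_ineq4 norm_mult norm_of_real)
      also have "\<dots> \<le> e / (1 + \<bar>r\<bar>) + \<bar>r\<bar> * (e / (1 + \<bar>r\<bar>))"
        using S by (intro add_mono mult_left_mono) auto
      also have "\<dots> = (1 + \<bar>r\<bar>) * (e / (1 + \<bar>r\<bar>))" by (simp only: distrib_right mult_1)
      also have "\<dots> = e" by (simp add: add_pos_nonneg less_imp_neq[THEN not_sym])
      finally show "(norm u)\<^sup>2 \<le> 0 + e" by (simp add: cinner_self del: of_real_power)
    qed
    then show ?thesis by (simp add: u_def)
  qed
  have "T (single \<beta> h) (\<beta> @ \<alpha>) = sqrt (b \<beta> * b \<alpha> / b (\<beta> @ \<alpha>)) *\<^sub>R T (single [] h) \<alpha>" for \<beta> \<alpha> h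
    by (rule key[OF _ s s]) (use cov in \<open>simp add: shift_covariant_def\<close>)
  \<comment> \<open>Vanishing of an entry is the relation with factor 0.\<close>
  moreover have "T (single \<beta> h) \<gamma> = 0" if "\<nexists>\<alpha>. \<gamma> = \<beta> @ \<alpha>" for \<beta> \<gamma> h
    using key[OF _ s s, of \<beta> h \<gamma> 0 \<beta> h \<gamma>] cov that by (simp add: shift_covariant_def)
  ultimately show ?thesis by (simp add: shift_covariant_def)
qed

lemma shift_covariant_wot_closure:
  fixes T :: "('n list \<Rightarrow> 'k::chilbert) \<Rightarrow> 'n list \<Rightarrow> 'k"
  assumes T: "T \<in> wot_closure \<S>" and cov: "\<And>S. S \<in> \<S> \<Longrightarrow> shift_covariant b S"
  shows "shift_covariant b T"
proof (rule shift_covariant_weak_limit[OF _ cov])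
  fix x x' :: "'n list \<Rightarrow> 'k" and \<gamma> \<gamma>' :: "'n list" and k :: 'k and \<epsilon> :: real
  assume x: "x \<in> Fock" "x' \<in> Fock" and \<epsilon>: "\<epsilon> > 0"
  \<comment> \<open>Pairing with \<open>single \<gamma> k\<close> isolates the coordinate \<gamma>,
    so two test pairs control both entries of a relation by one operator \<open>S\<close>.\<close>
  let ?P = "{(x, single \<gamma> k), (x', single \<gamma>' k)}"
  have "finite ?P \<and> ?P \<subseteq> Fock \<times> Fock"
    using x by (auto intro: single_F2[OF one_pos])
  then obtain S where "S \<in> \<S>" "\<forall>(x, y)\<in>?P. cmod (F2_inner fock_weight (\<lambda>\<alpha>. T x \<alpha> - S x \<alpha>) y) < \<epsilon>"
    using T[unfolded wot_closure_def, THEN CollectD, THEN conjunct2, rule_format, of ?P \<epsilon>] \<epsilon> by auto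
  then show "\<exists>S\<in>\<S>. cmod (cinner (T x \<gamma> - S x \<gamma>) k) < \<epsilon> \<and> cmod (cinner (T x' \<gamma>' - S x' \<gamma>') k) < \<epsilon>"
    by (auto simp: F2_inner_single_right)
qed

text \<open>Closeness in operator norm controls each entry through Cauchy-Schwarz. The approximants
  must map into \<open>Fock\<close> so that the norm of the difference bounds its
  coordinates.\<close>

lemma shift_covariant_op_norm_closure:
  fixes T :: "('n list \<Rightarrow> 'k::chilbert) \<Rightarrow> 'n list \<Rightarrow> 'k"
  assumes T: "T \<in> op_norm_closure \<S>" and cov: "\<And>S. S \<in> \<S> \<Longrightarrow> shift_covariant b S"
    and Fock: "\<And>S x. S \<in> \<S> \<Longrightarrow> x \<in> Fock \<Longrightarrow> S x \<in> Fock"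
  shows "shift_covariant b T"
proof (rule shift_covariant_weak_limit[OF _ cov])
  fix x x' :: "'n list \<Rightarrow> 'k" and \<gamma> \<gamma>' :: "'n list" and k :: 'k and \<epsilon> :: real
  assume x: "x \<in> Fock" "x' \<in> Fock" and \<epsilon>: "\<epsilon> > 0"
  \<comment> \<open>The summands 1 make \<open>N\<close> positive and strictly larger than both
    products needed, even for zero vectors.\<close>
  define N where "N = (F2_norm fock_weight x + F2_norm fock_weight x' + 1) * (norm k + 1)"
  have nn: "F2_norm fock_weight y \<ge> 0" for y :: "'n list \<Rightarrow> 'k" by (rule F2_norm_nonneg[OF one_pos])
  have N: "N > 0" using nn[of x] nn[of x'] by (auto simp: N_def intro!: mult_pos_pos add_nonneg_pos)
  have NN: "F2_norm fock_weight x * norm k < N" "F2_norm fock_weight x' * norm k < N"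
    unfolding N_def using nn[of x] nn[of x'] by (auto intro!: mult_strict_mono)
  have "\<epsilon> / N > 0" using \<epsilon> N by simp
  then obtain S where S: "S \<in> \<S>" and
    close: "\<And>y. y \<in> Fock \<Longrightarrow> F2_norm fock_weight (\<lambda>\<alpha>. T y \<alpha> - S y \<alpha>) \<le> (\<epsilon> / N) * F2_norm fock_weight y"
    using T[unfolded op_norm_closure_def, THEN CollectD, THEN conjunct2, rule_format, of "\<epsilon> / N"] by auto
  have *: "cmod (cinner (T y \<delta> - S y \<delta>) k) < \<epsilon>" if y: "y \<in> Fock" and yN: "F2_norm fock_weight y * norm k < N" for y \<delta>
  proof -
    have "T y \<in> Fock" using T y by (auto simp: op_norm_closure_def bop_def)
    then have TS: "(\<lambda>\<alpha>. T y \<alpha> - S y \<alpha>) \<in> Fock" using Fock[OF S y] by (rule F2_diff(1)[OF one_pos])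
    have "cmod (cinner (T y \<delta> - S y \<delta>) k) \<le> norm (T y \<delta> - S y \<delta>) * norm k"
      by (rule cinner_Cauchy_Schwarz)
    also have "\<dots> \<le> ((\<epsilon> / N) * F2_norm fock_weight y) * norm k"
      using order_trans[OF F2_coord_le[OF one_pos TS, of \<delta>]] close[OF y] by (intro mult_right_mono) auto
    also have "\<dots> = (\<epsilon> / N) * (F2_norm fock_weight y * norm k)" by simp
    also have "\<dots> < (\<epsilon> / N) * N" using yN \<epsilon> N by (intro mult_strict_left_mono) auto
    finally show ?thesis using N by simp
  qed
  show "\<exists>S\<in>\<S>. cmod (cinner (T x \<gamma> - S x \<gamma>) k) < \<epsilon> \<and> cmod (cinner (T x' \<gamma>' - S x' \<gamma>') k) < \<epsilon>"
    using S *[OF x(1) NN(1)] *[OF x(2) NN(2)] by blast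
qed

lemma algebraic_tensor_Fock:
  assumes "T \<in> algebraic_tensor \<A>" "x \<in> Fock"
  shows "T x \<in> (Fock :: ('n list \<Rightarrow> 'k::chilbert) set)"
proof -
  obtain r :: nat and S where T: "T = (\<lambda>x\<in>Fock. \<lambda>\<alpha>. \<Sum>l<r. S l x \<alpha>)"
    and S: "\<forall>l<r. \<exists>A\<in>\<A>. \<exists>B. bounded_clinear B \<and> is_tensor_op fock_weight fock_weight A B (S l)"
    using assms(1) by (auto simp: algebraic_tensor_def)
  have "S l x \<in> Fock" if "l < r" for l
    using S that assms(2) by (auto simp: is_tensor_op_def bop_def)
  then show ?thesis using assms(2) T F2_sum[OF one_pos, of "{..<r}" "\<lambda>l. S l x"] by simp
qed

text \<open>The column at the empty word defines the coefficients, covariance recovers all other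
  columns, and the columns determine a bounded operator.\<close>

lemma shift_covariant_imp_Psi:
  fixes T :: "('n list \<Rightarrow> 'k::chilbert) \<Rightarrow> 'n list \<Rightarrow> 'k"
  assumes T: "T \<in> bop fock_weight fock_weight" and cov: "shift_covariant b T"
  shows "T \<in> Psi b ` right_multipliers b"
proof -
  \<comment> \<open>The factor \<open>sqrt (b \<alpha>)\<close> turns the convolution weight
    \<open>sqrt (b \<beta> / b (\<beta> @ \<alpha>))\<close> into the covariance factor.\<close>
  define \<phi> where "\<phi> = (\<lambda>\<alpha> h. sqrt (b \<alpha>) *\<^sub>R T (single [] h) \<alpha>)"
  have s: "(single \<beta> h :: 'n list \<Rightarrow> 'k) \<in> Fock" for \<beta> h by (rule single_F2[OF one_pos])
  obtain C where C: "C \<ge> 0" "\<And>x. x \<in> Fock \<Longrightarrow> F2_norm fock_weight (T x) \<le> C * F2_norm fock_weight x"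
    using bop_bound[OF one_pos one_pos T] by blast
  have bc: "bounded_clinear (\<phi> \<alpha>)" for \<alpha>
  proof -
    have add: "T (single [] (h + k)) \<alpha> = T (single [] h) \<alpha> + T (single [] k) \<alpha>" for h k
    proof -
      have "single [] (h + k) = (\<lambda>\<alpha>. (single [] h :: 'n list \<Rightarrow> 'k) \<alpha> + single [] k \<alpha>)" by (auto simp: single_def)
      then show ?thesis using bop_add[OF one_pos one_pos T s s, of "[]" h "[]" k] by simp
    qed
    have scale: "T (single [] (a *\<^sub>C h)) \<alpha> = a *\<^sub>C T (single [] h) \<alpha>" for a h
    proof -
      have "single [] (a *\<^sub>C h) = (\<lambda>\<alpha>. a *\<^sub>C (single [] h :: 'n list \<Rightarrow> 'k) \<alpha>)" by (auto simp: single_def)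
      then show ?thesis using bop_scaleC[OF one_pos one_pos T s, of a "[]" h] by simp
    qed
    have "norm (T (single [] h) \<alpha>) \<le> norm h * C" for h
    proof -
      have "norm (T (single [] h) \<alpha>) \<le> F2_norm fock_weight (T (single [] h))"
        using F2_coord_le[OF one_pos bop_closed[OF one_pos one_pos T s]] by simp
      also have "\<dots> \<le> C * norm h" using C(2)[OF s, of "[]" h] by (simp add: F2_norm_single[OF one_pos])
      finally show ?thesis by (simp add: mult.commute)
    qed
    moreover have "T (single [] (r *\<^sub>R h)) \<alpha> = r *\<^sub>R T (single [] h) \<alpha>" for r h
      using scale[of "complex_of_real r" h] by (simp add: scaleC_of_real)
    ultimately have "bounded_linear (\<lambda>h. T (single [] h) \<alpha>)"
      by (intro bounded_linear_intro[of _ C]) (simp_all add: add)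
    then have "bounded_clinear (\<lambda>h. T (single [] h) \<alpha>)" by (simp add: bounded_clinear_def scale)
    then show ?thesis unfolding \<phi>_def by (rule bounded_clinear_scaleR_fun)
  qed
  have conv: "weighted_conv b \<phi> x = T x" if x: "x \<in> Fock" for x
  proof
    fix \<gamma>
    have "weighted_conv b \<phi> x \<gamma> = (\<Sum>(\<beta>, \<alpha>) | \<beta> @ \<alpha> = \<gamma>. T (single \<beta> (x \<beta>)) \<gamma>)"
      unfolding weighted_conv_def
    proof (rule sum.cong[OF refl], clarify)
      fix \<beta> \<alpha>
      have "sqrt (b \<beta> / b (\<beta> @ \<alpha>)) * sqrt (b \<alpha>) = sqrt (b \<beta> * b \<alpha> / b (\<beta> @ \<alpha>))"
        by (simp flip: real_sqrt_mult)
      then show "sqrt (b \<beta> / b (\<beta> @ \<alpha>)) *\<^sub>R \<phi> \<alpha> (x \<beta>) = T (single \<beta> (x \<beta>)) (\<beta> @ \<alpha>)"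
        using cov unfolding \<phi>_def shift_covariant_def by simp
    qed
    moreover have "((\<lambda>\<beta>. T (single \<beta> (x \<beta>)) \<gamma>) has_sum (\<Sum>(\<beta>, \<alpha>) | \<beta> @ \<alpha> = \<gamma>. T (single \<beta> (x \<beta>)) \<gamma>)) UNIV"
      by (rule sum_has_factorization) (use cov in \<open>simp add: shift_covariant_def\<close>)
    ultimately show "weighted_conv b \<phi> x \<gamma> = T x \<gamma>"
      using has_sum_unique[OF _ bop_expansion[OF one_pos one_pos T x]] by metis
  qed
  have \<phi>: "\<phi> \<in> right_multipliers b"
    using bc conv bop_closed[OF one_pos one_pos T] by (simp add: right_multiplier_iff[OF pos])
  have "T \<in> extensional Fock" using T by (simp add: bop_def PiE_def)
  then have "T = Psi b \<phi>"
    unfolding Psi_eq[OF pos \<phi>] by (auto intro!: extensionalityI[of _ Fock] simp: conv)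
  then show ?thesis using \<phi> by blast
qed

lemma hardy_algebra_subset_Psi:
  assumes "b [] = 1"
  shows "wot_closure (op_norm_closure (algebraic_tensor (R_infty b)))
    \<subseteq> Psi b ` (right_multipliers b :: ('n list \<Rightarrow> 'k::chilbert \<Rightarrow> 'k) set)"
proof
  fix T :: "('n list \<Rightarrow> 'k) \<Rightarrow> 'n list \<Rightarrow> 'k"
  assume T: "T \<in> wot_closure (op_norm_closure (algebraic_tensor (R_infty b)))"
  have "shift_covariant b T"
    using T
    by (rule shift_covariant_wot_closure)
      (erule shift_covariant_op_norm_closure,
        use assms in \<open>auto intro: shift_covariant_algebraic_tensor algebraic_tensor_Fock\<close>)
  moreover have "T \<in> bop fock_weight fock_weight" using T by (simp add: wot_closure_def)
  ultimately show "T \<in> Psi b ` right_multipliers b" by (intro shift_covariant_imp_Psi)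
qed

end

subsection \<open>Fejer means\<close>

lemma F2_inner_Cauchy_Schwarz:
  fixes x y :: "'n list \<Rightarrow> 'k::chilbert"
  assumes x: "x \<in> Fock" and y: "y \<in> Fock"
  shows "(\<lambda>\<alpha>. cmod (cinner (x \<alpha>) (y \<alpha>))) summable_on UNIV"
    and "cmod (F2_inner fock_weight x y) \<le> F2_norm fock_weight x * F2_norm fock_weight y"
proof -
  have *: "(\<Sum>\<alpha>\<in>F. cmod (cinner (x \<alpha>) (y \<alpha>))) \<le> F2_norm fock_weight x * F2_norm fock_weight y" for F
  proof -
    have "(\<Sum>\<alpha>\<in>F. cmod (cinner (x \<alpha>) (y \<alpha>))) \<le> (\<Sum>\<alpha>\<in>F. \<bar>norm (x \<alpha>)\<bar> * \<bar>norm (y \<alpha>)\<bar>)"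
      by (rule sum_mono) (simp add: cinner_Cauchy_Schwarz)
    also have "\<dots> \<le> L2_set (\<lambda>\<alpha>. norm (x \<alpha>)) F * L2_set (\<lambda>\<alpha>. norm (y \<alpha>)) F"
      by (rule L2_set_mult_ineq)
    also have "\<dots> \<le> F2_norm fock_weight x * F2_norm fock_weight y"
      using F2_L2_set_le[OF one_pos x, of F] F2_L2_set_le[OF one_pos y, of F] F2_norm_nonneg[OF one_pos, of x]
      by (intro mult_mono) simp_all
    finally show ?thesis .
  qed
  show abs: "(\<lambda>\<alpha>. cmod (cinner (x \<alpha>) (y \<alpha>))) summable_on UNIV"
    by (rule nonneg_bdd_above_summable_on) (auto intro!: bdd_aboveI2 *)
  have "cmod (F2_inner fock_weight x y) \<le> (\<Sum>\<^sub>\<infinity>\<alpha>. cmod (cinner (x \<alpha>) (y \<alpha>)))"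
    unfolding F2_inner_def using norm_infsum_bound[OF abs] by simp
  also have "\<dots> \<le> F2_norm fock_weight x * F2_norm fock_weight y"
    by (rule infsum_le_finite_sums[OF abs *])
  finally show "cmod (F2_inner fock_weight x y) \<le> F2_norm fock_weight x * F2_norm fock_weight y" .
qed

text \<open>The vector \<open>y\<close> is split into finitely many coordinates, where
  \<open>u n\<close> tends to 0, and a tail of small norm, against which the bound \<open>C\<close>
  suffices. This is where a uniform bound on approximants pays off.\<close>

lemma F2_inner_tendsto_0:
  fixes u :: "nat \<Rightarrow> 'n list \<Rightarrow> 'k::chilbert"
  assumes u: "\<And>n. u n \<in> Fock" "\<And>n. F2_norm fock_weight (u n) \<le> C"
    and lim: "\<And>\<alpha>. (\<lambda>n. u n \<alpha>) \<longlonglongrightarrow> 0" and y: "y \<in> Fock"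
  shows "(\<lambda>n. F2_inner fock_weight (u n) y) \<longlonglongrightarrow> 0"
proof (rule tendstoI)
  fix e :: real assume e: "e > 0"
  have C: "C \<ge> 0" using F2_norm_nonneg[OF one_pos, of "u 0"] u(2)[of 0] by linarith
  \<comment> \<open>With \<open>C + 1\<close> the denominator is positive even if
    \<open>C = 0\<close>; the tail then contributes at most e/2.\<close>
  have d: "e / (2 * (C + 1)) > 0" using e C by simp
  obtain F where F: "finite F" "\<And>G. F \<subseteq> G \<Longrightarrow> F2_norm fock_weight (\<lambda>\<alpha>. if \<alpha> \<in> G then 0 else y \<alpha>) < e / (2 * (C + 1))"
    using F2_truncation[OF one_pos y d] by blast
  define z where "z = (\<lambda>\<alpha>. if \<alpha> \<in> F then 0 else y \<alpha>)"
  have z: "z \<in> Fock" unfolding z_def by (rule F2_mono(1)[OF one_pos y]) simp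
  have zn: "F2_norm fock_weight z < e / (2 * (C + 1))" unfolding z_def by (rule F(2)) simp
  have split: "F2_inner fock_weight (u n) y = (\<Sum>\<alpha>\<in>F. cinner (u n \<alpha>) (y \<alpha>)) + F2_inner fock_weight (u n) z" for n
  proof -
    have "((\<lambda>\<alpha>. if \<alpha> \<in> F then cinner (u n \<alpha>) (y \<alpha>) else 0) has_sum (\<Sum>\<alpha>\<in>F. cinner (u n \<alpha>) (y \<alpha>))) UNIV"
      by (rule has_sum_finite_neutralI[OF F(1)]) auto
    moreover have "((\<lambda>\<alpha>. cinner (u n \<alpha>) (z \<alpha>)) has_sum F2_inner fock_weight (u n) z) UNIV"
      unfolding F2_inner_def
      using abs_summable_summable[OF F2_inner_Cauchy_Schwarz(1)[OF u(1) z], THEN has_sum_infsum] by simp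
    ultimately have "((\<lambda>\<alpha>. (if \<alpha> \<in> F then cinner (u n \<alpha>) (y \<alpha>) else 0) + cinner (u n \<alpha>) (z \<alpha>)) has_sum
        ((\<Sum>\<alpha>\<in>F. cinner (u n \<alpha>) (y \<alpha>)) + F2_inner fock_weight (u n) z)) UNIV"
      by (rule has_sum_add)
    also have "(\<lambda>\<alpha>. (if \<alpha> \<in> F then cinner (u n \<alpha>) (y \<alpha>) else 0) + cinner (u n \<alpha>) (z \<alpha>))
        = (\<lambda>\<alpha>. cinner (u n \<alpha>) (y \<alpha>) / complex_of_real 1)"
      by (auto simp: z_def)
    finally show ?thesis unfolding F2_inner_def by (simp add: infsumI)
  qed
  have "(\<lambda>n. cinner (u n \<alpha>) (y \<alpha>)) \<longlonglongrightarrow> 0" for \<alpha>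
  proof (rule Lim_null_comparison)
    show "\<forall>\<^sub>F n in sequentially. norm (cinner (u n \<alpha>) (y \<alpha>)) \<le> norm (u n \<alpha>) * norm (y \<alpha>)"
      by (simp add: cinner_Cauchy_Schwarz)
    show "(\<lambda>n. norm (u n \<alpha>) * norm (y \<alpha>)) \<longlonglongrightarrow> 0"
      by (rule tendsto_mult_left_zero, rule tendsto_norm_zero, rule lim)
  qed
  then have "(\<lambda>n. \<Sum>\<alpha>\<in>F. cinner (u n \<alpha>) (y \<alpha>)) \<longlonglongrightarrow> 0" by (rule tendsto_null_sum)
  then have "\<forall>\<^sub>F n in sequentially. dist (\<Sum>\<alpha>\<in>F. cinner (u n \<alpha>) (y \<alpha>)) 0 < e / 2"
    using e by (intro tendstoD) simp_all
  then show "\<forall>\<^sub>F n in sequentially. dist (F2_inner fock_weight (u n) y) 0 < e"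
  proof eventually_elim
    case (elim n)
    have "cmod (F2_inner fock_weight (u n) z) \<le> F2_norm fock_weight (u n) * F2_norm fock_weight z"
      by (rule F2_inner_Cauchy_Schwarz(2)[OF u(1) z])
    also have "\<dots> \<le> (C + 1) * (e / (2 * (C + 1)))"
      using u(2)[of n] zn C F2_norm_nonneg[OF one_pos, of z] by (intro mult_mono) auto
    also have "\<dots> = e / 2"
    proof -
      have "D * (e / (2 * D)) = e / 2" if "D \<noteq> 0" for D using that by simp
      then show ?thesis by this (use C in simp)
    qed
    finally have "cmod (F2_inner fock_weight (u n) z) \<le> e / 2" .
    then show ?case
      using elim norm_triangle_ineq[of "\<Sum>\<alpha>\<in>F. cinner (u n \<alpha>) (y \<alpha>)" "F2_inner fock_weight (u n) z"]
      unfolding split by simp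
  qed
qed

section \<open>Monomials, Fejer weights and windows\<close>

definition monomial_series :: "'n list \<Rightarrow> ('k \<Rightarrow> 'k) \<Rightarrow> 'n list \<Rightarrow> 'k \<Rightarrow> 'k::chilbert" where
  "monomial_series \<alpha> B = (\<lambda>\<alpha>' h. if \<alpha>' = \<alpha> then B h else 0)"

lemma bounded_clinear_monomial: "bounded_clinear B \<Longrightarrow> bounded_clinear (monomial_series \<alpha> B \<alpha>')"
  by (cases "\<alpha>' = \<alpha>") (simp_all add: monomial_series_def bounded_clinear_const_zero)

lemma weighted_conv_monomial:
  "weighted_conv b (monomial_series \<alpha> B) x (\<beta> @ \<alpha>) = sqrt (b \<beta> / b (\<beta> @ \<alpha>)) *\<^sub>R B (x \<beta>)"
  "(\<nexists>\<beta>. \<gamma> = \<beta> @ \<alpha>) \<Longrightarrow> weighted_conv b (monomial_series \<alpha> B) x \<gamma> = 0"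
proof -
  have "weighted_conv b (monomial_series \<alpha> B) x (\<beta> @ \<alpha>)
      = (\<Sum>(\<beta>', \<alpha>') \<in> {(\<beta>, \<alpha>)}. sqrt (b \<beta>' / b (\<beta> @ \<alpha>)) *\<^sub>R monomial_series \<alpha> B \<alpha>' (x \<beta>'))"
    unfolding weighted_conv_def
    by (rule sum.mono_neutral_right[OF finite_factorizations])
      (auto simp: monomial_series_def split: if_split_asm)
  then show "weighted_conv b (monomial_series \<alpha> B) x (\<beta> @ \<alpha>) = sqrt (b \<beta> / b (\<beta> @ \<alpha>)) *\<^sub>R B (x \<beta>)"
    by (simp add: monomial_series_def)
  show "(\<nexists>\<beta>. \<gamma> = \<beta> @ \<alpha>) \<Longrightarrow> weighted_conv b (monomial_series \<alpha> B) x \<gamma> = 0"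
    unfolding weighted_conv_def by (rule sum.neutral) (auto simp: monomial_series_def)
qed

text \<open>Natural subtraction stops at 0, so for positive N this is the Fejer coefficient max(0, 1
  - |\<alpha>|/N), which vanishes on words of length at least N.\<close>

definition fejer_weight :: "nat \<Rightarrow> 'n list \<Rightarrow> real" where
  "fejer_weight N \<alpha> = real (N - length \<alpha>) / real N"

lemma fejer_weight_tendsto: "(\<lambda>N. fejer_weight N \<alpha>) \<longlonglongrightarrow> 1"
proof -
  have "(\<lambda>N. 1 - real (length \<alpha>) / real N) \<longlonglongrightarrow> 1 - 0"
    by (intro tendsto_intros lim_const_over_n)
  moreover have "\<forall>\<^sub>F N in sequentially. fejer_weight N \<alpha> = 1 - real (length \<alpha>) / real N"
    using eventually_ge_at_top[of "Suc (length \<alpha>)"]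
    by (rule eventually_mono) (auto simp: fejer_weight_def of_nat_diff field_simps)
  ultimately show ?thesis by (simp add: tendsto_cong)
qed

text \<open>
  The Fejer weight counts the windows \<open>[m - N + 1, m]\<close> containing the lengths of both row and column
  index. Hence the Fejer mean is an average of compressions, which bounds it by the original operator.
\<close>

definition window :: "nat \<Rightarrow> nat \<Rightarrow> ('n list \<Rightarrow> 'k::chilbert) \<Rightarrow> 'n list \<Rightarrow> 'k" where
  "window N m x = (\<lambda>\<beta>. if length \<beta> \<le> m \<and> m < length \<beta> + N then x \<beta> else 0)"

text \<open>The range of m selects the windows containing the row \<gamma>, while
  \<open>window\<close> cuts the input to the same window. For \<gamma> = \<beta>\<alpha>, row and
  column \<beta> share N - |\<alpha>| windows, or none if this is negative.\<close>

lemma fejer_eq_window_sum: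
  assumes bc: "\<And>\<alpha>. bounded_clinear (\<phi> \<alpha>)" and N: "N > 0"
  shows "weighted_conv b (\<lambda>\<alpha> h. fejer_weight N \<alpha> *\<^sub>R \<phi> \<alpha> h) x \<gamma>
    = (1 / real N) *\<^sub>R (\<Sum>m\<in>{length \<gamma>..<length \<gamma> + N}. weighted_conv b \<phi> (window N m x) \<gamma>)"
proof -
  let ?S = "{(\<beta>, \<alpha>). \<beta> @ \<alpha> = \<gamma>}"
  have "(\<Sum>m\<in>{length \<gamma>..<length \<gamma> + N}. weighted_conv b \<phi> (window N m x) \<gamma>)
      = (\<Sum>p\<in>?S. \<Sum>m\<in>{length \<gamma>..<length \<gamma> + N}. sqrt (b (fst p) / b \<gamma>) *\<^sub>R \<phi> (snd p) (window N m x (fst p)))"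
    unfolding weighted_conv_def case_prod_unfold by (rule sum.swap)
  also have "\<dots> = (\<Sum>p\<in>?S. real (N - length (snd p)) *\<^sub>R sqrt (b (fst p) / b \<gamma>) *\<^sub>R \<phi> (snd p) (x (fst p)))"
  proof (rule sum.cong[OF refl])
    fix p assume "p \<in> ?S"
    then have len: "length \<gamma> = length (fst p) + length (snd p)" by auto
    let ?v = "sqrt (b (fst p) / b \<gamma>) *\<^sub>R \<phi> (snd p) (x (fst p))"
    have "(\<Sum>m\<in>{length \<gamma>..<length \<gamma> + N}. sqrt (b (fst p) / b \<gamma>) *\<^sub>R \<phi> (snd p) (window N m x (fst p)))
        = (\<Sum>m\<in>{length \<gamma>..<length (fst p) + N}. ?v)"
      by (rule sum.mono_neutral_cong_right)
        (use len in \<open>auto simp: window_def bounded_clinear_zero[OF bc]\<close>)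
    also have "\<dots> = real (N - length (snd p)) *\<^sub>R ?v"
      unfolding sum_constant_scaleR using len by simp
    finally show "(\<Sum>m\<in>{length \<gamma>..<length \<gamma> + N}. sqrt (b (fst p) / b \<gamma>) *\<^sub>R \<phi> (snd p) (window N m x (fst p)))
        = real (N - length (snd p)) *\<^sub>R ?v" .
  qed
  finally show ?thesis
    by (simp add: weighted_conv_def fejer_weight_def case_prod_unfold scaleR_sum_right mult.commute)
qed

lemma finite_words_length_le: "finite {\<beta> :: 'n::finite list. length \<beta> \<le> M}"
  using finite_lists_length_le[of "UNIV :: 'n set" M] by simp

lemma window_Fock: "x \<in> Fock \<Longrightarrow> window N m x \<in> Fock"
  by (rule F2_mono(1)[OF one_pos, of x]) (auto simp: window_def)

text \<open>Every word length lies in exactly N windows, so each coordinate is counted at most N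
  times.\<close>

lemma sum_window_norm_le:
  fixes x :: "'n::finite list \<Rightarrow> 'k::chilbert"
  assumes x: "x \<in> Fock"
  shows "(\<Sum>m<M. (F2_norm fock_weight (window N m x))\<^sup>2) \<le> real N * (F2_norm fock_weight x)\<^sup>2"
proof -
  let ?W = "{\<beta> :: 'n list. length \<beta> \<le> M}"
  have "(\<Sum>m<M. (F2_norm fock_weight (window N m x))\<^sup>2) = (\<Sum>m<M. \<Sum>\<beta>\<in>?W. (norm (window N m x \<beta>))\<^sup>2)"
  proof (rule sum.cong[OF refl])
    fix m assume "m \<in> {..<M}"
    then show "(F2_norm fock_weight (window N m x))\<^sup>2 = (\<Sum>\<beta>\<in>?W. (norm (window N m x \<beta>))\<^sup>2)"
      using F2_finite_support(2)[OF one_pos finite_words_length_le[of M], of "window N m x"]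
      by (simp add: window_def)
  qed
  also have "\<dots> = (\<Sum>\<beta>\<in>?W. \<Sum>m<M. (norm (window N m x \<beta>))\<^sup>2)" by (rule sum.swap)
  also have "\<dots> \<le> (\<Sum>\<beta>\<in>?W. real N * (norm (x \<beta>))\<^sup>2)"
  proof (rule sum_mono)
    fix \<beta> :: "'n list"
    have "(\<Sum>m<M. (norm (window N m x \<beta>))\<^sup>2) = (\<Sum>m\<in>{..<M} \<inter> {length \<beta>..<length \<beta> + N}. (norm (x \<beta>))\<^sup>2)"
      by (rule sum.mono_neutral_cong_right) (auto simp: window_def)
    also have "\<dots> \<le> (\<Sum>m\<in>{length \<beta>..<length \<beta> + N}. (norm (x \<beta>))\<^sup>2)"
      by (rule sum_mono2) auto
    also have "\<dots> = real N * (norm (x \<beta>))\<^sup>2" by simp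
    finally show "(\<Sum>m<M. (norm (window N m x \<beta>))\<^sup>2) \<le> real N * (norm (x \<beta>))\<^sup>2" .
  qed
  also have "\<dots> = real N * (\<Sum>\<beta>\<in>?W. (norm (x \<beta>))\<^sup>2)" by (simp add: sum_distrib_left)
  also have "\<dots> \<le> real N * (F2_norm fock_weight x)\<^sup>2"
    using F2_sum_le[OF one_pos x finite_words_length_le[of M]] by (intro mult_left_mono) simp_all
  finally show ?thesis .
qed

text \<open>Cauchy-Schwarz over the N windows at a row costs a factor N, and summing the windowed
  parts of \<open>x\<close> costs another; both are absorbed by the square of the averaging factor
  1/N. The constant is therefore \<open>C\<close> itself, for every N.\<close>

lemma fejer_bound:
  fixes x :: "'n::finite list \<Rightarrow> 'k::chilbert"
  assumes bc: "\<And>\<alpha>. bounded_clinear (\<phi> \<alpha>)" and N: "N > 0"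
    and cl: "\<And>x. x \<in> Fock \<Longrightarrow> weighted_conv b \<phi> x \<in> Fock"
    and C: "C \<ge> 0" "\<And>x. x \<in> Fock \<Longrightarrow> F2_norm fock_weight (weighted_conv b \<phi> x) \<le> C * F2_norm fock_weight x"
    and x: "x \<in> Fock"
  defines "y \<equiv> weighted_conv b (\<lambda>\<alpha> h. fejer_weight N \<alpha> *\<^sub>R \<phi> \<alpha> h) x"
  shows "y \<in> Fock" "F2_norm fock_weight y \<le> C * F2_norm fock_weight x"
proof -
  have *: "(\<Sum>\<gamma>\<in>F. (norm (y \<gamma>))\<^sup>2 / 1) \<le> (C * F2_norm fock_weight x)\<^sup>2" if F: "finite F" for F
  proof -
    define q where "q m \<gamma> = (norm (weighted_conv b \<phi> (window N m x) \<gamma>))\<^sup>2" for m \<gamma>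
    \<comment> \<open>A common bound for all window indices that occur at rows in \<open>F\<close>,
      so that the sums over rows and windows can be exchanged.\<close>
    define M where "M = (\<Sum>\<gamma>\<in>F. length \<gamma>) + N"
    have "(norm (y \<gamma>))\<^sup>2 \<le> (1 / real N) * (\<Sum>m<M. q m \<gamma>)" if \<gamma>: "\<gamma> \<in> F" for \<gamma>
    proof -
      let ?I = "{length \<gamma>..<length \<gamma> + N}"
      have "length \<gamma> \<le> (\<Sum>\<gamma>\<in>F. length \<gamma>)" using \<gamma> F by (intro member_le_sum) auto
      then have I: "?I \<subseteq> {..<M}" by (auto simp: M_def)
      have "norm (y \<gamma>) \<le> (1 / real N) * (\<Sum>m\<in>?I. norm (weighted_conv b \<phi> (window N m x) \<gamma>))"
        unfolding y_def fejer_eq_window_sum[OF bc N] norm_scaleR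
        using N by (simp add: divide_right_mono norm_sum)
      then have "(norm (y \<gamma>))\<^sup>2 \<le> ((1 / real N) * (\<Sum>m\<in>?I. norm (weighted_conv b \<phi> (window N m x) \<gamma>)))\<^sup>2"
        by (rule power_mono) simp
      also have "\<dots> = (1 / real N)\<^sup>2 * (\<Sum>m\<in>?I. norm (weighted_conv b \<phi> (window N m x) \<gamma>))\<^sup>2"
        by (rule power_mult_distrib)
      also have "\<dots> \<le> (1 / real N)\<^sup>2 * ((\<Sum>m\<in>?I. q m \<gamma>) * real (card ?I))"
        unfolding q_def by (intro mult_left_mono sum_squared_le_sum_of_squares) auto
      also have "\<dots> = (1 / real N) * (\<Sum>m\<in>?I. q m \<gamma>)"
        using N by (simp add: power2_eq_square)
      also have "\<dots> \<le> (1 / real N) * (\<Sum>m<M. q m \<gamma>)"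
        using I by (intro mult_left_mono sum_mono2) (auto simp: q_def)
      finally show ?thesis .
    qed
    then have "(\<Sum>\<gamma>\<in>F. (norm (y \<gamma>))\<^sup>2 / 1) \<le> (\<Sum>\<gamma>\<in>F. (1 / real N) * (\<Sum>m<M. q m \<gamma>))"
      by (intro sum_mono) simp
    also have "\<dots> = (1 / real N) * (\<Sum>m<M. \<Sum>\<gamma>\<in>F. q m \<gamma>)"
      unfolding sum_distrib_left[symmetric] by (subst sum.swap) (rule refl)
    also have "\<dots> \<le> (1 / real N) * (\<Sum>m<M. C\<^sup>2 * (F2_norm fock_weight (window N m x))\<^sup>2)"
    proof (intro mult_left_mono sum_mono)
      fix m
      have w: "window N m x \<in> Fock" by (rule window_Fock[OF x])
      have "(\<Sum>\<gamma>\<in>F. q m \<gamma>) \<le> (F2_norm fock_weight (weighted_conv b \<phi> (window N m x)))\<^sup>2"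
        using F2_sum_le[OF one_pos cl[OF w] F] by (simp add: q_def)
      also have "\<dots> \<le> (C * F2_norm fock_weight (window N m x))\<^sup>2"
        by (rule power_mono[OF C(2)[OF w] F2_norm_nonneg[OF one_pos]])
      finally show "(\<Sum>\<gamma>\<in>F. q m \<gamma>) \<le> C\<^sup>2 * (F2_norm fock_weight (window N m x))\<^sup>2"
        by (simp add: power_mult_distrib)
    qed simp
    also have "\<dots> = (1 / real N) * (C\<^sup>2 * (\<Sum>m<M. (F2_norm fock_weight (window N m x))\<^sup>2))"
      by (simp add: sum_distrib_left)
    also have "\<dots> \<le> (1 / real N) * (C\<^sup>2 * (real N * (F2_norm fock_weight x)\<^sup>2))"
      by (intro mult_left_mono sum_window_norm_le x) auto
    also have "\<dots> = (C * F2_norm fock_weight x)\<^sup>2"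
      using N by (simp add: power_mult_distrib)
    finally show ?thesis .
  qed
  have nn: "C * F2_norm fock_weight x \<ge> 0" using C(1) F2_norm_nonneg[OF one_pos, of x] by simp
  show "y \<in> Fock" "F2_norm fock_weight y \<le> C * F2_norm fock_weight x"
    by (rule F2_norm_leI'[OF one_pos * nn], assumption)+
qed

section \<open>Fejer means inside the Hardy algebra\<close>

context
  fixes b :: "'n::finite list \<Rightarrow> real"
  assumes pos: "\<And>\<alpha>. b \<alpha> > 0"
    and ratio: "\<And>i. bdd_above (range (\<lambda>\<alpha>. b \<alpha> / b (\<alpha> @ [i])))"
begin

text \<open>The ratio telescopes along the letters of \<alpha>, and each factor is bounded by the
  assumption for one letter.\<close>

lemma weight_ratio_bound: "\<exists>R\<ge>0. \<forall>\<beta>. b \<beta> / b (\<beta> @ \<alpha>) \<le> R"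
proof (induction \<alpha>)
  case Nil
  then show ?case using pos by (intro exI[of _ 1]) (simp add: less_imp_neq[THEN not_sym])
next
  case (Cons i \<alpha>)
  then obtain R where R: "R \<ge> 0" "\<And>\<beta>. b \<beta> / b (\<beta> @ \<alpha>) \<le> R" by blast
  obtain R' where R': "\<And>\<beta>. b \<beta> / b (\<beta> @ [i]) \<le> R'" using ratio[of i] by (auto simp: bdd_above_def)
  have R'0: "R' \<ge> 0" using R'[of "[]"] pos[of "[]"] pos[of "[] @ [i]"] by (smt (verit) divide_pos_pos)
  have "b \<beta> / b (\<beta> @ i # \<alpha>) \<le> R' * R" for \<beta>
  proof -
    have "b \<beta> / b (\<beta> @ i # \<alpha>) = (b \<beta> / b (\<beta> @ [i])) * (b (\<beta> @ [i]) / b ((\<beta> @ [i]) @ \<alpha>))"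
      using pos[of "\<beta> @ [i]"] by simp
    also have "\<dots> \<le> R' * R"
      using pos by (intro mult_mono R R' R'0) (simp add: less_imp_le)
    finally show ?thesis .
  qed
  then show ?case using R R'0 by (intro exI[of _ "R' * R"]) simp
qed

text \<open>Rows not ending in \<alpha> vanish and row \<beta>\<alpha> sees the coordinate \<beta>
  alone, so this is a weighted shift combined with \<open>B\<close>, bounded through the weight
  ratios.\<close>

lemma monomial_bound:
  assumes B: "bounded_clinear (B :: 'k::chilbert \<Rightarrow> 'k)"
  obtains C where "\<And>x. x \<in> Fock \<Longrightarrow> weighted_conv b (monomial_series \<alpha> B) x \<in> Fock"
    and "\<And>x. x \<in> Fock \<Longrightarrow> F2_norm fock_weight (weighted_conv b (monomial_series \<alpha> B) x) \<le> C * F2_norm fock_weight x"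
proof -
  obtain R where R: "R \<ge> 0" "\<And>\<beta>. b \<beta> / b (\<beta> @ \<alpha>) \<le> R" using weight_ratio_bound by blast
  obtain K where K: "K \<ge> 0" "\<And>x. norm (B x) \<le> K * norm x" using bounded_clinear_bound[OF B] by blast
  have *: "(\<Sum>\<gamma>\<in>F. (norm (weighted_conv b (monomial_series \<alpha> B) x \<gamma>))\<^sup>2 / 1) \<le> (sqrt R * K * F2_norm fock_weight x)\<^sup>2"
    if F: "finite F" and x: "x \<in> Fock" for F x
  proof -
    define G where "G = (\<lambda>\<beta>. \<beta> @ \<alpha>) -` F"
    have inj: "inj (\<lambda>\<beta>. \<beta> @ \<alpha>)" by (simp add: inj_on_def)
    have G: "finite G" unfolding G_def by (rule finite_vimageI[OF F inj])
    have "(\<Sum>\<gamma>\<in>F. (norm (weighted_conv b (monomial_series \<alpha> B) x \<gamma>))\<^sup>2 / 1)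
        = (\<Sum>\<gamma>\<in>(\<lambda>\<beta>. \<beta> @ \<alpha>) ` G. (norm (weighted_conv b (monomial_series \<alpha> B) x \<gamma>))\<^sup>2)"
      unfolding div_by_1 using F
      by (intro sum.mono_neutral_right) (auto simp: G_def intro!: weighted_conv_monomial(2))
    also have "\<dots> = (\<Sum>\<beta>\<in>G. (norm (weighted_conv b (monomial_series \<alpha> B) x (\<beta> @ \<alpha>)))\<^sup>2)"
      by (subst sum.reindex) (auto simp: inj_on_def)
    also have "\<dots> \<le> (\<Sum>\<beta>\<in>G. (R * K\<^sup>2) * (norm (x \<beta>))\<^sup>2)"
    proof (rule sum_mono)
      fix \<beta>
      have "(norm (weighted_conv b (monomial_series \<alpha> B) x (\<beta> @ \<alpha>)))\<^sup>2 = (b \<beta> / b (\<beta> @ \<alpha>)) * (norm (B (x \<beta>)))\<^sup>2"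
        using pos[of \<beta>] pos[of "\<beta> @ \<alpha>"] by (simp add: weighted_conv_monomial power_mult_distrib)
      also have "\<dots> \<le> R * (K * norm (x \<beta>))\<^sup>2"
        by (intro mult_mono R K power_mono) simp_all
      finally show "(norm (weighted_conv b (monomial_series \<alpha> B) x (\<beta> @ \<alpha>)))\<^sup>2 \<le> (R * K\<^sup>2) * (norm (x \<beta>))\<^sup>2"
        by (simp add: power_mult_distrib)
    qed
    also have "\<dots> = (R * K\<^sup>2) * (\<Sum>\<beta>\<in>G. (norm (x \<beta>))\<^sup>2)" by (simp add: sum_distrib_left)
    also have "\<dots> \<le> (R * K\<^sup>2) * (F2_norm fock_weight x)\<^sup>2"
      using F2_sum_le[OF one_pos x G] R(1) by (intro mult_left_mono) simp_all
    also have "\<dots> = (sqrt R * K * F2_norm fock_weight x)\<^sup>2" using R(1) by (simp add: power_mult_distrib)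
    finally show ?thesis .
  qed
  have nn: "sqrt R * K * F2_norm fock_weight x \<ge> 0" for x :: "'n list \<Rightarrow> 'k"
    using R(1) K(1) F2_norm_nonneg[OF one_pos, of x] by simp
  show ?thesis
  proof (rule that[of "sqrt R * K"])
    fix x :: "'n list \<Rightarrow> 'k" assume x: "x \<in> Fock"
    show "weighted_conv b (monomial_series \<alpha> B) x \<in> Fock"
      by (rule F2_norm_leI'(1)[OF one_pos *[OF _ x] nn])
    show "F2_norm fock_weight (weighted_conv b (monomial_series \<alpha> B) x) \<le> sqrt R * K * F2_norm fock_weight x"
      by (rule F2_norm_leI'(2)[OF one_pos *[OF _ x] nn])
  qed
qed

lemma monomial_bop:
  assumes B: "bounded_clinear (B :: 'k::chilbert \<Rightarrow> 'k)"
  shows "(\<lambda>x\<in>Fock. weighted_conv b (monomial_series \<alpha> B) x) \<in> bop fock_weight fock_weight"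
proof -
  obtain C where C: "\<And>x. x \<in> Fock \<Longrightarrow> weighted_conv b (monomial_series \<alpha> B) x \<in> Fock"
    "\<And>x. x \<in> Fock \<Longrightarrow> F2_norm fock_weight (weighted_conv b (monomial_series \<alpha> B) x) \<le> C * F2_norm fock_weight x"
    using monomial_bound[OF B] by blast
  show ?thesis
    by (rule bopI[OF one_pos one_pos, where C=C])
      (simp_all add: C F2_add[OF one_pos] F2_scaleC[OF one_pos] weighted_conv_add[OF bounded_clinear_monomial[OF B]]
        weighted_conv_scaleC[OF bounded_clinear_monomial[OF B]])
qed

text \<open>Taking the indicator of \<alpha> as coefficient family leaves the single term of the
  word \<open>rev \<alpha>\<close>: the operator is a product of weighted right creation
  operators.\<close>

lemma monomial_R_infty: "(\<lambda>\<xi>\<in>Fock. weighted_conv b (monomial_series \<alpha> id) \<xi>) \<in> R_infty b"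
proof -
  define c where "c = (\<lambda>\<beta>. if \<beta> = \<alpha> then 1 else 0 :: complex)"
  have eq: "formal_Lambda_sum b c p = weighted_conv b (monomial_series \<alpha> id) p" for p :: "'n list \<Rightarrow> complex"
    unfolding formal_Lambda_sum_eq[OF pos]
    by (rule arg_cong[where f="\<lambda>\<phi>. weighted_conv b \<phi> p"]) (auto simp: monomial_series_def c_def fun_eq_iff)
  have poly: "p \<in> Fock" if "p \<in> fock_polynomials" for p :: "'n list \<Rightarrow> complex"
    using that by (intro F2_finite_support(1)[OF one_pos, of "{\<alpha>. p \<alpha> \<noteq> 0}"]) (auto simp: fock_polynomials_def)
  obtain C where C: "\<And>x. x \<in> Fock \<Longrightarrow>
      F2_norm fock_weight (weighted_conv b (monomial_series \<alpha> (id :: complex \<Rightarrow> complex)) x) \<le> C * F2_norm fock_weight x"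
    using monomial_bound[OF bounded_clinear_id] by blast
  have "(\<lambda>\<beta>. (cmod (c \<beta>))\<^sup>2 * (b \<gamma> / b (\<gamma> @ \<beta>))) summable_on UNIV" for \<gamma>
    unfolding summable_on_def
    by (intro exI, rule has_sum_finite_neutralI[of "{\<alpha>}"]) (auto simp: c_def)
  moreover have "bdd_above ((\<lambda>p. F2_norm fock_weight (formal_Lambda_sum b c p)) `
       {p \<in> fock_polynomials. F2_norm fock_weight p \<le> 1})"
  proof (rule bdd_aboveI2)
    fix p :: "'n list \<Rightarrow> complex" assume p: "p \<in> {p \<in> fock_polynomials. F2_norm fock_weight p \<le> 1}"
    then have "F2_norm fock_weight (formal_Lambda_sum b c p) \<le> C * F2_norm fock_weight p"
      unfolding eq by (intro C poly) simp
    \<comment> \<open>The absolute value is taken because \<open>monomial_bound\<close> says nothing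
      about the sign of \<open>C\<close>.\<close>
    also have "\<dots> \<le> \<bar>C\<bar> * 1"
      using p F2_norm_nonneg[OF one_pos, of p] by (intro mult_mono) auto
    finally show "F2_norm fock_weight (formal_Lambda_sum b c p) \<le> \<bar>C\<bar> * 1" .
  qed
  ultimately show ?thesis
    unfolding R_infty_def using monomial_bop[OF bounded_clinear_id, of \<alpha>] poly eq
    by (intro CollectI conjI exI[of _ c]) auto
qed

lemma monomial_tensor:
  assumes B: "bounded_clinear (B :: 'k::chilbert \<Rightarrow> 'k)"
  shows "is_tensor_op fock_weight fock_weight
    (\<lambda>\<xi>\<in>Fock. weighted_conv b (monomial_series \<alpha> id) \<xi>) B (\<lambda>x\<in>Fock. weighted_conv b (monomial_series \<alpha> B) x)"
  unfolding is_tensor_op_def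
proof (intro conjI ballI allI monomial_bop B)
  fix \<xi> :: "'n list \<Rightarrow> complex" and h :: 'k assume \<xi>: "\<xi> \<in> Fock"
  have t: "tensor_vec \<xi> h \<in> Fock"
  proof (rule F2_mono(1)[OF one_pos])
    show "(\<lambda>\<alpha>. norm h *\<^sub>R \<xi> \<alpha>) \<in> Fock" by (rule F2_scaleR(1)[OF one_pos \<xi>])
  qed (simp add: tensor_vec_def norm_scaleC mult.commute)
  have "weighted_conv b (monomial_series \<alpha> B) (tensor_vec \<xi> h) \<gamma>
      = weighted_conv b (monomial_series \<alpha> id) \<xi> \<gamma> *\<^sub>C B h" for \<gamma>
  proof (cases "\<exists>\<beta>. \<gamma> = \<beta> @ \<alpha>")
    case True
    then obtain \<beta> where \<gamma>: "\<gamma> = \<beta> @ \<alpha>" by blast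
    show ?thesis
      unfolding \<gamma> weighted_conv_monomial
      by (simp add: tensor_vec_def bounded_clinear_scaleC[OF B] scaleR_conv_of_real flip: scaleC_scaleC scaleC_of_real)
  next
    case False
    then show ?thesis by (simp add: weighted_conv_monomial(2))
  qed
  then show "(\<lambda>x\<in>Fock. weighted_conv b (monomial_series \<alpha> B) x) (tensor_vec \<xi> h)
      = tensor_vec ((\<lambda>\<xi>\<in>Fock. weighted_conv b (monomial_series \<alpha> id) \<xi>) \<xi>) (B h)"
    using t \<xi> by (simp add: tensor_vec_def[of "weighted_conv b (monomial_series \<alpha> id) \<xi>"] fun_eq_iff)
qed

text \<open>The weight vanishes outside the finitely many words of length below N, so the mean is a
  finite sum of monomial terms, each of them an elementary tensor.\<close>

lemma fejer_algebraic_tensor: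
  fixes \<phi> :: "'n list \<Rightarrow> 'k::chilbert \<Rightarrow> 'k"
  assumes bc: "\<And>\<alpha>. bounded_clinear (\<phi> \<alpha>)"
  shows "(\<lambda>x\<in>Fock. weighted_conv b (\<lambda>\<alpha> h. fejer_weight N \<alpha> *\<^sub>R \<phi> \<alpha> h) x) \<in> algebraic_tensor (R_infty b)"
proof -
  define W where "W = {\<alpha> :: 'n list. length \<alpha> < N}"
  have W: "finite W"
    unfolding W_def by (rule finite_subset[OF _ finite_words_length_le[of N]]) auto
  \<comment> \<open>\<open>algebraic_tensor\<close> indexes its summands by natural numbers, hence
    the enumeration of the words.\<close>
  obtain e where e: "bij_betw e {..<card W} W"
    using ex_bij_betw_nat_finite[OF W] by (auto simp: atLeast0LessThan)
  define B where "B \<alpha> = (\<lambda>h. fejer_weight N \<alpha> *\<^sub>R \<phi> \<alpha> h)" for \<alpha>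
  have B: "bounded_clinear (B \<alpha>)" for \<alpha> unfolding B_def by (rule bounded_clinear_scaleR_fun[OF bc])
  define S where "S l = (\<lambda>x\<in>Fock. weighted_conv b (monomial_series (e l) (B (e l))) x)" for l
  have "weighted_conv b B x \<gamma> = (\<Sum>\<alpha>\<in>W. weighted_conv b (monomial_series \<alpha> (B \<alpha>)) x \<gamma>)" for x \<gamma>
  proof -
    have "B \<alpha> h = (\<Sum>\<alpha>'\<in>W. monomial_series \<alpha>' (B \<alpha>') \<alpha> h)" for \<alpha> h
    proof (cases "\<alpha> \<in> W")
      case True
      then show ?thesis using W by (simp add: monomial_series_def)
    next
      case False
      then show ?thesis using W by (auto simp: monomial_series_def B_def fejer_weight_def W_def intro!: sum.neutral)
    qed
    then have "weighted_conv b B x \<gamma>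
        = (\<Sum>p | fst p @ snd p = \<gamma>. \<Sum>\<alpha>'\<in>W. sqrt (b (fst p) / b \<gamma>) *\<^sub>R monomial_series \<alpha>' (B \<alpha>') (snd p) (x (fst p)))"
      by (simp add: weighted_conv_def case_prod_unfold scaleR_sum_right)
    also have "\<dots> = (\<Sum>\<alpha>'\<in>W. \<Sum>p | fst p @ snd p = \<gamma>. sqrt (b (fst p) / b \<gamma>) *\<^sub>R monomial_series \<alpha>' (B \<alpha>') (snd p) (x (fst p)))"
      by (rule sum.swap)
    finally show ?thesis by (simp add: weighted_conv_def case_prod_unfold)
  qed
  then have "(\<lambda>x\<in>Fock. weighted_conv b B x) = (\<lambda>x\<in>Fock. \<lambda>\<alpha>. \<Sum>l<card W. S l x \<alpha>)"
    by (auto simp: S_def sum.reindex_bij_betw[OF e, symmetric] intro!: restrict_ext)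
  moreover have "\<exists>A\<in>R_infty b. \<exists>B. bounded_clinear B \<and> is_tensor_op fock_weight fock_weight A B (S l)" for l
    unfolding S_def using monomial_R_infty monomial_tensor[OF B] B by blast
  ultimately show ?thesis
    unfolding algebraic_tensor_def B_def[abs_def] by blast
qed

lemma Psi_subset_hardy_algebra:
  "Psi b ` (right_multipliers b :: ('n list \<Rightarrow> 'k::chilbert \<Rightarrow> 'k) set)
    \<subseteq> wot_closure (op_norm_closure (algebraic_tensor (R_infty b)))"
proof (rule image_subsetI)
  fix \<phi> :: "'n list \<Rightarrow> 'k \<Rightarrow> 'k" assume \<phi>: "\<phi> \<in> right_multipliers b"
  have bc: "\<And>\<alpha>. bounded_clinear (\<phi> \<alpha>)" using \<phi> by (simp add: right_multipliers_def)
  have cl: "\<And>x. x \<in> Fock \<Longrightarrow> weighted_conv b \<phi> x \<in> Fock" using \<phi> by (simp add: right_multiplier_iff[OF pos])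
  let ?T = "Psi b \<phi>"
  have T: "?T \<in> bop fock_weight fock_weight" by (rule Psi_bop[OF pos \<phi>])
  have Teq: "?T x = weighted_conv b \<phi> x" if "x \<in> Fock" for x using that by (simp add: Psi_eq[OF pos \<phi>])
  obtain C where C: "C \<ge> 0" "\<And>x. x \<in> Fock \<Longrightarrow> F2_norm fock_weight (weighted_conv b \<phi> x) \<le> C * F2_norm fock_weight x"
    using bop_bound[OF one_pos one_pos T] Teq by metis
  define \<sigma> where "\<sigma> N = (\<lambda>x\<in>Fock. weighted_conv b (\<lambda>\<alpha> h. fejer_weight N \<alpha> *\<^sub>R \<phi> \<alpha> h) x)" for N
  have bcN: "bounded_clinear (\<lambda>h. fejer_weight N \<alpha> *\<^sub>R \<phi> \<alpha> h)" for N \<alpha> by (rule bounded_clinear_scaleR_fun[OF bc])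
  have bound: "weighted_conv b (\<lambda>\<alpha> h. fejer_weight N \<alpha> *\<^sub>R \<phi> \<alpha> h) x \<in> Fock"
      "F2_norm fock_weight (weighted_conv b (\<lambda>\<alpha> h. fejer_weight N \<alpha> *\<^sub>R \<phi> \<alpha> h) x) \<le> C * F2_norm fock_weight x"
    if "N > 0" "x \<in> Fock" for N x
    using fejer_bound[of \<phi> N b C x] bc cl C that by simp_all
  \<comment> \<open>The index \<open>Suc n\<close> keeps the number of windows positive, as
    \<open>fejer_bound\<close> demands.\<close>
  have \<sigma>: "\<sigma> (Suc n) \<in> op_norm_closure (algebraic_tensor (R_infty b))" for n
  proof -
    have "\<sigma> (Suc n) \<in> bop fock_weight fock_weight"
      unfolding \<sigma>_def
      by (rule bopI[OF one_pos one_pos, where C=C])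
        (simp_all add: bound F2_add[OF one_pos] F2_scaleC[OF one_pos] weighted_conv_add[OF bcN] weighted_conv_scaleC[OF bcN])
    moreover have "\<sigma> (Suc n) \<in> algebraic_tensor (R_infty b)"
      unfolding \<sigma>_def by (rule fejer_algebraic_tensor[OF bc])
    \<comment> \<open>Each mean already lies in the algebraic tensor product, so it approximates
      itself for every \<epsilon>.\<close>
    ultimately show ?thesis
      unfolding op_norm_closure_def
      by (intro CollectI conjI allI impI bexI[of _ "\<sigma> (Suc n)"])
        (simp_all add: F2_norm_nonneg[of fock_weight, OF one_pos] F2_zero(2)[of fock_weight, OF one_pos])
  qed
  have weak: "(\<lambda>n. F2_inner fock_weight (\<lambda>\<alpha>. ?T x \<alpha> - \<sigma> (Suc n) x \<alpha>) y) \<longlonglongrightarrow> 0"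
    if x: "x \<in> Fock" and y: "y \<in> Fock" for x y
  proof (rule F2_inner_tendsto_0[OF _ _ _ y])
    fix n
    have 1: "\<sigma> (Suc n) x \<in> Fock" "F2_norm fock_weight (\<sigma> (Suc n) x) \<le> C * F2_norm fock_weight x"
      using x by (simp_all add: \<sigma>_def bound)
    have 2: "?T x \<in> Fock" "F2_norm fock_weight (?T x) \<le> C * F2_norm fock_weight x"
      using cl[OF x] C(2)[OF x] by (simp_all add: Teq[OF x])
    show "(\<lambda>\<alpha>. ?T x \<alpha> - \<sigma> (Suc n) x \<alpha>) \<in> Fock" by (rule F2_diff(1)[OF one_pos 2(1) 1(1)])
    show "F2_norm fock_weight (\<lambda>\<alpha>. ?T x \<alpha> - \<sigma> (Suc n) x \<alpha>) \<le> 2 * C * F2_norm fock_weight x"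
      using F2_diff(2)[OF one_pos 2(1) 1(1)] 1(2) 2(2) by linarith
  next
    fix \<gamma>
    \<comment> \<open>The convolution at \<gamma> is a finite sum, so it is enough that each weight
      tends to 1.\<close>
    have "(\<lambda>N. weighted_conv b (\<lambda>\<alpha> h. fejer_weight N \<alpha> *\<^sub>R \<phi> \<alpha> h) x \<gamma>)
        \<longlonglongrightarrow> weighted_conv b (\<lambda>\<alpha> h. 1 *\<^sub>R \<phi> \<alpha> h) x \<gamma>"
      unfolding weighted_conv_def case_prod_unfold
      by (intro tendsto_sum tendsto_scaleR tendsto_const fejer_weight_tendsto)
    from LIMSEQ_Suc[OF this] have "(\<lambda>n. \<sigma> (Suc n) x \<gamma>) \<longlonglongrightarrow> ?T x \<gamma>"
      using x by (simp add: \<sigma>_def Teq)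
    from tendsto_diff[OF tendsto_const[of "?T x \<gamma>"] this]
    show "(\<lambda>n. ?T x \<gamma> - \<sigma> (Suc n) x \<gamma>) \<longlonglongrightarrow> 0" by simp
  qed
  show "?T \<in> wot_closure (op_norm_closure (algebraic_tensor (R_infty b)))"
    unfolding wot_closure_def
  proof (intro CollectI conjI T allI impI)
    fix P :: "(('n list \<Rightarrow> 'k) \<times> ('n list \<Rightarrow> 'k)) set" and \<epsilon> :: real
    assume P: "finite P \<and> P \<subseteq> Fock \<times> Fock" and \<epsilon>: "\<epsilon> > 0"
    have "\<forall>p\<in>P. \<forall>\<^sub>F n in sequentially. cmod (F2_inner fock_weight (\<lambda>\<alpha>. ?T (fst p) \<alpha> - \<sigma> (Suc n) (fst p) \<alpha>) (snd p)) < \<epsilon>"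
    proof
      fix p assume "p \<in> P"
      then have "fst p \<in> Fock" "snd p \<in> Fock" using P by auto
      from tendstoD[OF weak[OF this] \<epsilon>]
      show "\<forall>\<^sub>F n in sequentially. cmod (F2_inner fock_weight (\<lambda>\<alpha>. ?T (fst p) \<alpha> - \<sigma> (Suc n) (fst p) \<alpha>) (snd p)) < \<epsilon>"
        by simp
    qed
    \<comment> \<open>Finiteness of \<open>P\<close> lets one index n serve all test pairs.\<close>
    then have "\<forall>\<^sub>F n in sequentially. \<forall>p\<in>P. cmod (F2_inner fock_weight (\<lambda>\<alpha>. ?T (fst p) \<alpha> - \<sigma> (Suc n) (fst p) \<alpha>) (snd p)) < \<epsilon>"
      using P by (intro eventually_ball_finite) auto
    then obtain n where "\<forall>p\<in>P. cmod (F2_inner fock_weight (\<lambda>\<alpha>. ?T (fst p) \<alpha> - \<sigma> (Suc n) (fst p) \<alpha>) (snd p)) < \<epsilon>"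
      using eventually_happens by force
    then show "\<exists>S\<in>op_norm_closure (algebraic_tensor (R_infty b)).
        \<forall>(x, y)\<in>P. cmod (F2_inner fock_weight (\<lambda>\<alpha>. ?T x \<alpha> - S x \<alpha>) y) < \<epsilon>"
      using \<sigma> by (intro bexI[of _ "\<sigma> (Suc n)"]) auto
  qed
qed

end

theorem theorem3p3:
  fixes b :: "'n::finite list \<Rightarrow> real"
  assumes "b [] = 1"
    and "\<And>\<alpha>. b \<alpha> > 0"
    and "\<And>i. bdd_above (range (\<lambda>\<alpha>. b \<alpha> / b (i # \<alpha>)))"
    and "\<And>i. bdd_above (range (\<lambda>\<alpha>. b \<alpha> / b (\<alpha> @ [i])))"
  shows "completely_isometrically_isomorphic
           (right_multiplier_algebra b :: ('n list \<Rightarrow> 'k::chilbert \<Rightarrow> 'k) operator_algebra)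
           (hardy_algebra b :: (('n list \<Rightarrow> 'k) \<Rightarrow> ('n list \<Rightarrow> 'k)) operator_algebra)
       \<and> completely_isometric_isomorphism
           (right_multiplier_algebra b :: ('n list \<Rightarrow> 'k \<Rightarrow> 'k) operator_algebra)
           (hardy_algebra b) (Psi b)"
proof -
  \<comment> \<open>\<open>Psi b\<close> is already a complete isometry onto its range, so equality
    of the carriers finishes the proof.\<close>
  have "wot_closure (op_norm_closure (algebraic_tensor (R_infty b)))
      = Psi b ` (right_multipliers b :: ('n list \<Rightarrow> 'k \<Rightarrow> 'k) set)"
    by (rule antisym[OF hardy_algebra_subset_Psi[of b, OF assms(2,1)] Psi_subset_hardy_algebra[of b, OF assms(2,4)]])
  then have "completely_isometric_isomorphism
      (right_multiplier_algebra b :: ('n list \<Rightarrow> 'k \<Rightarrow> 'k) operator_algebra) (hardy_algebra b) (Psi b)"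
    unfolding hardy_algebra_def using Psi_completely_isometric[of b, OF assms(2)] by simp
  then show ?thesis unfolding completely_isometrically_isomorphic_def by blast
qed

end
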